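(* Let $\mathcal I=\mathbb R_+=[0,\infty)$, let $X=\{x_n\}_{n=1}^\infty$, $d_n=x_n-x_{n-1}$ and $\beta=\{\beta_n\}_{n=1}^\infty\subset\mathbb R\setminus\{0\}$ be as in the context, and let $d_n\to0$ as $n\to\infty$. If there exists a constant $C>0$ such that at least one of the following conditions is satisfied: (i) $\beta_n\ge-Cd_n^3$, $n\in\mathbb N$; (ii) $\beta_n^-\le-C(d_n^{-1}+d_{n+1}^{-1})$, $n\in\mathbb N$, where $\beta_n^-:=\beta_n$ if $\beta_n<0$ and $\beta_n^-:=-\infty$ if $\beta_n>0$; then the spectrum of the operator $\mathrm H_{X,\beta}$ is not discrete.
   Context: $X=\{x_n\}_{n=1}^\infty$, $0=x_0<x_1<x_2<\dots$, $\lim_nx_n=+\infty$; $d_n=x_n-x_{n-1}$; $\beta_n\neq0$ for all $n$. $W^{2,2}(\mathcal I\setminus X)=\{f\in L^2(\mathcal I): f,f'\in AC_{loc}(\mathcal I\setminus X),\ f''\in L^2(\mathcal I)\}$, and $W^{2,2}_{\mathrm{comp}}(\mathcal I\setminus X)$ is the set of its elements with compact support in $\mathcal I=[0,\infty)$. $\mathrm H_{X,\beta}$ is the closure in $L^2(\mathcal I)$ of the symmetric operator $-\mathrm d^2/\mathrm dx^2$ with domain $$\{f\in W^{2,2}_{\mathrm{comp}}(\mathcal I\setminus X): f'(0+)=0,\ f'(x_n+)=f'(x_n-),\ f(x_n+)-f(x_n-)=\beta_nf'(x_n),\ n\in\mathbb N\};$$ for $\mathcal I=\mathbb R_+$ it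 is self-adjoint. A self-adjoint operator has discrete spectrum if its spectrum consists only of isolated eigenvalues of finite multiplicity. *)

theory Defs
  imports "HOL-Analysis.Analysis"
begin

section \<open>The Hilbert space of square integrable functions on the half-line\<close>

text \<open>
  Elements of the space are represented by functions on the half-line; two functions represent the
  same element iff they agree almost everywhere. Values outside the half-line are irrelevant.
\<close>

abbreviation half_line_measure :: "real measure" where
  "half_line_measure \<equiv> lebesgue_on {0..}"

definition L2_half_line :: "(real \<Rightarrow> complex) set" where
  "L2_half_line = {f \<in> borel_measurable half_line_measure.
     integrable half_line_measure (\<lambda>t. (cmod (f t))\<^sup>2)}"

definition L2_norm :: "(real \<Rightarrow> complex) \<Rightarrow> real" where
  "L2_norm f = sqrt (\<integral>t. (cmod (f t))\<^sup>2 \<partial>half_line_measure)"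

definition ae_eq :: "(real \<Rightarrow> complex) \<Rightarrow> (real \<Rightarrow> complex) \<Rightarrow> bool" where
  "ae_eq f g \<longleftrightarrow> (AE t in half_line_measure. f t = g t)"


section \<open>Unbounded operators, given by their graphs\<close>

type_synonym L2_operator = "((real \<Rightarrow> complex) \<times> (real \<Rightarrow> complex)) set"

text \<open>
  The graph of the closure of a closable operator is the closure of its graph. The result is
  automatically saturated under almost everywhere equality in both components.
\<close>

definition op_closure :: "L2_operator \<Rightarrow> L2_operator" where
  "op_closure A = {(f, g). f \<in> L2_half_line \<and> g \<in> L2_half_line \<and>
     (\<exists>F G. (\<forall>k::nat. (F k, G k) \<in> A) \<and>
        (\<lambda>k. L2_norm (\<lambda>t. F k t - f t)) \<longlonglongrightarrow> 0 \<and>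
        (\<lambda>k. L2_norm (\<lambda>t. G k t - g t)) \<longlonglongrightarrow> 0)}"

text \<open>The resolvent set: \<open>A - z\<close> is injective, onto, and has a bounded inverse.\<close>

definition resolvent_set :: "L2_operator \<Rightarrow> complex set" where
  "resolvent_set A = {z.
     (\<forall>(f, g) \<in> A. ae_eq (\<lambda>t. g t - z * f t) (\<lambda>t. 0) \<longrightarrow> ae_eq f (\<lambda>t. 0)) \<and>
     (\<forall>h \<in> L2_half_line. \<exists>(f, g) \<in> A. ae_eq (\<lambda>t. g t - z * f t) h) \<and>
     (\<exists>K. \<forall>(f, g) \<in> A. L2_norm f \<le> K * L2_norm (\<lambda>t. g t - z * f t))}"

definition op_spectrum :: "L2_operator \<Rightarrow> complex set" where
  "op_spectrum A = - resolvent_set A"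

definition eigenspace :: "L2_operator \<Rightarrow> complex \<Rightarrow> (real \<Rightarrow> complex) set" where
  "eigenspace A z = {f. \<exists>g. (f, g) \<in> A \<and> ae_eq g (\<lambda>t. z * f t)}"

definition is_eigenvalue :: "L2_operator \<Rightarrow> complex \<Rightarrow> bool" where
  "is_eigenvalue A z \<longleftrightarrow> (\<exists>f \<in> eigenspace A z. \<not> ae_eq f (\<lambda>t. 0))"

text \<open>Finite-dimensionality is meant modulo almost everywhere equality.\<close>

definition has_finite_multiplicity :: "L2_operator \<Rightarrow> complex \<Rightarrow> bool" where
  "has_finite_multiplicity A z \<longleftrightarrow>
     (\<exists>B. finite B \<and> B \<subseteq> eigenspace A z \<and>
        (\<forall>f \<in> eigenspace A z. \<exists>c. ae_eq f (\<lambda>t. \<Sum>b\<in>B. c b * b t)))"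

text \<open>
  For a self-adjoint operator the algebraic and the geometric multiplicity of an eigenvalue
  coincide, so that the dimension of the eigenspace is the multiplicity.
\<close>

definition has_discrete_spectrum :: "L2_operator \<Rightarrow> bool" where
  "has_discrete_spectrum A \<longleftrightarrow>
     (\<forall>z \<in> op_spectrum A.
        z isolated_in op_spectrum A \<and> is_eigenvalue A z \<and> has_finite_multiplicity A z)"


section \<open>The Sobolev space on the punctured half-line\<close>

definition abs_continuous_on :: "real \<Rightarrow> real \<Rightarrow> (real \<Rightarrow> complex) \<Rightarrow> bool" where
  "abs_continuous_on a b f \<longleftrightarrow>
     (\<forall>\<epsilon>>0. \<exists>\<delta>>0. \<forall>D. D division_of \<Union>D \<and> \<Union>D \<subseteq> {a..b} \<and> (\<Sum>K\<in>D. measure lborel K) < \<delta> \<longrightarrow>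
        (\<Sum>K\<in>D. cmod (f (Sup K) - f (Inf K))) < \<epsilon>)"

definition AC_loc :: "real set \<Rightarrow> (real \<Rightarrow> complex) \<Rightarrow> bool" where
  "AC_loc S f \<longleftrightarrow> (\<forall>a b. a \<le> b \<and> {a..b} \<subseteq> S \<longrightarrow> abs_continuous_on a b f)"

definition interaction_points :: "(nat \<Rightarrow> real) \<Rightarrow> real set" where
  "interaction_points x = x ` {1..}"

definition punctured :: "(nat \<Rightarrow> real) \<Rightarrow> real set" where
  "punctured x = {0..} - interaction_points x"

text \<open>
  The derivative on the punctured half-line, one-sided at the endpoint 0. At points where it does
  not exist its value is unspecified.
\<close>

definition pderivative :: "(nat \<Rightarrow> real) \<Rightarrow> (real \<Rightarrow> complex) \<Rightarrow> real \<Rightarrow> complex" where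
  "pderivative x f t = vector_derivative f (at t within punctured x)"

text \<open>
  An absolutely continuous \<open>f\<close> is the integral of its almost everywhere derivative, so that local
  absolute continuity of \<open>pderivative x f\<close> forces \<open>f\<close> to be continuously differentiable on the
  punctured half-line.
\<close>

definition W22 :: "(nat \<Rightarrow> real) \<Rightarrow> (real \<Rightarrow> complex) set" where
  "W22 x = {f \<in> L2_half_line.
     AC_loc (punctured x) f \<and> AC_loc (punctured x) (pderivative x f) \<and>
     pderivative x (pderivative x f) \<in> L2_half_line}"

definition W22_comp :: "(nat \<Rightarrow> real) \<Rightarrow> (real \<Rightarrow> complex) set" where
  "W22_comp x = {f \<in> W22 x. compact (closure {t \<in> punctured x. f t \<noteq> 0})}"


section \<open>The operator with delta-prime interactions\<close>

definition H_min_domain :: "(nat \<Rightarrow> real) \<Rightarrow> (nat \<Rightarrow> real) \<Rightarrow> (real \<Rightarrow> complex) set" where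
  "H_min_domain x \<beta> = {f \<in> W22_comp x.
     (pderivative x f \<longlongrightarrow> 0) (at_right 0) \<and>
     (\<forall>n\<ge>1. \<exists>fr fl f'.
        (f \<longlongrightarrow> fr) (at_right (x n)) \<and> (f \<longlongrightarrow> fl) (at_left (x n)) \<and>
        (pderivative x f \<longlongrightarrow> f') (at_right (x n)) \<and>
        (pderivative x f \<longlongrightarrow> f') (at_left (x n)) \<and>
        fr - fl = complex_of_real (\<beta> n) * f')}"

definition H_min :: "(nat \<Rightarrow> real) \<Rightarrow> (nat \<Rightarrow> real) \<Rightarrow> L2_operator" where
  "H_min x \<beta> = {(f, \<lambda>t. - pderivative x (pderivative x f) t) | f. f \<in> H_min_domain x \<beta>}"

definition H_op :: "(nat \<Rightarrow> real) \<Rightarrow> (nat \<Rightarrow> real) \<Rightarrow> L2_operator" where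
  "H_op x \<beta> = op_closure (H_min x \<beta>)"

definition gap :: "(nat \<Rightarrow> real) \<Rightarrow> nat \<Rightarrow> real" where
  "gap x n = x n - x (n - 1)"

definition beta_minus :: "(nat \<Rightarrow> real) \<Rightarrow> nat \<Rightarrow> ereal" where
  "beta_minus \<beta> n = (if \<beta> n < 0 then ereal (\<beta> n) else - \<infinity>)"

end

theory Submission
  imports Defs
begin

text \<open>
  If the spectrum of a symmetric operator is discrete, then its inverse at some real regular
  point is a bounded symmetric operator \<open>S\<close> on \<open>L\<^sup>2\<close> which is small off a finite-dimensional space:
  an approximate eigenvalue \<open>\<plusminus>\<parallel>S\<parallel>\<close> always exists, and at an isolated spectral point the
  operator is bounded below on the complement of the kernel. Hence there is no sequence of
  pairwise orthogonal \<open>f\<^sub>k\<close> in the domain with pairwise orthogonal images and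
  \<open>\<parallel>H f\<^sub>k\<parallel> \<le> M \<parallel>f\<^sub>k\<parallel>\<close>.

  Such a sequence exists under either condition. The interface conditions say that
  \<open>df = w dM\<close> for the continuous function \<open>w = f'\<close> and the measure \<open>dM = dx + \<Sum> \<beta>\<^sub>n \<delta>(x - x\<^sub>n)\<close>.
  Take \<open>w\<close> to be a bump of \<open>dM\<close>-integral \<open>1\<close> in \<open>[a, a + 1]\<close> minus one in \<open>[a + 2, a + 3]\<close>;
  then \<open>f = 1\<close> in between, \<open>f\<close> has compact support, and \<open>H f = - w'\<close>. It remains to bound
  \<open>w'\<close> independently of \<open>a\<close>, that is, to find bumps whose \<open>dM\<close>-integral is not small
  compared with their slope. If \<open>\<beta>\<^sub>n \<ge> - C d\<^sub>n\<^sup>3\<close> near \<open>[a, a + 1]\<close>, a fixed bump will do, since the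
  negative part of \<open>dM\<close> tends to zero; otherwise some \<open>\<beta>\<^sub>n \<le> - C (1/d\<^sub>n + 1/d\<^sub>n\<^sub>+\<^sub>1)\<close>, and a bump centred
  at \<open>x\<^sub>n\<close> of width \<open>min d\<^sub>n d\<^sub>n\<^sub>+\<^sub>1\<close> meets no other point.

  Symmetry of \<open>H\<close> is integration by parts, for which absolutely continuous functions have to be
  differentiable almost everywhere and to satisfy the fundamental theorem of calculus.
\<close>

section \<open>Compactness from discrete spectrum\<close>

text \<open>Being an isolated eigenvalue of finite multiplicity says nothing by itself about the
  operator off the eigenspace. In place of the spectral theorem, a distance-to-spectrum estimate for
  the resolvents at nearby regular values yields the lower bound there. The two conditions are not
  treated one after the other; the case distinction is made anew on each unit interval. If the cubic
  bound fails at a point near the middle, that \<open>\<beta>\<^sub>n\<close> is negative, so the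
  first condition is excluded and the second makes \<open>\<beta>\<^sub>n\<close> strongly negative.
  Either sign of the mass is welcome, since a bump gets divided by its mass; the danger is
  cancellation between \<open>dx\<close> and the point masses. A narrow bump is affordable because
  its slope, at most \<open>4 / \<delta>\<close>, and its mass, of order
  \<open>C / \<delta>\<close>, grow together.\<close>

definition regular_value :: "('a::real_inner \<Rightarrow> 'a) \<Rightarrow> real \<Rightarrow> bool" where
  "regular_value S \<mu> \<longleftrightarrow>
     (\<exists>K. \<forall>h. norm h \<le> K * norm (S h - \<mu> *\<^sub>R h)) \<and> (\<forall>k. \<exists>h. S h - \<mu> *\<^sub>R h = k)"

section \<open>Approximate eigenvalues and inverses of bounded symmetric operators\<close>

lemma pos_lower_bound_const:
  assumes "\<exists>K. \<forall>h. norm h \<le> K * norm (T h)"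
  obtains K where "K > 0" "\<And>h. norm h \<le> K * norm (T h)"
proof -
  obtain K where K: "\<And>h. norm h \<le> K * norm (T h)" using assms by blast
  have "norm h \<le> (\<bar>K\<bar> + 1) * norm (T h)" for h
  proof -
    have "K * norm (T h) \<le> (\<bar>K\<bar> + 1) * norm (T h)" by (intro mult_right_mono) auto
    then show ?thesis using K[of h] by linarith
  qed
  then show thesis using that[of "\<bar>K\<bar> + 1"] by auto
qed

text \<open>Were \<open>S - s\<close> and \<open>S + s\<close> both bounded below for
  \<open>s = onorm S\<close>, so would be their product \<open>S\<^sup>2 - s\<^sup>2\<close>.
  Expanding its squared norm by symmetry turns this into
  \<open>norm (S h) \<le> sqrt t * norm h\<close> with \<open>t < s\<^sup>2\<close>, which
  contradicts the definition of the operator norm. The vector \<open>h0\<close> witnesses that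
  \<open>s\<close> exceeds \<open>e\<close>.\<close>

lemma symmetric_approximate_eigenvalue:
  fixes S :: "'a::real_inner \<Rightarrow> 'a"
  assumes S: "bounded_linear S" and sym: "\<And>u v. S u \<bullet> v = u \<bullet> S v"
    and e: "e \<ge> 0" "norm (S h0) > e * norm h0"
  obtains \<mu> where "\<bar>\<mu>\<bar> > e" "\<not> (\<exists>K. \<forall>h. norm h \<le> K * norm (S h - \<mu> *\<^sub>R h))"
proof -
  interpret S: bounded_linear S by fact
  define s where "s = onorm S"
  have le_s: "norm (S h) \<le> s * norm h" for h
    unfolding s_def by (rule onorm[OF S])
  have "h0 \<noteq> 0" using e by (auto simp: S.zero)
  then have "s > e" using le_s[of h0] e
    by (meson mult_right_mono norm_ge_zero not_le order_trans)
  then have s0: "s > 0" using e by linarith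
  have "\<exists>\<mu>\<in>{s,-s}. \<not> (\<exists>K. \<forall>h. norm h \<le> K * norm (S h - \<mu> *\<^sub>R h))"
  proof (rule ccontr)
    assume "\<not> ?thesis"
    then have 1: "\<exists>K. \<forall>h. norm h \<le> K * norm (S h - s *\<^sub>R h)"
      and 2: "\<exists>K. \<forall>h. norm h \<le> K * norm (S h - (-s) *\<^sub>R h)" by blast+
    obtain K1 where K1: "K1 > 0" "\<And>h. norm h \<le> K1 * norm (S h - s *\<^sub>R h)"
      using pos_lower_bound_const[OF 1] by blast
    obtain K2 where K2: "K2 > 0" "\<And>h. norm h \<le> K2 * norm (S h - (-s) *\<^sub>R h)"
      using pos_lower_bound_const[OF 2] by blast
    define C where "C = (K1 * K2)\<^sup>2"
    have C: "C > 0" using K1 K2 by (simp add: C_def)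
    have main: "(norm (S h))\<^sup>2 \<le> (s\<^sup>2 - 1 / (C * s\<^sup>2)) * (norm h)\<^sup>2" for h
    proof -
      have "norm h \<le> K1 * norm (S h - s *\<^sub>R h)" by (rule K1)
      also have "\<dots> \<le> K1 * (K2 * norm (S (S h - s *\<^sub>R h) - (-s) *\<^sub>R (S h - s *\<^sub>R h)))"
        using K1 K2 by (intro mult_left_mono) auto
      also have "S (S h - s *\<^sub>R h) - (-s) *\<^sub>R (S h - s *\<^sub>R h) = S (S h) - s\<^sup>2 *\<^sub>R h"
        by (simp add: S.diff S.scaleR algebra_simps power2_eq_square)
      finally have "norm h \<le> (K1 * K2) * norm (S (S h) - s\<^sup>2 *\<^sub>R h)" by (simp add: mult.assoc)
      then have "(norm h)\<^sup>2 \<le> C * (norm (S (S h) - s\<^sup>2 *\<^sub>R h))\<^sup>2"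
        unfolding C_def by (metis norm_ge_zero power_mono power_mult_distrib)
      also have "(norm (S (S h) - s\<^sup>2 *\<^sub>R h))\<^sup>2 = (norm (S (S h)))\<^sup>2 - 2 * s\<^sup>2 * (norm (S h))\<^sup>2 + s^4 * (norm h)\<^sup>2"
        unfolding power2_norm_eq_inner
        by (simp add: inner_diff_left inner_diff_right sym inner_commute algebra_simps power4_eq_xxxx power2_eq_square)
      also have "(norm (S (S h)))\<^sup>2 \<le> s\<^sup>2 * (norm (S h))\<^sup>2"
        using power_mono[OF le_s[of "S h"], of 2] by (simp add: power_mult_distrib)
      finally have "(norm h)\<^sup>2 \<le> C * (s^4 * (norm h)\<^sup>2 - s\<^sup>2 * (norm (S h))\<^sup>2)"
        using C by (simp add: algebra_simps)
      then have "C * s\<^sup>2 * (norm (S h))\<^sup>2 \<le> (C * s^4 - 1) * (norm h)\<^sup>2"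
        by (simp add: algebra_simps)
      then have "(norm (S h))\<^sup>2 \<le> (C * s^4 - 1) * (norm h)\<^sup>2 / (C * s\<^sup>2)"
        using C s0 by (simp add: field_simps)
      also have "(C * s^4 - 1) * (norm h)\<^sup>2 / (C * s\<^sup>2) = (s\<^sup>2 - 1 / (C * s\<^sup>2)) * (norm h)\<^sup>2"
        using C s0 by (simp add: field_simps power4_eq_xxxx power2_eq_square)
      finally show ?thesis .
    qed
    define t where "t = s\<^sup>2 - 1 / (C * s\<^sup>2)"
    have t: "t < s\<^sup>2" using C s0 by (simp add: t_def)
    have "t \<ge> 0"
    proof -
      have "0 \<le> (norm (S h0))\<^sup>2" by simp
      also have "\<dots> \<le> t * (norm h0)\<^sup>2" using main[of h0] by (simp add: t_def)
      finally show ?thesis using \<open>h0 \<noteq> 0\<close> by (simp add: zero_le_mult_iff)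
    qed
    have "norm (S h) \<le> sqrt t * norm h" for h
      using real_sqrt_le_mono[OF main[of h]] by (simp add: real_sqrt_mult t_def)
    then have "s \<le> sqrt t" unfolding s_def using \<open>t \<ge> 0\<close> by (intro onorm_bound) auto
    moreover have "sqrt t < s" using t s0 real_sqrt_less_mono[OF t] by simp
    ultimately show False by simp
  qed
  then obtain \<mu> where \<mu>: "\<mu> \<in> {s, -s}" "\<not> (\<exists>K. \<forall>h. norm h \<le> K * norm (S h - \<mu> *\<^sub>R h))" by blast
  then have "\<bar>\<mu>\<bar> > e" using \<open>s > e\<close> s0 by auto
  then show thesis using \<mu>(2) by (rule that)
qed

lemma regular_value_inverse:
  fixes S :: "'a::real_inner \<Rightarrow> 'a"
  assumes S: "bounded_linear S" and sym: "\<And>u v. S u \<bullet> v = u \<bullet> S v"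
    and reg: "regular_value S \<mu>"
  obtains R where "bounded_linear R" "\<And>u v. R u \<bullet> v = u \<bullet> R v"
    "\<And>h. S (R h) - \<mu> *\<^sub>R R h = h" "\<And>h. R (S h - \<mu> *\<^sub>R h) = h"
proof -
  interpret S: bounded_linear S by fact
  define T where "T h = S h - \<mu> *\<^sub>R h" for h
  have T: "linear T" unfolding T_def
    by (rule linearI) (simp_all add: S.add S.scaleR algebra_simps)
  have ex: "\<exists>K. \<forall>h. norm h \<le> K * norm (T h)"
    using reg unfolding regular_value_def T_def by blast
  obtain K where K: "K > 0" "\<And>h. norm h \<le> K * norm (T h)"
    using pos_lower_bound_const[OF ex] by blast
  have surj: "\<exists>h. T h = k" for k using reg unfolding regular_value_def T_def by blast
  have inj: "u = v" if "T u = T v" for u v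
    using K(2)[of "u - v"] that by (simp add: linear_diff[OF T])
  define R where "R k = (SOME h. T h = k)" for k
  have TR: "T (R k) = k" for k unfolding R_def by (rule someI_ex[OF surj])
  have RT: "R (T h) = h" for h by (rule inj) (rule TR)
  have "bounded_linear R"
  proof (rule bounded_linear_intro[where K = K])
    show "R (x + y) = R x + R y" for x y by (rule inj) (simp add: TR linear_add[OF T])
    show "R (r *\<^sub>R x) = r *\<^sub>R R x" for r x by (rule inj) (simp add: TR linear_scale[OF T])
    show "norm (R x) \<le> norm x * K" for x using K(2)[of "R x"] by (simp add: TR mult.commute)
  qed
  moreover have "R u \<bullet> v = u \<bullet> R v" for u v
  proof -
    have "R u \<bullet> T (R v) = T (R u) \<bullet> R v"
      unfolding T_def by (simp add: inner_diff_left inner_diff_right sym)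
    then show ?thesis by (simp add: TR)
  qed
  ultimately show thesis using that TR RT unfolding T_def by blast
qed

section \<open>Isolated points of the spectrum\<close>

text \<open>A resolvent of norm above \<open>1 / \<bar>\<eta>\<bar>\<close> would have an
  approximate eigenvalue \<open>\<nu>\<close> beyond that bound, so
  \<open>\<eta> + 1 / \<nu>\<close> would be irregular for \<open>B\<close>. But this number is
  nonzero and of modulus below \<open>2 * \<bar>\<eta>\<bar> < \<delta>\<close>, hence
  regular.\<close>

lemma isolated_zero_resolvent_bound:
  fixes B :: "'a::real_inner \<Rightarrow> 'a"
  assumes B: "bounded_linear B" and sym: "\<And>u v. B u \<bullet> v = u \<bullet> B v"
    and reg: "\<And>\<eta>. 0 < \<bar>\<eta>\<bar> \<Longrightarrow> \<bar>\<eta>\<bar> < \<delta> \<Longrightarrow> regular_value B \<eta>"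
    and \<eta>: "0 < \<bar>\<eta>\<bar>" "2 * \<bar>\<eta>\<bar> < \<delta>"
  shows "\<bar>\<eta>\<bar> * norm h \<le> norm (B h - \<eta> *\<^sub>R h)"
proof (rule ccontr)
  assume neg: "\<not> ?thesis"
  have "regular_value B \<eta>" using reg \<eta> by simp
  then obtain R where R: "bounded_linear R" "\<And>u v. R u \<bullet> v = u \<bullet> R v"
    "\<And>h. B (R h) - \<eta> *\<^sub>R R h = h" "\<And>h. R (B h - \<eta> *\<^sub>R h) = h"
    using regular_value_inverse[OF B sym] by blast
  define h0 where "h0 = B h - \<eta> *\<^sub>R h"
  have "R h0 = h" using R(4) by (simp add: h0_def)
  then have "norm (R h0) > (1 / \<bar>\<eta>\<bar>) * norm h0"
    using neg \<eta> unfolding h0_def by (simp add: field_simps)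
  then obtain \<nu> where \<nu>: "\<bar>\<nu>\<bar> > 1 / \<bar>\<eta>\<bar>"
    "\<not> (\<exists>K. \<forall>k. norm k \<le> K * norm (R k - \<nu> *\<^sub>R k))"
    using symmetric_approximate_eigenvalue[OF R(1,2), of "1 / \<bar>\<eta>\<bar>" h0] \<eta> by auto
  define \<kappa> where "\<kappa> = 1 / \<nu>"
  have "\<bar>\<nu>\<bar> > 0" using \<nu>(1) \<eta> by (smt (verit) divide_nonneg_nonneg)
  then have \<kappa>: "\<bar>\<kappa>\<bar> < \<bar>\<eta>\<bar>" "\<kappa> * \<nu> = 1" "\<nu> \<noteq> 0"
    using \<nu>(1) \<eta> by (auto simp: \<kappa>_def field_simps)
  have "regular_value B (\<eta> + \<kappa>)" using \<kappa> \<eta> by (intro reg) linarith+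
  then have ex: "\<exists>K. \<forall>h. norm h \<le> K * norm (B h - (\<eta> + \<kappa>) *\<^sub>R h)"
    unfolding regular_value_def by blast
  obtain K where K: "K > 0" "\<And>h. norm h \<le> K * norm (B h - (\<eta> + \<kappa>) *\<^sub>R h)"
    using pos_lower_bound_const[OF ex] by blast
  have "norm k \<le> (\<bar>\<kappa>\<bar> * (1 + K * \<bar>\<kappa>\<bar>)) * norm (R k - \<nu> *\<^sub>R k)" for k
  proof -
    let ?d = "R k - \<nu> *\<^sub>R k"
    \<comment> \<open>\<open>R\<close> inverts \<open>B - \<eta>\<close> and
      \<open>\<kappa> * \<nu> = 1\<close>; thus the lower bound for
      \<open>B - (\<eta> + \<kappa>)\<close>, applied at \<open>R k\<close>, bounds
      \<open>R k\<close> by \<open>R k - \<nu> k\<close>.\<close>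
    have eq: "B (R k) - (\<eta> + \<kappa>) *\<^sub>R R k = - \<kappa> *\<^sub>R ?d"
      using R(3)[of k] \<kappa>(2) by (simp add: algebra_simps)
    have 1: "norm (R k) \<le> K * (\<bar>\<kappa>\<bar> * norm ?d)" using K(2)[of "R k"] unfolding eq by simp
    have "k = \<kappa> *\<^sub>R (R k - ?d)" using \<kappa>(2) by simp
    then have "norm k = \<bar>\<kappa>\<bar> * norm (R k - ?d)" by (metis norm_scaleR)
    also have "\<dots> \<le> \<bar>\<kappa>\<bar> * (norm (R k) + norm ?d)" by (intro mult_left_mono norm_triangle_ineq4) auto
    also have "\<dots> \<le> \<bar>\<kappa>\<bar> * (K * (\<bar>\<kappa>\<bar> * norm ?d) + norm ?d)" using 1 by (intro mult_left_mono) auto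
    finally show ?thesis by (simp add: algebra_simps)
  qed
  then show False using \<nu>(2) by blast
qed

text \<open>The resolvent bound near an isolated point dominates the quadratic form of \<open>B\<close> by that of
  \<open>B\<^sup>2\<close>; polarization turns this into a lower bound for \<open>B\<close> on its range.\<close>

lemma isolated_zero_bounded_below_on_range:
  fixes B :: "'a::real_inner \<Rightarrow> 'a"
  assumes B: "bounded_linear B" and sym: "\<And>u v. B u \<bullet> v = u \<bullet> B v"
    and reg: "\<And>\<eta>. 0 < \<bar>\<eta>\<bar> \<Longrightarrow> \<bar>\<eta>\<bar> < \<delta> \<Longrightarrow> regular_value B \<eta>"
    and \<delta>: "\<delta> > 0"
  shows "norm (B u) \<le> (2 / \<delta>) * norm (B (B u))"
proof -
  interpret B: bounded_linear B by fact
  \<comment> \<open>A quarter keeps \<open>2 * \<eta>\<close> below \<open>\<delta>\<close>, as the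
    resolvent bound requires, and gives \<open>1 / (2 * \<eta>) = 2 / \<delta>\<close> at the
    end.\<close>
  define \<eta> where "\<eta> = \<delta> / 4"
  have \<eta>: "\<eta> > 0" "2 * \<eta> < \<delta>" using \<delta> by (auto simp: \<eta>_def)
  \<comment> \<open>The resolvent bounds at \<open>\<eta>\<close> and \<open>- \<eta>\<close> carry
    \<open>\<eta>\<^sup>2 * (norm f)\<^sup>2\<close> on both sides; once it cancels, only the form
    and \<open>norm (B f)\<close> are left.\<close>
  have form: "2 * \<eta> * \<bar>B f \<bullet> f\<bar> \<le> (norm (B f))\<^sup>2" for f
  proof -
    have "(t * norm f)\<^sup>2 \<le> (norm (B f - s *\<^sub>R f))\<^sup>2" if "t = \<bar>s\<bar>" "\<bar>s\<bar> = \<eta>" for s t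
      using isolated_zero_resolvent_bound[where B = B and \<delta> = \<delta> and \<eta> = s and h = f, OF B sym reg] that \<eta> by (intro power_mono) auto
    from this[of \<eta> \<eta>] this[of \<eta> "-\<eta>"] \<eta>
    have "(\<eta> * norm f)\<^sup>2 \<le> (norm (B f - \<eta> *\<^sub>R f))\<^sup>2" "(\<eta> * norm f)\<^sup>2 \<le> (norm (B f + \<eta> *\<^sub>R f))\<^sup>2"
      by auto
    then have "0 \<le> (norm (B f))\<^sup>2 - 2 * \<eta> * (B f \<bullet> f)" "0 \<le> (norm (B f))\<^sup>2 + 2 * \<eta> * (B f \<bullet> f)"
      unfolding power2_norm_eq_inner power_mult_distrib
      by (auto simp: inner_diff_left inner_diff_right inner_add_left inner_add_right inner_commute
          algebra_simps power2_eq_square)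
    then show ?thesis using \<eta> by (simp add: abs_if)
  qed
  have polar: "8 * \<eta> * (B f \<bullet> g) \<le> 2 * (norm (B f))\<^sup>2 + 2 * (norm (B g))\<^sup>2" for f g
  proof -
    have "8 * \<eta> * (B f \<bullet> g) = 2 * \<eta> * (B (f + g) \<bullet> (f + g)) - 2 * \<eta> * (B (f - g) \<bullet> (f - g))"
      by (simp add: B.add B.diff inner_diff_left inner_diff_right inner_add_left inner_add_right
          algebra_simps) (metis inner_commute sym)
    also have "\<dots> \<le> 2 * \<eta> * \<bar>B (f + g) \<bullet> (f + g)\<bar> + 2 * \<eta> * \<bar>B (f - g) \<bullet> (f - g)\<bar>"
    proof -
      have "2 * \<eta> * x \<le> 2 * \<eta> * \<bar>x\<bar>" "- (2 * \<eta> * x) \<le> 2 * \<eta> * \<bar>x\<bar>" for x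
        using \<eta> by (auto simp: abs_if)
      from this(1)[of "B (f + g) \<bullet> (f + g)"] this(2)[of "B (f - g) \<bullet> (f - g)"]
      show ?thesis by linarith
    qed
    also have "\<dots> \<le> (norm (B (f + g)))\<^sup>2 + (norm (B (f - g)))\<^sup>2"
      by (intro add_mono form)
    also have "\<dots> = 2 * (norm (B f))\<^sup>2 + 2 * (norm (B g))\<^sup>2"
      unfolding power2_norm_eq_inner
      by (simp add: B.add B.diff inner_diff_left inner_diff_right inner_add_left inner_add_right
          algebra_simps)
    finally show ?thesis .
  qed
  \<comment> \<open>The factor \<open>2 * \<eta>\<close> is tuned: the left side becomes
    \<open>16 * \<eta>\<^sup>2 * (norm (B u))\<^sup>2\<close>, and the first term on the right is
    half of it and can be absorbed.\<close>
  have *: "8 * \<eta> * (B ((2 * \<eta>) *\<^sub>R u) \<bullet> B u) \<le> 2 * (norm (B ((2 * \<eta>) *\<^sub>R u)))\<^sup>2 + 2 * (norm (B (B u)))\<^sup>2"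
    by (rule polar)
  have "16 * \<eta>\<^sup>2 * (norm (B u))\<^sup>2 \<le> 8 * \<eta>\<^sup>2 * (norm (B u))\<^sup>2 + 2 * (norm (B (B u)))\<^sup>2"
  proof -
    have "B ((2 * \<eta>) *\<^sub>R u) \<bullet> B u = 2 * \<eta> * (norm (B u))\<^sup>2"
      by (simp add: B.scaleR power2_norm_eq_inner)
    moreover have "(norm (B ((2 * \<eta>) *\<^sub>R u)))\<^sup>2 = 4 * \<eta>\<^sup>2 * (norm (B u))\<^sup>2"
      by (simp add: B.scaleR power_mult_distrib)
    ultimately show ?thesis using * by (simp add: power2_eq_square algebra_simps)
  qed
  then have "(2 * \<eta> * norm (B u))\<^sup>2 \<le> (norm (B (B u)))\<^sup>2" by (simp add: power_mult_distrib)
  then have "2 * \<eta> * norm (B u) \<le> norm (B (B u))" by (rule power2_le_imp_le) simp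
  then show ?thesis using \<delta> by (simp add: \<eta>_def field_simps)
qed

text \<open>The vectors \<open>v n = B (R n h)\<close>, with \<open>R n\<close> the inverse of
  \<open>B - \<epsilon> n\<close>, lie in the range of \<open>B\<close>, where the lower bound is
  known. By the resolvent identity they converge to some \<open>w\<close> orthogonal to the kernel
  with \<open>B w = B h\<close>. As \<open>h\<close> is orthogonal to the kernel too,
  \<open>h = w\<close>, and the bound passes to the limit.\<close>

lemma isolated_zero_bounded_below:
  fixes B :: "'a::{real_inner,complete_space} \<Rightarrow> 'a"
  assumes B: "bounded_linear B" and sym: "\<And>u v. B u \<bullet> v = u \<bullet> B v"
    and reg: "\<And>\<eta>. 0 < \<bar>\<eta>\<bar> \<Longrightarrow> \<bar>\<eta>\<bar> < \<delta> \<Longrightarrow> regular_value B \<eta>"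
    and \<delta>: "\<delta> > 0" and h: "\<And>k. B k = 0 \<Longrightarrow> h \<bullet> k = 0"
  shows "norm h \<le> (2 / \<delta>) * norm (B h)"
proof -
  interpret B: bounded_linear B by fact
  define K where "K = 2 / \<delta>"
  have K: "K > 0" and Bu: "norm (B u) \<le> K * norm (B (B u))" for u
    using \<delta> isolated_zero_bounded_below_on_range[OF B sym reg \<delta>] by (auto simp: K_def)
  define \<epsilon> where "\<epsilon> n = \<delta> / (4 * (real n + 1))" for n
  have \<epsilon>: "\<epsilon> n > 0" "2 * \<epsilon> n < \<delta>" for n
  proof -
    have "real n * \<delta> \<ge> 0" using \<delta> by simp
    then show "\<epsilon> n > 0" "2 * \<epsilon> n < \<delta>"
      using \<delta> by (auto simp: \<epsilon>_def divide_simps algebra_simps intro!: add_pos_nonneg)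
  qed
  have \<epsilon>0: "\<epsilon> \<longlonglongrightarrow> 0"
  proof -
    have "(\<lambda>n. (\<delta> / 4) * inverse (real (Suc n))) \<longlonglongrightarrow> (\<delta> / 4) * 0"
      by (intro tendsto_mult_left LIMSEQ_inverse_real_of_nat)
    moreover have "(\<lambda>n. (\<delta> / 4) * inverse (real (Suc n))) = \<epsilon>"
      by (auto simp: \<epsilon>_def field_simps)
    ultimately show ?thesis by (metis mult_zero_right)
  qed
  have "\<forall>n. \<exists>R. bounded_linear R \<and> (\<forall>h. B (R h) - \<epsilon> n *\<^sub>R R h = h) \<and> (\<forall>h. R (B h - \<epsilon> n *\<^sub>R h) = h)"
  proof
    fix n
    have "regular_value B (\<epsilon> n)" using \<epsilon>[of n] by (intro reg) auto
    then show "\<exists>R. bounded_linear R \<and> (\<forall>h. B (R h) - \<epsilon> n *\<^sub>R R h = h) \<and> (\<forall>h. R (B h - \<epsilon> n *\<^sub>R h) = h)"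
      using regular_value_inverse[OF B sym] by metis
  qed
  then obtain R where R: "\<And>n. bounded_linear (R n)"
    "\<And>n h. B (R n h) - \<epsilon> n *\<^sub>R R n h = h" "\<And>n h. R n (B h - \<epsilon> n *\<^sub>R h) = h" by metis
  have R_bound: "norm (\<epsilon> n *\<^sub>R R n k) \<le> norm k" for n k
    using isolated_zero_resolvent_bound[where B = B and \<delta> = \<delta> and \<eta> = "\<epsilon> n" and h = "R n k", OF B sym reg]
      \<epsilon>[of n] by (simp add: R)
  have BR: "B (R n k) = k + \<epsilon> n *\<^sub>R R n k" for n k
    using R(2)[of n k] by (simp add: algebra_simps)
  have BR_bound: "norm (B (R n k)) \<le> 2 * norm k" for n k
    using R_bound[of n k] norm_triangle_ineq[of k "\<epsilon> n *\<^sub>R R n k"] unfolding BR by linarith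
  have comm: "R n (B k) = B (R n k)" for n k
  proof -
    have "R n (B k) - \<epsilon> n *\<^sub>R R n k = k"
      using R(3)[of n k] R(1)[of n] by (simp add: bounded_linear_def linear_diff linear_scale)
    then show ?thesis using BR[of n k] by (simp add: algebra_simps)
  qed
  define v where "v n = B (R n h)" for n
  \<comment> \<open>The resolvents blow up as \<open>\<epsilon> n\<close> tends to 0. The lower
    bound on the range trades \<open>B ?u\<close> for \<open>B (B ?u)\<close>, where each resolvent
    meets its own \<open>B\<close> and costs only a factor 2; hence \<open>K * 4\<close>.\<close>
  have vdiff: "norm (v m - v n) \<le> \<bar>\<epsilon> m - \<epsilon> n\<bar> * (K * (4 * norm h))" for m n
  proof -
    let ?u = "R m (R n h)"
    have 1: "B (R m (R n h)) = R n h + \<epsilon> m *\<^sub>R R m (R n h)" by (rule BR)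
    have 2: "R m (B (R n h)) = R m h + \<epsilon> n *\<^sub>R R m (R n h)"
      unfolding BR[of n] using R(1)[of m] by (simp add: bounded_linear_def linear_add linear_scale)
    have 3: "R n h - R m h = (\<epsilon> n - \<epsilon> m) *\<^sub>R ?u"
      using 1 2 comm[of m "R n h"] by (simp add: algebra_simps)
    have "v m - v n = - B (R n h - R m h)" by (simp add: v_def B.diff)
    also have "\<dots> = (\<epsilon> m - \<epsilon> n) *\<^sub>R B ?u" unfolding 3 B.scaleR by (simp add: algebra_simps)
    finally have "norm (v m - v n) = \<bar>\<epsilon> m - \<epsilon> n\<bar> * norm (B ?u)" by simp
    moreover have "norm (B ?u) \<le> K * (4 * norm h)"
    proof -
      have "norm (B ?u) \<le> K * norm (B (B ?u))" by (rule Bu)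
      also have "B (B ?u) = B (R m (B (R n h)))" by (simp add: comm)
      also have "norm \<dots> \<le> 2 * norm (B (R n h))" by (rule BR_bound)
      also have "\<dots> \<le> 2 * (2 * norm h)" using BR_bound[of n h] by simp
      finally show ?thesis using K by simp
    qed
    ultimately show ?thesis by (simp add: mult_left_mono)
  qed
  have "Cauchy v"
  proof (rule metric_CauchyI)
    fix e :: real assume e: "e > 0"
    define L where "L = K * (4 * norm h) + 1"
    have L: "L > 0" using K by (simp add: L_def add_nonneg_pos)
    from LIMSEQ_imp_Cauchy[OF \<epsilon>0] obtain M where M: "\<And>m n. m \<ge> M \<Longrightarrow> n \<ge> M \<Longrightarrow> dist (\<epsilon> m) (\<epsilon> n) < e / L"
      unfolding Cauchy_def using e L by (meson divide_pos_pos)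
    have "dist (v m) (v n) < e" if "m \<ge> M" "n \<ge> M" for m n
    proof -
      have "dist (v m) (v n) \<le> \<bar>\<epsilon> m - \<epsilon> n\<bar> * L"
        using vdiff[of m n] by (simp add: dist_norm L_def algebra_simps)
      also have "\<dots> < e / L * L"
        using M[OF that] L by (intro mult_strict_right_mono) (auto simp: dist_real_def)
      finally show ?thesis using L by simp
    qed
    then show "\<exists>M. \<forall>m\<ge>M. \<forall>n\<ge>M. dist (v m) (v n) < e" by blast
  qed
  then obtain w where w: "v \<longlonglongrightarrow> w" using Cauchy_convergent convergentD by blast
  have "(\<lambda>n. B (v n)) \<longlonglongrightarrow> B h"
  proof (rule LIM_zero_cancel, rule tendsto_norm_zero_cancel,
      rule tendsto_sandwich[where f = "\<lambda>_. 0" and h = "\<lambda>n. \<epsilon> n * (2 * norm h)"])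
    have "norm (B (v n) - B h) \<le> \<epsilon> n * (2 * norm h)" for n
    proof -
      have "B (v n) - B h = \<epsilon> n *\<^sub>R B (R n h)" unfolding v_def BR[of n h]
        by (simp add: B.add B.scaleR BR scaleR_add_right)
      then show ?thesis using BR_bound[of n h] \<epsilon>[of n] by (simp add: mult_left_mono)
    qed
    then show "\<forall>\<^sub>F n in sequentially. norm (B (v n) - B h) \<le> \<epsilon> n * (2 * norm h)" by simp
    show "(\<lambda>n. \<epsilon> n * (2 * norm h)) \<longlonglongrightarrow> 0" using tendsto_mult_right[OF \<epsilon>0] by simp
  qed auto
  moreover have "(\<lambda>n. B (v n)) \<longlonglongrightarrow> B w" by (rule B.tendsto[OF w])
  ultimately have "B (h - w) = 0" using LIMSEQ_unique by (auto simp: B.diff)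
  then have "h \<bullet> (h - w) = 0" by (rule h)
  moreover have "w \<bullet> (h - w) = 0"
  proof -
    have "v n \<bullet> (h - w) = 0" for n unfolding v_def using \<open>B (h - w) = 0\<close> by (simp add: sym)
    then have "(\<lambda>n. 0) \<longlonglongrightarrow> w \<bullet> (h - w)" using tendsto_inner[OF w tendsto_const[of "h - w"]] by simp
    then show ?thesis using LIMSEQ_unique tendsto_const by metis
  qed
  ultimately have "(h - w) \<bullet> (h - w) = 0" by (simp add: inner_diff_left)
  then have "h = w" by simp
  have "norm w \<le> K * norm (B w)"
  proof (rule tendsto_le[OF sequentially_bot])
    show "(\<lambda>n. norm (v n)) \<longlonglongrightarrow> norm w" by (rule tendsto_norm[OF w])
    show "(\<lambda>n. K * norm (B (v n))) \<longlonglongrightarrow> K * norm (B w)"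
      by (intro tendsto_mult_left tendsto_norm B.tendsto w)
    show "\<forall>\<^sub>F n in sequentially. norm (v n) \<le> K * norm (B (v n))" unfolding v_def using Bu by simp
  qed
  then show ?thesis by (simp add: \<open>h = w\<close> K_def)
qed

text \<open>Solving \<open>(S - \<nu>) h = k\<close> is the fixed point problem
  \<open>h = R (k + (\<nu> - \<mu>) h)\<close>. Within \<open>1 / (2 * K)\<close> of
  \<open>\<mu>\<close> the right side contracts by one half, and the same smallness absorbs the
  perturbation in the lower bound.\<close>

lemma regular_value_open:
  fixes S :: "'a::{real_inner,complete_space} \<Rightarrow> 'a"
  assumes S: "bounded_linear S" and sym: "\<And>u v. S u \<bullet> v = u \<bullet> S v"
    and reg: "regular_value S \<mu>"
  obtains d where "d > 0" "\<And>\<nu>. \<bar>\<nu> - \<mu>\<bar> < d \<Longrightarrow> regular_value S \<nu>"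
proof -
  obtain R where R: "bounded_linear R" "\<And>h. S (R h) - \<mu> *\<^sub>R R h = h" "\<And>h. R (S h - \<mu> *\<^sub>R h) = h"
    using regular_value_inverse[OF S sym reg] by metis
  interpret R: bounded_linear R by fact
  obtain K where K: "K > 0" "\<And>h. norm (R h) \<le> norm h * K" using R.pos_bounded by blast
  have "regular_value S \<nu>" if \<nu>: "\<bar>\<nu> - \<mu>\<bar> < 1 / (2 * K)" for \<nu>
    unfolding regular_value_def
  proof
    define c where "c = \<nu> - \<mu>"
    have c: "\<bar>c\<bar> * K \<le> 1 / 2" using \<nu> K by (simp add: c_def field_simps)
    have "norm h \<le> (2 * K) * norm (S h - \<nu> *\<^sub>R h)" for h
    proof -
      have "norm h \<le> norm (S h - \<mu> *\<^sub>R h) * K" using K(2)[of "S h - \<mu> *\<^sub>R h"] by (simp add: R)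
      also have "S h - \<mu> *\<^sub>R h = (S h - \<nu> *\<^sub>R h) + c *\<^sub>R h" by (simp add: c_def algebra_simps)
      also have "norm \<dots> * K \<le> (norm (S h - \<nu> *\<^sub>R h) + \<bar>c\<bar> * norm h) * K"
        using K norm_triangle_ineq[of "S h - \<nu> *\<^sub>R h" "c *\<^sub>R h"] by (intro mult_right_mono) auto
      also have "\<dots> = norm (S h - \<nu> *\<^sub>R h) * K + (\<bar>c\<bar> * K) * norm h" by (simp add: algebra_simps)
      also have "\<dots> \<le> norm (S h - \<nu> *\<^sub>R h) * K + (1 / 2) * norm h"
        using c by (intro add_left_mono mult_right_mono) auto
      finally show ?thesis by (simp add: algebra_simps)
    qed
    then show "\<exists>K. \<forall>h. norm h \<le> K * norm (S h - \<nu> *\<^sub>R h)" by blast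
    show "\<forall>k. \<exists>h. S h - \<nu> *\<^sub>R h = k"
    proof
      fix k
      have "\<exists>!h. R (k + c *\<^sub>R h) = h"
      proof (rule banach_fix_type[where c = "1/2"])
        have "dist (R (k + c *\<^sub>R x)) (R (k + c *\<^sub>R y)) \<le> 1 / 2 * dist x y" for x y
        proof -
          have "R (k + c *\<^sub>R x) - R (k + c *\<^sub>R y) = R (c *\<^sub>R (x - y))"
            by (simp add: R.diff[symmetric] scaleR_diff_right)
          then have "dist (R (k + c *\<^sub>R x)) (R (k + c *\<^sub>R y)) \<le> (\<bar>c\<bar> * K) * norm (x - y)"
            using K(2)[of "c *\<^sub>R (x - y)"] by (simp add: dist_norm mult_ac)
          also have "\<dots> \<le> 1 / 2 * norm (x - y)" using c by (intro mult_right_mono) auto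
          finally show ?thesis by (simp add: dist_norm)
        qed
        then show "\<forall>x y. dist (R (k + c *\<^sub>R x)) (R (k + c *\<^sub>R y)) \<le> 1 / 2 * dist x y" by blast
      qed auto
      then obtain h where "R (k + c *\<^sub>R h) = h" by blast
      then have "S h - \<mu> *\<^sub>R h = k + c *\<^sub>R h" by (metis R(2))
      then have "S h - \<nu> *\<^sub>R h = k" by (simp add: c_def algebra_simps)
      then show "\<exists>h. S h - \<nu> *\<^sub>R h = k" by blast
    qed
  qed
  then show thesis using K by (intro that[of "1 / (2 * K)"]) auto
qed

section \<open>Splitting off finitely many eigenspaces\<close>

text \<open>Dividing by \<open>b \<bullet> b\<close> replaces normalisation; a zero vector in
  \<open>C\<close> contributes zero because division by zero gives zero.\<close>

lemma orthogonal_sum_projection: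
  fixes C :: "'a::real_inner set"
  assumes "finite C" "pairwise orthogonal C"
  defines "P \<equiv> \<lambda>h. \<Sum>b\<in>C. ((b \<bullet> h) / (b \<bullet> b)) *\<^sub>R b"
  shows "bounded_linear P" "P h \<in> span C" "\<And>c. c \<in> span C \<Longrightarrow> c \<bullet> (h - P h) = 0"
proof -
  have "bounded_linear (\<lambda>h. (b \<bullet> h / (b \<bullet> b)) *\<^sub>R b)" for b :: 'a
    by (intro bounded_linear_scaleR_const bounded_linear_divide bounded_linear_inner_right
        bounded_linear_compose[OF bounded_linear_divide bounded_linear_inner_right])
  then show "bounded_linear P" unfolding P_def by (rule bounded_linear_sum)
  show "P h \<in> span C" unfolding P_def by (intro span_sum span_scale span_base)
  have base: "c \<bullet> (h - P h) = 0" if c: "c \<in> C" for c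
  proof -
    have "c \<bullet> P h = (\<Sum>b\<in>C. (b \<bullet> h) / (b \<bullet> b) * (c \<bullet> b))"
      unfolding P_def by (simp add: inner_sum_right)
    also have "\<dots> = (\<Sum>b\<in>C. if b = c then c \<bullet> h else 0)"
      using assms(2) c by (intro sum.cong) (auto simp: pairwise_def orthogonal_def)
    also have "\<dots> = c \<bullet> h" using c \<open>finite C\<close> by simp
    finally show ?thesis by (simp add: inner_diff_right)
  qed
  show "c \<bullet> (h - P h) = 0" if "c \<in> span C" for c
    using that by (induction rule: span_induct_alt) (auto simp: inner_add_left base)
qed

text \<open>Irregular values cannot accumulate away from 0, so only finitely many have modulus at
  least \<open>e\<close>, and \<open>C\<close> spans their eigenspaces. The compression of
  \<open>S\<close> to the complement of \<open>C\<close> has norm at most \<open>e\<close>: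
  otherwise it had an approximate eigenvalue \<open>\<mu>\<close> with
  \<open>\<bar>\<mu>\<bar> > e\<close>, whereas \<open>S - \<mu>\<close> is bounded below on that
  complement.\<close>

theorem discrete_spectrum_small_complement:
  fixes S :: "'a::{real_inner,complete_space} \<Rightarrow> 'a"
  assumes S: "bounded_linear S" and sym: "\<And>u v. S u \<bullet> v = u \<bullet> S v"
    and iso: "\<And>\<mu>. \<mu> \<noteq> 0 \<Longrightarrow> \<not> regular_value S \<mu> \<Longrightarrow>
       \<exists>\<delta>>0. \<forall>\<nu>. 0 < \<bar>\<nu> - \<mu>\<bar> \<and> \<bar>\<nu> - \<mu>\<bar> < \<delta> \<longrightarrow> regular_value S \<nu>"
    and fin: "\<And>\<mu>. \<mu> \<noteq> 0 \<Longrightarrow> \<not> regular_value S \<mu> \<Longrightarrow> \<exists>B. finite B \<and> {h. S h = \<mu> *\<^sub>R h} \<subseteq> span B"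
    and e: "e > 0"
  shows "\<exists>C. finite C \<and> pairwise orthogonal C \<and>
    (\<forall>h. (\<forall>c\<in>C. c \<bullet> h = 0) \<longrightarrow> norm (S h) \<le> e * norm h)"
proof -
  interpret S: bounded_linear S by fact
  obtain L where L: "L > 0" "\<And>h. norm (S h) \<le> norm h * L" using S.pos_bounded by blast
  \<comment> \<open>Around a regular value this is openness, around an irregular one isolation. Both
    are wanted, because a limit point of \<open>N\<close> is not known to lie in
    \<open>N\<close>.\<close>
  have nbhd: "\<exists>\<delta>>0. \<forall>\<nu>. 0 < \<bar>\<nu> - \<mu>\<bar> \<and> \<bar>\<nu> - \<mu>\<bar> < \<delta> \<longrightarrow> regular_value S \<nu>" if "\<mu> \<noteq> 0" for \<mu>
    using iso[OF that] regular_value_open[OF S sym, of \<mu>] by metis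
  define N where "N = {\<mu>. e \<le> \<bar>\<mu>\<bar> \<and> \<bar>\<mu>\<bar> \<le> L \<and> \<not> regular_value S \<mu>}"
  have "finite N"
  proof (rule ccontr)
    assume "infinite N"
    have "compact ({-L..-e} \<union> {e..L})" by (intro compact_Un compact_Icc)
    moreover have "N \<subseteq> {-L..-e} \<union> {e..L}" by (auto simp: N_def abs_if split: if_splits)
    ultimately obtain \<mu> where \<mu>: "\<mu> \<in> {-L..-e} \<union> {e..L}" "\<mu> islimpt N"
      using \<open>infinite N\<close> unfolding compact_eq_Bolzano_Weierstrass by blast
    then have "\<mu> \<noteq> 0" using e by auto
    from nbhd[OF this] obtain \<delta> where \<delta>: "\<delta> > 0"
      "\<And>\<nu>. 0 < \<bar>\<nu> - \<mu>\<bar> \<Longrightarrow> \<bar>\<nu> - \<mu>\<bar> < \<delta> \<Longrightarrow> regular_value S \<nu>" by blast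
    obtain \<nu> where "\<nu> \<in> N" "\<nu> \<noteq> \<mu>" "dist \<nu> \<mu> < \<delta>"
      using \<mu>(2) \<delta>(1) unfolding islimpt_approachable by blast
    then show False using \<delta>(2)[of \<nu>] by (auto simp: N_def dist_real_def)
  qed
  have "\<forall>\<mu>\<in>N. \<exists>B. finite B \<and> B \<subseteq> {h. S h = \<mu> *\<^sub>R h} \<and> {h. S h = \<mu> *\<^sub>R h} \<subseteq> span B"
  proof
    fix \<mu> assume "\<mu> \<in> N"
    then have "\<mu> \<noteq> 0" "\<not> regular_value S \<mu>" using e by (auto simp: N_def)
    from fin[OF this] obtain A where A: "finite A" "{h. S h = \<mu> *\<^sub>R h} \<subseteq> span A" by blast
    \<comment> \<open>\<open>A\<close> may contain vectors that are not eigenvectors. A maximal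
      independent set of eigenvectors is finite because \<open>A\<close> spans it, and it makes the
      span invariant under \<open>S\<close>.\<close>
    obtain B where B: "B \<subseteq> {h. S h = \<mu> *\<^sub>R h}" "independent B" "{h. S h = \<mu> *\<^sub>R h} \<subseteq> span B"
      using maximal_independent_subset by blast
    have "finite B" using independent_span_bound[OF A(1) B(2)] A(2) B(1) by blast
    then show "\<exists>B. finite B \<and> B \<subseteq> {h. S h = \<mu> *\<^sub>R h} \<and> {h. S h = \<mu> *\<^sub>R h} \<subseteq> span B" using B by blast
  qed
  then obtain B where B: "\<And>\<mu>. \<mu> \<in> N \<Longrightarrow> finite (B \<mu>)" "\<And>\<mu>. \<mu> \<in> N \<Longrightarrow> B \<mu> \<subseteq> {h. S h = \<mu> *\<^sub>R h}"
    "\<And>\<mu>. \<mu> \<in> N \<Longrightarrow> {h. S h = \<mu> *\<^sub>R h} \<subseteq> span (B \<mu>)" by metis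
  have "finite (\<Union>\<mu>\<in>N. B \<mu>)" using \<open>finite N\<close> B(1) by blast
  from basis_orthogonal[OF this] obtain C where C: "finite C" "span C = span (\<Union>\<mu>\<in>N. B \<mu>)" "pairwise orthogonal C"
    by blast
  have SC: "S c \<in> span C" if "c \<in> span C" for c
    using that unfolding C(2)
  proof (induction rule: span_induct_alt)
    case base
    then show ?case by (simp add: S.zero span_zero)
  next
    case (step r x y)
    then obtain \<mu> where "\<mu> \<in> N" "x \<in> B \<mu>" by blast
    then have "S x = \<mu> *\<^sub>R x" using B(2) by blast
    then have "S (r *\<^sub>R x + y) = (r * \<mu>) *\<^sub>R x + S y" by (simp add: S.add S.scaleR)
    then show ?case using step by (simp add: span_add span_scale span_base)
  qed
  define P where "P h = (\<Sum>b\<in>C. ((b \<bullet> h) / (b \<bullet> b)) *\<^sub>R b)" for h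
  have Pl: "bounded_linear P" and P: "\<And>h. P h \<in> span C" "\<And>h c. c \<in> span C \<Longrightarrow> c \<bullet> (h - P h) = 0"
    unfolding P_def using orthogonal_sum_projection[OF C(1,3)] by auto
  interpret P: bounded_linear P by fact
  \<comment> \<open>Three ranges: regular \<open>\<mu>\<close>; irregular \<open>\<mu>\<close> with
    \<open>\<bar>\<mu>\<bar> \<le> L\<close>, isolated and with kernel inside \<open>span C\<close>;
    and \<open>\<bar>\<mu>\<bar> > L\<close>, beyond a bound for the norm of
    \<open>S\<close>.\<close>
  have bound: "\<exists>K. \<forall>q. (\<forall>c\<in>span C. c \<bullet> q = 0) \<longrightarrow> norm q \<le> K * norm (S q - \<mu> *\<^sub>R q)" if \<mu>: "\<bar>\<mu>\<bar> > e" for \<mu>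
  proof (cases "regular_value S \<mu>")
    case True
    then show ?thesis unfolding regular_value_def by blast
  next
    case False
    show ?thesis
    proof (cases "\<bar>\<mu>\<bar> \<le> L")
      case True
      then have "\<mu> \<in> N" using \<mu> False by (simp add: N_def)
      have "\<mu> \<noteq> 0" using \<mu> e by auto
      from nbhd[OF this] obtain \<delta> where \<delta>: "\<delta> > 0"
        "\<And>\<nu>. 0 < \<bar>\<nu> - \<mu>\<bar> \<Longrightarrow> \<bar>\<nu> - \<mu>\<bar> < \<delta> \<Longrightarrow> regular_value S \<nu>" by blast
      define T where "T h = S h - \<mu> *\<^sub>R h" for h
      have "norm q \<le> (2 / \<delta>) * norm (T q)" if q: "\<forall>c\<in>span C. c \<bullet> q = 0" for q
      proof (rule isolated_zero_bounded_below[OF _ _ _ \<delta>(1)])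
        show "bounded_linear T" unfolding T_def
          by (intro bounded_linear_sub S bounded_linear_scaleR_right)
        show "T u \<bullet> v = u \<bullet> T v" for u v
          by (simp add: T_def inner_diff_left inner_diff_right sym)
        show "regular_value T \<eta>" if "0 < \<bar>\<eta>\<bar>" "\<bar>\<eta>\<bar> < \<delta>" for \<eta>
          using \<delta>(2)[of "\<mu> + \<eta>"] that
          by (simp add: regular_value_def T_def algebra_simps)
        show "q \<bullet> k = 0" if "T k = 0" for k
        proof -
          have "k \<in> span (B \<mu>)" using that B(3)[OF \<open>\<mu> \<in> N\<close>] by (auto simp: T_def)
          then have "k \<in> span C" unfolding C(2) using \<open>\<mu> \<in> N\<close> span_mono[of "B \<mu>" "\<Union>\<mu>\<in>N. B \<mu>"] by blast
          then show ?thesis using q by (simp add: inner_commute)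
        qed
      qed
      then show ?thesis unfolding T_def by blast
    next
      case False
      have "norm q \<le> (1 / (\<bar>\<mu>\<bar> - L)) * norm (S q - \<mu> *\<^sub>R q)" for q
      proof -
        have "\<bar>\<mu>\<bar> * norm q \<le> norm (S q) + norm (S q - \<mu> *\<^sub>R q)"
          using norm_triangle_ineq4[of "S q" "S q - \<mu> *\<^sub>R q"] by simp
        then have "(\<bar>\<mu>\<bar> - L) * norm q \<le> norm (S q - \<mu> *\<^sub>R q)"
          using L(2)[of q] by (simp add: algebra_simps)
        then show ?thesis using False by (simp add: field_simps)
      qed
      then show ?thesis by blast
    qed
  qed
  define Q where "Q h = h - P h" for h
  have Ql: "bounded_linear Q" unfolding Q_def by (intro bounded_linear_sub bounded_linear_ident Pl)
  have PQ: "P u \<bullet> Q v = 0" for u v using P unfolding Q_def by blast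
  have Qsym: "Q u \<bullet> v = u \<bullet> Q v" for u v
  proof -
    have "Q u \<bullet> v = Q u \<bullet> Q v + Q u \<bullet> P v" by (simp add: Q_def inner_diff_right)
    also have "\<dots> = Q u \<bullet> Q v + P u \<bullet> Q v" using PQ by (simp add: inner_commute)
    also have "\<dots> = u \<bullet> Q v" by (simp add: Q_def inner_diff_left)
    finally show ?thesis .
  qed
  have SQ: "Q (S (Q h)) = S (Q h)" for h
  proof -
    have "c \<bullet> S (Q h) = 0" if "c \<in> span C" for c
      using P(2)[OF SC[OF that], of h] by (simp add: sym[symmetric] Q_def)
    then have "P (S (Q h)) \<bullet> S (Q h) = 0" "P (S (Q h)) \<bullet> (S (Q h) - P (S (Q h))) = 0" using P by blast+
    then have "P (S (Q h)) \<bullet> P (S (Q h)) = 0" by (simp add: inner_diff_right)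
    then show ?thesis by (simp add: Q_def)
  qed
  have Q_le: "norm (S (Q h)) \<le> e * norm h" for h
  proof (rule ccontr)
    assume neg: "\<not> ?thesis"
    define T where "T h = Q (S (Q h))" for h
    have "bounded_linear T" unfolding T_def
      by (intro bounded_linear_compose[OF Ql] bounded_linear_compose[OF S] Ql)
    moreover have "T u \<bullet> v = u \<bullet> T v" for u v by (simp add: T_def Qsym sym)
    moreover have "norm (T h) > e * norm h" using neg by (simp add: T_def SQ)
    ultimately obtain \<mu> where \<mu>: "\<bar>\<mu>\<bar> > e" "\<not> (\<exists>K. \<forall>h. norm h \<le> K * norm (T h - \<mu> *\<^sub>R h))"
      using symmetric_approximate_eigenvalue[of T e h] e by (metis less_imp_le)
    from bound[OF \<mu>(1)] obtain K where K: "\<And>q. (\<forall>c\<in>span C. c \<bullet> q = 0) \<Longrightarrow> norm q \<le> K * norm (S q - \<mu> *\<^sub>R q)" by blast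
    have "norm k \<le> (\<bar>K\<bar> + 1 / e) * norm (T k - \<mu> *\<^sub>R k)" for k
    proof -
      let ?q = "Q k" and ?p = "P k"
      have q: "\<forall>c\<in>span C. c \<bullet> ?q = 0" using P(2) by (simp add: Q_def)
      \<comment> \<open>\<open>T\<close> kills \<open>span C\<close> and maps into its complement,
        so \<open>T - \<mu>\<close> acts as \<open>S - \<mu>\<close> on \<open>?q\<close> and as
        \<open>- \<mu>\<close> on \<open>?p\<close>. By Pythagoras each part is bounded by the
        whole; \<open>\<bar>\<mu>\<bar> > e\<close> then controls \<open>?p\<close>.\<close>
      have eq: "T k - \<mu> *\<^sub>R k = (S ?q - \<mu> *\<^sub>R ?q) + (- \<mu>) *\<^sub>R ?p"
        unfolding T_def SQ by (simp add: Q_def algebra_simps)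
      have "?p \<bullet> S ?q = 0" using P(2)[OF SC[OF P(1)]] by (simp add: sym[symmetric] Q_def)
      then have orth: "orthogonal (S ?q - \<mu> *\<^sub>R ?q) ((- \<mu>) *\<^sub>R ?p)"
        using PQ[of k k] by (simp add: orthogonal_def inner_diff_right inner_commute[of _ ?p])
      have pyth: "(norm (T k - \<mu> *\<^sub>R k))\<^sup>2 = (norm (S ?q - \<mu> *\<^sub>R ?q))\<^sup>2 + (norm ((- \<mu>) *\<^sub>R ?p))\<^sup>2"
        unfolding eq by (rule norm_add_Pythagorean[OF orth])
      have 1: "norm (S ?q - \<mu> *\<^sub>R ?q) \<le> norm (T k - \<mu> *\<^sub>R k)"
        by (rule power2_le_imp_le) (use pyth in auto)
      have "norm ((- \<mu>) *\<^sub>R ?p) \<le> norm (T k - \<mu> *\<^sub>R k)"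
        by (rule power2_le_imp_le) (use pyth in auto)
      then have "e * norm ?p \<le> norm (T k - \<mu> *\<^sub>R k)"
        using \<mu>(1) mult_right_mono[of e "\<bar>\<mu>\<bar>" "norm ?p"] by simp
      then have 2: "norm ?p \<le> (1 / e) * norm (T k - \<mu> *\<^sub>R k)" using e by (simp add: field_simps)
      have "norm ?q \<le> K * norm (S ?q - \<mu> *\<^sub>R ?q)" using K[OF q] .
      also have "\<dots> \<le> \<bar>K\<bar> * norm (T k - \<mu> *\<^sub>R k)" using 1 by (intro mult_mono) auto
      finally have 3: "norm ?q \<le> \<bar>K\<bar> * norm (T k - \<mu> *\<^sub>R k)" .
      have "norm k \<le> norm ?q + norm ?p" using norm_triangle_ineq[of ?q ?p] by (simp add: Q_def)
      then show ?thesis using 2 3 by (simp add: algebra_simps)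
    qed
    then show False using \<mu>(2) by blast
  qed
  have "norm (S h) \<le> e * norm h" if h: "\<forall>c\<in>C. c \<bullet> h = 0" for h
  proof -
    have "P h = 0" unfolding P_def using h by simp
    then show ?thesis using Q_le[of h] by (simp add: Q_def)
  qed
  then show ?thesis using C(1,3) by blast
qed

text \<open>Bessel's inequality makes the squared coefficients summable.\<close>

lemma orthonormal_inner_tendsto_zero:
  fixes u :: "nat \<Rightarrow> 'a::real_inner"
  assumes "\<And>i j. i \<noteq> j \<Longrightarrow> u i \<bullet> u j = 0" "\<And>i. norm (u i) = 1"
  shows "(\<lambda>k. b \<bullet> u k) \<longlonglongrightarrow> 0"
proof -
  have uu: "u i \<bullet> u j = (if i = j then 1 else 0)" for i j
    using assms by (simp add: dot_square_norm)
  have "(\<Sum>k<n. (b \<bullet> u k)\<^sup>2) \<le> (norm b)\<^sup>2" for n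
  proof -
    let ?p = "\<Sum>k<n. (b \<bullet> u k) *\<^sub>R u k"
    have 1: "b \<bullet> ?p = (\<Sum>k<n. (b \<bullet> u k)\<^sup>2)" by (simp add: inner_sum_right power2_eq_square)
    have 2: "?p \<bullet> ?p = (\<Sum>k<n. (b \<bullet> u k)\<^sup>2)"
      by (simp add: inner_sum_left inner_sum_right uu power2_eq_square if_distrib cong: if_cong)
    have "0 \<le> (b - ?p) \<bullet> (b - ?p)" by simp
    also have "\<dots> = (norm b)\<^sup>2 - (\<Sum>k<n. (b \<bullet> u k)\<^sup>2)"
      using 1 2 by (simp add: inner_diff_left inner_diff_right power2_norm_eq_inner inner_commute)
    finally show ?thesis by simp
  qed
  then have "summable (\<lambda>k. (b \<bullet> u k)\<^sup>2)" by (intro summableI_nonneg_bounded) auto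
  then have "(\<lambda>k. (b \<bullet> u k)\<^sup>2) \<longlonglongrightarrow> 0" by (rule summable_LIMSEQ_zero)
  then have "(\<lambda>k. sqrt ((b \<bullet> u k)\<^sup>2)) \<longlonglongrightarrow> sqrt 0" by (rule tendsto_real_sqrt)
  then show ?thesis by (simp add: tendsto_rabs_zero_iff)
qed

text \<open>The normalised sequence tends weakly to 0, so its projections to the span of the finite
  set \<open>C\<close> tend to 0 in norm. On what remains \<open>S\<close> has norm at most
  \<open>c / 2\<close>, in conflict with the lower bound \<open>c\<close>.\<close>

corollary discrete_spectrum_no_bounded_below_sequence:
  fixes S :: "'a::{real_inner,complete_space} \<Rightarrow> 'a"
  assumes S: "bounded_linear S" and sym: "\<And>u v. S u \<bullet> v = u \<bullet> S v"
    and iso: "\<And>\<mu>. \<mu> \<noteq> 0 \<Longrightarrow> \<not> regular_value S \<mu> \<Longrightarrow>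
       \<exists>\<delta>>0. \<forall>\<nu>. 0 < \<bar>\<nu> - \<mu>\<bar> \<and> \<bar>\<nu> - \<mu>\<bar> < \<delta> \<longrightarrow> regular_value S \<nu>"
    and fin: "\<And>\<mu>. \<mu> \<noteq> 0 \<Longrightarrow> \<not> regular_value S \<mu> \<Longrightarrow> \<exists>B. finite B \<and> {h. S h = \<mu> *\<^sub>R h} \<subseteq> span B"
    and orth: "\<And>i j :: nat. i \<noteq> j \<Longrightarrow> h i \<bullet> h j = 0" and nz: "\<And>i. h i \<noteq> 0"
    and c: "c > 0" "\<And>i. norm (S (h i)) \<ge> c * norm (h i)"
  shows False
proof -
  interpret S: bounded_linear S by fact
  have "c / 2 > 0" using c(1) by simp
  from discrete_spectrum_small_complement[OF S sym iso fin this]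
  obtain C where C: "finite C" "pairwise orthogonal C"
    and small: "\<And>h. \<forall>c\<in>C. c \<bullet> h = 0 \<Longrightarrow> norm (S h) \<le> (c / 2) * norm h"
    by blast
  define P where "P h = (\<Sum>b\<in>C. ((b \<bullet> h) / (b \<bullet> b)) *\<^sub>R b)" for h
  have P: "\<And>h c. c \<in> span C \<Longrightarrow> c \<bullet> (h - P h) = 0"
    unfolding P_def using orthogonal_sum_projection[OF C(1,2)] by auto
  define u where "u k = (1 / norm (h k)) *\<^sub>R h k" for k
  have u: "norm (u k) = 1" for k using nz by (simp add: u_def)
  have "(\<lambda>k. b \<bullet> u k) \<longlonglongrightarrow> 0" for b
    by (rule orthonormal_inner_tendsto_zero) (use orth u in \<open>auto simp: u_def\<close>)
  then have "(\<lambda>k. P (u k)) \<longlonglongrightarrow> (\<Sum>b\<in>C. (0 / (b \<bullet> b)) *\<^sub>R b)"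
    unfolding P_def divide_inverse by (intro tendsto_intros)
  then have P0: "(\<lambda>k. P (u k)) \<longlonglongrightarrow> 0" by simp
  have "c \<le> norm (S (P (u k))) + (c / 2) * norm (u k - P (u k))" for k
  proof -
    have "c \<le> norm (S (u k))"
      using c(2)[of k] nz by (simp add: u_def S.scaleR field_simps)
    also have "S (u k) = S (P (u k)) + S (u k - P (u k))" by (simp add: S.diff)
    also have "norm \<dots> \<le> norm (S (P (u k))) + norm (S (u k - P (u k)))" by (rule norm_triangle_ineq)
    also have "norm (S (u k - P (u k))) \<le> (c / 2) * norm (u k - P (u k))"
      by (rule small) (simp add: P span_base)
    finally show ?thesis by simp
  qed
  then have "c \<le> norm (S (P (u k))) + (c / 2) * (1 + norm (P (u k)))" for k
    using norm_triangle_ineq4[of "u k" "P (u k)"] u[of k] c(1)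
    by (smt (verit) mult_left_mono half_gt_zero)
  moreover have "(\<lambda>k. norm (S (P (u k))) + (c / 2) * (1 + norm (P (u k)))) \<longlonglongrightarrow> norm (S 0) + (c / 2) * (1 + norm (0::'a))"
    by (intro tendsto_intros P0 S.tendsto)
  ultimately have "c \<le> norm (S 0) + (c / 2) * (1 + norm (0::'a))"
    by (intro LIMSEQ_le_const) auto
  then show False using c(1) by (simp add: S.zero)
qed

section \<open>Square integrable functions as a Hilbert space\<close>

lemma L2_half_lineD:
  assumes "f \<in> L2_half_line"
  shows "f \<in> borel_measurable half_line_measure"
    "integrable half_line_measure (\<lambda>t. (cmod (f t))\<^sup>2)"
  using assms by (auto simp: L2_half_line_def)

lemma L2_integrable_bound:
  fixes h :: "real \<Rightarrow> 'a::{banach, second_countable_topology}"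
  assumes f: "f \<in> L2_half_line" and g: "g \<in> L2_half_line"
    and h: "h \<in> borel_measurable half_line_measure"
    and le: "\<And>t. norm (h t) \<le> c * (cmod (f t) * cmod (g t))" and c: "c \<ge> 0"
  shows "integrable half_line_measure h"
proof (rule Bochner_Integration.integrable_bound)
  show "integrable half_line_measure (\<lambda>t. c * ((cmod (f t))\<^sup>2 + (cmod (g t))\<^sup>2))"
    using L2_half_lineD(2)[OF f] L2_half_lineD(2)[OF g] by simp
  have "norm (h t) \<le> c * ((cmod (f t))\<^sup>2 + (cmod (g t))\<^sup>2)" for t
  proof -
    have "cmod (f t) * cmod (g t) \<le> (cmod (f t))\<^sup>2 + (cmod (g t))\<^sup>2"
      using sum_squares_bound[of "cmod (f t)" "cmod (g t)"] mult_nonneg_nonneg[of "cmod (f t)" "cmod (g t)"]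
        norm_ge_zero[of "f t"] norm_ge_zero[of "g t"] by linarith
    then show ?thesis using le[of t] c by (meson mult_left_mono order_trans)
  qed
  then show "AE t in half_line_measure. norm (h t) \<le> norm (c * ((cmod (f t))\<^sup>2 + (cmod (g t))\<^sup>2))"
    using c by simp
qed (fact h)

text \<open>The inner product here is the real one on the complex plane,
  \<open>Re (f t * cnj (g t))\<close>; its integral is the real part of the usual scalar
  product.\<close>

lemma L2_integrable_inner:
  assumes "f \<in> L2_half_line" "g \<in> L2_half_line"
  shows "integrable half_line_measure (\<lambda>t. f t \<bullet> g t)"
proof (rule L2_integrable_bound[OF assms, where c = 1])
  have [measurable]: "f \<in> borel_measurable half_line_measure" "g \<in> borel_measurable half_line_measure"
    using assms L2_half_lineD by auto
  show "(\<lambda>t. f t \<bullet> g t) \<in> borel_measurable half_line_measure" by measurable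
  show "norm (f t \<bullet> g t) \<le> 1 * (cmod (f t) * cmod (g t))" for t
    using Cauchy_Schwarz_ineq2[of "f t" "g t"] by simp
qed simp

lemma L2_zero: "(\<lambda>t. 0) \<in> L2_half_line"
  by (simp add: L2_half_line_def)

lemma L2_cmult:
  assumes "f \<in> L2_half_line"
  shows "(\<lambda>t. c * f t) \<in> L2_half_line"
  using assms by (auto simp: L2_half_line_def norm_mult power_mult_distrib)

lemma L2_scaleR:
  assumes "f \<in> L2_half_line"
  shows "(\<lambda>t. r *\<^sub>R f t) \<in> L2_half_line"
  using L2_cmult[OF assms, of "complex_of_real r"] by (simp add: scaleR_conv_of_real)

lemma L2_add:
  assumes f: "f \<in> L2_half_line" and g: "g \<in> L2_half_line"
  shows "(\<lambda>t. f t + g t) \<in> L2_half_line"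
  unfolding L2_half_line_def
proof safe
  have [measurable]: "f \<in> borel_measurable half_line_measure" "g \<in> borel_measurable half_line_measure"
    using assms L2_half_lineD by auto
  show "(\<lambda>t. f t + g t) \<in> borel_measurable half_line_measure" by measurable
  have "(cmod (f t + g t))\<^sup>2 = (cmod (f t))\<^sup>2 + (cmod (g t))\<^sup>2 + 2 * (f t \<bullet> g t)" for t
    by (simp add: power2_norm_eq_inner inner_add_left inner_add_right inner_commute)
  then show "integrable half_line_measure (\<lambda>t. (cmod (f t + g t))\<^sup>2)"
    using f g by (simp add: L2_half_lineD L2_integrable_inner)
qed

lemma L2_uminus:
  assumes "f \<in> L2_half_line"
  shows "(\<lambda>t. - f t) \<in> L2_half_line"
  using L2_cmult[OF assms, of "-1"] by simp

lemma L2_diff: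
  assumes f: "f \<in> L2_half_line" and g: "g \<in> L2_half_line"
  shows "(\<lambda>t. f t - g t) \<in> L2_half_line"
  using L2_add[OF f L2_uminus[OF g]] by simp

section \<open>The quotient by almost everywhere equality\<close>

text \<open>A partial equivalence: a function that is not square integrable is related to nothing,
  itself included, so the quotient consists of classes of square integrable functions only.\<close>

definition l2_rel :: "(real \<Rightarrow> complex) \<Rightarrow> (real \<Rightarrow> complex) \<Rightarrow> bool" where
  "l2_rel f g \<longleftrightarrow> f \<in> L2_half_line \<and> g \<in> L2_half_line \<and> ae_eq f g"

lemma part_equivp_l2_rel: "part_equivp l2_rel"
proof (rule part_equivpI)
  show "\<exists>x. l2_rel x x" using L2_zero by (auto simp: l2_rel_def ae_eq_def)
  show "symp l2_rel" by (auto simp: symp_def l2_rel_def ae_eq_def eq_commute)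
  show "transp l2_rel" unfolding transp_def l2_rel_def ae_eq_def
    by (auto elim: eventually_elim2)
qed

quotient_type l2 = "real \<Rightarrow> complex" / partial: l2_rel
  by (rule part_equivp_l2_rel)

instantiation l2 :: real_inner
begin

lift_definition zero_l2 :: l2 is "\<lambda>t. 0" by (simp add: l2_rel_def L2_zero ae_eq_def)

lift_definition plus_l2 :: "l2 \<Rightarrow> l2 \<Rightarrow> l2" is "\<lambda>f g t. f t + g t"
  unfolding l2_rel_def ae_eq_def by (auto simp: L2_add elim: eventually_elim2)

lift_definition minus_l2 :: "l2 \<Rightarrow> l2 \<Rightarrow> l2" is "\<lambda>f g t. f t - g t"
  unfolding l2_rel_def ae_eq_def by (auto simp: L2_diff elim: eventually_elim2)

lift_definition uminus_l2 :: "l2 \<Rightarrow> l2" is "\<lambda>f t. - f t"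
  unfolding l2_rel_def ae_eq_def by (auto simp: L2_uminus)

lift_definition scaleR_l2 :: "real \<Rightarrow> l2 \<Rightarrow> l2" is "\<lambda>r f t. r *\<^sub>R f t"
  unfolding l2_rel_def ae_eq_def by (auto simp: L2_scaleR elim: eventually_mono)

lift_definition inner_l2 :: "l2 \<Rightarrow> l2 \<Rightarrow> real" is "\<lambda>f g. \<integral>t. f t \<bullet> g t \<partial>half_line_measure"
proof -
  fix f f' g g' assume "l2_rel f f'" "l2_rel g g'"
  then have *: "f \<in> L2_half_line" "f' \<in> L2_half_line" "g \<in> L2_half_line" "g' \<in> L2_half_line"
    "AE t in half_line_measure. f t = f' t" "AE t in half_line_measure. g t = g' t"
    by (auto simp: l2_rel_def ae_eq_def)
  show "(\<integral>t. f t \<bullet> g t \<partial>half_line_measure) = (\<integral>t. f' t \<bullet> g' t \<partial>half_line_measure)"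
  proof (rule integral_cong_AE)
    show "AE t in half_line_measure. f t \<bullet> g t = f' t \<bullet> g' t" using *(5,6) by eventually_elim simp
  qed (use L2_integrable_inner * in \<open>auto intro: borel_measurable_integrable\<close>)
qed

definition norm_l2 :: "l2 \<Rightarrow> real" where "norm_l2 x = sqrt (x \<bullet> x)"
definition dist_l2 :: "l2 \<Rightarrow> l2 \<Rightarrow> real" where "dist_l2 x y = norm (x - y)"
definition sgn_l2 :: "l2 \<Rightarrow> l2" where "sgn_l2 x = inverse (norm x) *\<^sub>R x"
definition uniformity_l2 :: "(l2 \<times> l2) filter" where
  "uniformity_l2 = (INF e\<in>{0<..}. principal {(x, y). dist x y < e})"
definition open_l2 :: "l2 set \<Rightarrow> bool" where
  "open_l2 U = (\<forall>x\<in>U. eventually (\<lambda>(x', y). x' = x \<longrightarrow> y \<in> U) uniformity)"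

instance
proof
  fix x y z :: l2 and r s :: real
  show "x + y + z = x + (y + z)"
    by transfer (simp add: l2_rel_def ae_eq_def L2_add add_ac)
  show "x + y = y + x"
    by transfer (simp add: l2_rel_def ae_eq_def L2_add add_ac)
  show "0 + x = x"
    by transfer (simp add: l2_rel_def ae_eq_def)
  show "- x + x = 0"
    by transfer (simp add: l2_rel_def ae_eq_def L2_zero)
  show "x - y = x + - y"
    by transfer (simp add: l2_rel_def ae_eq_def L2_diff)
  show "r *\<^sub>R (x + y) = r *\<^sub>R x + r *\<^sub>R y"
    by transfer (simp add: l2_rel_def ae_eq_def L2_add L2_scaleR scaleR_add_right scaleR_add_left)
  show "(r + s) *\<^sub>R x = r *\<^sub>R x + s *\<^sub>R x"
    by transfer (simp add: l2_rel_def ae_eq_def L2_add L2_scaleR scaleR_add_right scaleR_add_left)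
  show "r *\<^sub>R s *\<^sub>R x = (r * s) *\<^sub>R x"
    by transfer (simp add: l2_rel_def ae_eq_def L2_scaleR)
  show "1 *\<^sub>R x = x"
    by transfer (simp add: l2_rel_def ae_eq_def)
  show "dist x y = norm (x - y)" by (rule dist_l2_def)
  show "sgn x = inverse (norm x) *\<^sub>R x" by (rule sgn_l2_def)
  show "uniformity = (INF e\<in>{0<..}. principal {(x::l2, y). dist x y < e})" by (rule uniformity_l2_def)
  show "open U = (\<forall>x\<in>U. eventually (\<lambda>(x', y). x' = x \<longrightarrow> y \<in> U) uniformity)" for U :: "l2 set"
    by (rule open_l2_def)
  show "norm x = sqrt (x \<bullet> x)" by (rule norm_l2_def)
  show "x \<bullet> y = y \<bullet> x" by transfer (simp add: inner_commute)
  show "(x + y) \<bullet> z = x \<bullet> z + y \<bullet> z"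
    by transfer (simp add: l2_rel_def inner_add_left L2_integrable_inner)
  show "(r *\<^sub>R x) \<bullet> y = r * (x \<bullet> y)"
    by transfer simp
  show "0 \<le> x \<bullet> x" by transfer (simp add: inner_ge_zero integral_nonneg_AE)
  show "(x \<bullet> x = 0) = (x = 0)"
  proof (transfer)
    fix f assume f: "l2_rel f f"
    then have "integrable half_line_measure (\<lambda>t. f t \<bullet> f t)" by (simp add: l2_rel_def L2_integrable_inner)
    then have "(\<integral>t. f t \<bullet> f t \<partial>half_line_measure) = 0 \<longleftrightarrow> (AE t in half_line_measure. f t \<bullet> f t = 0)"
      by (intro integral_nonneg_eq_0_iff_AE) auto
    then show "((\<integral>t. f t \<bullet> f t \<partial>half_line_measure) = 0) = l2_rel f (\<lambda>t. 0)"
      using f by (simp add: l2_rel_def ae_eq_def L2_zero)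
  qed
qed

end

lemma abs_l2_eq_iff:
  assumes "f \<in> L2_half_line" "g \<in> L2_half_line"
  shows "abs_l2 f = abs_l2 g \<longleftrightarrow> ae_eq f g"
  using Quotient3_rel[OF Quotient3_l2, of f g] assms by (simp add: l2_rel_def ae_eq_def)

lemma abs_l2_surj: obtains f where "f \<in> L2_half_line" "abs_l2 f = x"
  using Quotient3_abs_rep[OF Quotient3_l2, of x] Quotient3_rep_reflp[OF Quotient3_l2, of x]
  by (intro that[of "rep_l2 x"]) (simp_all add: l2_rel_def)

lemma abs_l2_simps:
  assumes "f \<in> L2_half_line"
  shows "norm (abs_l2 f) = L2_norm f"
    "g \<in> L2_half_line \<Longrightarrow> abs_l2 f + abs_l2 g = abs_l2 (\<lambda>t. f t + g t)"
    "g \<in> L2_half_line \<Longrightarrow> abs_l2 f - abs_l2 g = abs_l2 (\<lambda>t. f t - g t)"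
    "r *\<^sub>R abs_l2 f = abs_l2 (\<lambda>t. r *\<^sub>R f t)"
    "g \<in> L2_half_line \<Longrightarrow> abs_l2 f \<bullet> abs_l2 g = (\<integral>t. f t \<bullet> g t \<partial>half_line_measure)"
proof -
  have *: "l2_rel h h" if "h \<in> L2_half_line" for h using that by (simp add: l2_rel_def ae_eq_def)
  show "norm (abs_l2 f) = L2_norm f"
    by (simp add: norm_l2_def inner_l2.abs_eq * assms L2_norm_def power2_norm_eq_inner)
qed (simp_all add: plus_l2.abs_eq minus_l2.abs_eq scaleR_l2.abs_eq inner_l2.abs_eq assms l2_rel_def ae_eq_def)

section \<open>Completeness of the quotient\<close>

lemma L2_norm_nn_integral:
  assumes "f \<in> L2_half_line"
  shows "(\<integral>\<^sup>+t. ennreal ((cmod (f t))\<^sup>2) \<partial>half_line_measure) = ennreal ((L2_norm f)\<^sup>2)"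
  using nn_integral_eq_integral[OF L2_half_lineD(2)[OF assms]] by (simp add: L2_norm_def)

text \<open>The weights \<open>2 ^ k\<close> trade part of the decay for pointwise control: the
  weighted squares have summable integrals, hence a finite sum almost everywhere, and this forces
  the increments below a geometric sequence of ratio \<open>1 / sqrt 2\<close>.\<close>

lemma L2_fast_Cauchy_AE_convergent:
  assumes F: "\<And>k. F k \<in> L2_half_line"
    and small: "\<And>k. L2_norm (\<lambda>t. F (Suc k) t - F k t) \<le> (1/2) ^ k"
  shows "AE t in half_line_measure. convergent (\<lambda>k. F k t)"
proof -
  define u where "u = (\<lambda>k t. F (Suc k) t - F k t)"
  have u: "u k \<in> L2_half_line" for k unfolding u_def by (intro L2_diff F)
  then have [measurable]: "u k \<in> borel_measurable half_line_measure" for k by (rule L2_half_lineD)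
  have "(\<integral>\<^sup>+t. (\<Sum>k. ennreal (2 ^ k * (cmod (u k t))\<^sup>2)) \<partial>half_line_measure)
      = (\<Sum>k. \<integral>\<^sup>+t. ennreal (2 ^ k * (cmod (u k t))\<^sup>2) \<partial>half_line_measure)"
    by (rule nn_integral_suminf) measurable
  also have "\<dots> \<le> (\<Sum>k. ennreal ((1/2) ^ k))"
  proof (rule suminf_le)
    fix k
    have "(\<integral>\<^sup>+t. ennreal (2 ^ k * (cmod (u k t))\<^sup>2) \<partial>half_line_measure)
      = ennreal (2 ^ k) * ennreal ((L2_norm (u k))\<^sup>2)"
      by (simp add: ennreal_mult nn_integral_cmult L2_norm_nn_integral[OF u])
    also have "\<dots> = ennreal (2 ^ k * (L2_norm (u k))\<^sup>2)" by (simp add: ennreal_mult)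
    also have "\<dots> \<le> ennreal ((1/2) ^ k)"
    proof (rule ennreal_leI)
      have "L2_norm (u k) \<ge> 0" by (simp add: L2_norm_def integral_nonneg_AE)
      then have "(L2_norm (u k))\<^sup>2 \<le> ((1/2) ^ k)\<^sup>2"
        using small[of k] by (intro power_mono) (auto simp: u_def)
      then have "2 ^ k * (L2_norm (u k))\<^sup>2 \<le> 2 ^ k * ((1/2) ^ k)\<^sup>2" by (intro mult_left_mono) auto
      also have "\<dots> = (1/2) ^ k" by (simp add: power2_eq_square power_divide)
      finally show "2 ^ k * (L2_norm (u k))\<^sup>2 \<le> (1/2) ^ k" .
    qed
    finally show "(\<integral>\<^sup>+t. ennreal (2 ^ k * (cmod (u k t))\<^sup>2) \<partial>half_line_measure) \<le> ennreal ((1/2) ^ k)" .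
  qed auto
  also have "\<dots> = ennreal (\<Sum>k. (1/2) ^ k)" by (rule suminf_ennreal2) (auto intro: summable_geometric)
  also have "\<dots> < \<infinity>" by simp
  finally have "AE t in half_line_measure. (\<Sum>k. ennreal (2 ^ k * (cmod (u k t))\<^sup>2)) \<noteq> \<infinity>"
    by (intro nn_integral_PInf_AE) (auto simp: less_top)
  then show ?thesis
  proof eventually_elim
    fix t assume fin: "(\<Sum>k. ennreal (2 ^ k * (cmod (u k t))\<^sup>2)) \<noteq> \<infinity>"
    have "summable (\<lambda>k. 2 ^ k * (cmod (u k t))\<^sup>2)"
      by (rule summable_suminf_not_top) (use fin in auto)
    then have "(\<lambda>k. 2 ^ k * (cmod (u k t))\<^sup>2) \<longlonglongrightarrow> 0" by (rule summable_LIMSEQ_zero)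
    then have "\<forall>\<^sub>F k in sequentially. 2 ^ k * (cmod (u k t))\<^sup>2 < 1" by (rule order_tendstoD) simp
    then have "\<forall>\<^sub>F k in sequentially. norm (u k t) \<le> (1 / sqrt 2) ^ k"
    proof eventually_elim
      case (elim k)
      then have "(cmod (u k t))\<^sup>2 \<le> 1 / 2 ^ k" by (simp add: field_simps)
      also have "\<dots> = ((1 / sqrt 2) ^ k)\<^sup>2"
        by (simp add: power_divide power_mult[symmetric] mult.commute[of k]) (simp add: power_mult)
      finally show ?case by (rule power2_le_imp_le) simp
    qed
    moreover have "summable (\<lambda>k. (1 / sqrt 2) ^ k)" by (rule summable_geometric) simp
    ultimately have "summable (\<lambda>k. u k t)"
      by (rule summable_comparison_test_ev)
    then have "convergent (\<lambda>n. \<Sum>k<n. u k t)" by (simp add: summable_iff_convergent)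
    then have "convergent (\<lambda>n. F 0 t + (\<Sum>k<n. u k t))" by (intro convergent_add convergent_const)
    moreover have "F 0 t + (\<Sum>k<n. u k t) = F n t" for n
      by (induction n) (simp_all add: u_def algebra_simps)
    ultimately show "convergent (\<lambda>k. F k t)" by simp
  qed
qed

text \<open>Fatou's lemma bounds the distance from the pointwise limit \<open>f\<close> to each
  \<open>F k\<close> by the tail estimate. This gives at once that \<open>f\<close> is square
  integrable and that the convergence holds in norm.\<close>

lemma l2_fast_Cauchy_convergent:
  fixes X :: "nat \<Rightarrow> l2"
  assumes small: "\<And>k. norm (X (Suc k) - X k) \<le> (1/2) ^ k"
  shows "convergent X"
proof -
  have "\<forall>k. \<exists>f. f \<in> L2_half_line \<and> abs_l2 f = X k" using abs_l2_surj by metis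
  then obtain F where F: "\<And>k. F k \<in> L2_half_line" "\<And>k. abs_l2 (F k) = X k" by metis
  have [measurable]: "F k \<in> borel_measurable half_line_measure" for k using F(1) by (rule L2_half_lineD)
  have FX: "norm (X j - X k) = L2_norm (\<lambda>t. F j t - F k t)" for j k
    by (simp add: F(2)[symmetric] abs_l2_simps F(1) L2_diff)
  have conv: "AE t in half_line_measure. convergent (\<lambda>k. F k t)"
    by (rule L2_fast_Cauchy_AE_convergent[OF F(1)]) (use small in \<open>simp add: FX\<close>)
  define f where "f t = lim (\<lambda>k. F k t)" for t
  have [measurable]: "f \<in> borel_measurable half_line_measure" unfolding f_def by measurable
  have tail: "norm (X j - X k) \<le> 2 * (1/2) ^ k" if "k \<le> j" for j k
  proof -
    have "norm (X j - X k) \<le> 2 * (1/2) ^ k - 2 * (1/2) ^ j"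
      using that
    proof (induction j rule: dec_induct)
      case (step j)
      then show ?case using small[of j] norm_triangle_ineq[of "X (Suc j) - X j" "X j - X k"] by simp
    qed simp
    moreover have "(1/2 :: real) ^ j \<ge> 0" by simp
    ultimately show ?thesis by linarith
  qed
  have Fatou: "(\<integral>\<^sup>+t. ennreal ((cmod (f t - F k t))\<^sup>2) \<partial>half_line_measure) \<le> ennreal ((2 * (1/2) ^ k)\<^sup>2)" for k
  proof -
    have "(\<integral>\<^sup>+t. ennreal ((cmod (f t - F k t))\<^sup>2) \<partial>half_line_measure)
      = (\<integral>\<^sup>+t. liminf (\<lambda>j. ennreal ((cmod (F j t - F k t))\<^sup>2)) \<partial>half_line_measure)"
    proof (rule nn_integral_cong_AE, use conv in eventually_elim)
      fix t assume "convergent (\<lambda>k. F k t)"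
      then have "(\<lambda>j. F j t) \<longlonglongrightarrow> f t" by (simp add: f_def convergent_LIMSEQ_iff)
      then have "(\<lambda>j. ennreal ((cmod (F j t - F k t))\<^sup>2)) \<longlonglongrightarrow> ennreal ((cmod (f t - F k t))\<^sup>2)"
        by (intro tendsto_ennrealI tendsto_intros)
      from lim_imp_Liminf[OF sequentially_bot this]
      show "ennreal ((cmod (f t - F k t))\<^sup>2) = liminf (\<lambda>j. ennreal ((cmod (F j t - F k t))\<^sup>2))"
        by (rule sym)
    qed
    also have "\<dots> \<le> liminf (\<lambda>j. \<integral>\<^sup>+t. ennreal ((cmod (F j t - F k t))\<^sup>2) \<partial>half_line_measure)"
      by (rule nn_integral_liminf) measurable
    also have "\<dots> = liminf (\<lambda>j. ennreal ((norm (X j - X k))\<^sup>2))"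
      by (simp add: FX L2_norm_nn_integral L2_diff F(1))
    also have "\<dots> \<le> ennreal ((2 * (1/2) ^ k)\<^sup>2)"
    proof -
      have "\<forall>\<^sub>F j in sequentially. ennreal ((norm (X j - X k))\<^sup>2) \<le> ennreal ((2 * (1/2) ^ k)\<^sup>2)"
        using eventually_ge_at_top[of k] by eventually_elim (intro ennreal_leI power_mono tail norm_ge_zero)
      then have "liminf (\<lambda>j. ennreal ((norm (X j - X k))\<^sup>2)) \<le> liminf (\<lambda>j::nat. ennreal ((2 * (1/2) ^ k)\<^sup>2))"
        by (rule Liminf_mono)
      then show ?thesis by (simp add: Liminf_const)
    qed
    finally show ?thesis .
  qed
  have d: "(\<lambda>t. f t - F k t) \<in> L2_half_line" for k
  proof -
    have "integrable half_line_measure (\<lambda>t. (cmod (f t - F k t))\<^sup>2)"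
    proof (rule integrableI_bounded)
      show "(\<integral>\<^sup>+t. ennreal (norm ((cmod (f t - F k t))\<^sup>2)) \<partial>half_line_measure) < \<infinity>"
        using le_less_trans[OF Fatou[of k]] by simp
    qed measurable
    then show ?thesis by (simp add: L2_half_line_def)
  qed
  have f: "f \<in> L2_half_line" using L2_add[OF d[of 0] F(1)[of 0]] by simp
  have "norm (X k - abs_l2 f) \<le> 2 * (1/2) ^ k" for k
  proof -
    have "norm (X k - abs_l2 f) = norm (abs_l2 f - X k)" by (rule norm_minus_commute)
    also have "\<dots> = L2_norm (\<lambda>t. f t - F k t)" by (simp add: F(2)[symmetric] abs_l2_simps F(1) f L2_diff)
    also have "\<dots> \<le> 2 * (1/2) ^ k"
    proof (rule power2_le_imp_le)
      show "(L2_norm (\<lambda>t. f t - F k t))\<^sup>2 \<le> (2 * (1/2) ^ k)\<^sup>2"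
        using Fatou[of k] unfolding L2_norm_nn_integral[OF d] by (simp add: ennreal_le_iff)
    qed simp
    finally show ?thesis .
  qed
  then have bound: "\<forall>\<^sub>F k in sequentially. norm (X k - abs_l2 f) \<le> 2 * (1/2) ^ k" by simp
  have "(\<lambda>k. 2 * (1/2 :: real) ^ k) \<longlonglongrightarrow> 2 * 0"
    by (intro tendsto_mult_left LIMSEQ_realpow_zero) auto
  then have "(\<lambda>k. X k - abs_l2 f) \<longlonglongrightarrow> 0"
    using Lim_null_comparison[OF bound] by simp
  then have "X \<longlonglongrightarrow> abs_l2 f" by (rule LIM_zero_cancel)
  then show ?thesis by (rule convergentI)
qed

instance l2 :: complete_space
proof
  fix X :: "nat \<Rightarrow> l2" assume X: "Cauchy X"
  have "\<forall>k. \<exists>M. \<forall>m\<ge>M. \<forall>n\<ge>M. norm (X m - X n) < (1/2) ^ k"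
    using X unfolding Cauchy_def dist_norm by simp
  then obtain M where M: "\<And>k m n. m \<ge> M k \<Longrightarrow> n \<ge> M k \<Longrightarrow> norm (X m - X n) < (1/2) ^ k" by metis
  \<comment> \<open>Adding \<open>M (Suc k)\<close> to the successor secures strict growth and
    \<open>r k \<ge> M k\<close> together.\<close>
  define r where "r = rec_nat (M 0) (\<lambda>k m. Suc m + M (Suc k))"
  have r_Suc: "r (Suc k) = Suc (r k) + M (Suc k)" for k by (simp add: r_def)
  have r: "r k \<ge> M k" for k by (cases k) (simp_all add: r_def)
  have r_mono: "strict_mono r" by (rule strict_monoI_Suc) (simp add: r_Suc)
  have "norm ((X \<circ> r) (Suc k) - (X \<circ> r) k) \<le> (1/2) ^ k" for k
    unfolding comp_def by (intro less_imp_le M r order_trans[OF r[of k]]) (simp add: r_Suc)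
  then have "convergent (X \<circ> r)" by (rule l2_fast_Cauchy_convergent)
  then obtain L where "(X \<circ> r) \<longlonglongrightarrow> L" by (auto simp: convergent_def)
  then have "X \<longlonglongrightarrow> L" by (rule Cauchy_converges_subseq[OF X r_mono])
  then show "convergent X" by (rule convergentI)
qed

section \<open>Absolutely continuous functions\<close>

text \<open>Stated for any normed codomain, because real and imaginary parts and inner products of
  the given functions are real-valued. The intervals of a division may touch and may degenerate to
  points.\<close>

definition ac_on :: "real \<Rightarrow> real \<Rightarrow> (real \<Rightarrow> 'a::real_normed_vector) \<Rightarrow> bool" where
  "ac_on a b f \<longleftrightarrow>
     (\<forall>\<epsilon>>0. \<exists>\<delta>>0. \<forall>D. D division_of \<Union>D \<and> \<Union>D \<subseteq> {a..b} \<and> (\<Sum>K\<in>D. measure lborel K) < \<delta> \<longrightarrow>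
        (\<Sum>K\<in>D. norm (f (Sup K) - f (Inf K))) < \<epsilon>)"

lemma abs_continuous_on_iff: "abs_continuous_on a b f \<longleftrightarrow> ac_on a b f"
  by (simp add: abs_continuous_on_def ac_on_def)

lemma ac_onD:
  assumes "ac_on a b f" "\<epsilon> > 0"
  obtains \<delta> where "\<delta> > 0"
    "\<And>D. D division_of \<Union>D \<Longrightarrow> \<Union>D \<subseteq> {a..b} \<Longrightarrow> (\<Sum>K\<in>D. measure lborel K) < \<delta>
       \<Longrightarrow> (\<Sum>K\<in>D. norm (f (Sup K) - f (Inf K))) < \<epsilon>"
proof -
  from assms(1)[unfolded ac_on_def, THEN spec, THEN mp, OF assms(2)]
  obtain \<delta> where "\<delta> > 0" and *: "\<forall>D. D division_of \<Union>D \<and> \<Union>D \<subseteq> {a..b} \<and> (\<Sum>K\<in>D. measure lborel K) < \<delta> \<longrightarrow>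
        (\<Sum>K\<in>D. norm (f (Sup K) - f (Inf K))) < \<epsilon>" by (elim exE conjE)
  show thesis by (rule that[OF \<open>\<delta> > 0\<close>]) (rule *[THEN spec, THEN mp], intro conjI)
qed

lemma division_telescope:
  fixes f :: "real \<Rightarrow> 'a::real_normed_vector"
  assumes "a \<le> b" and q: "q division_of {a..b}"
  shows "(\<Sum>K\<in>q. f (Sup K) - f (Inf K)) = f b - f a"
proof -
  define p where "p = (\<lambda>K. (Inf K, K)) ` q"
  have nonempty: "K \<noteq> {} \<and> (\<exists>u v. u \<le> v \<and> K = {u..v})" if K: "K \<in> q" for K
  proof -
    have "K \<noteq> {}" using division_ofD(3)[OF q K] .
    moreover obtain u v where "K = cbox u v" using division_ofD(4)[OF q K] by blast
    ultimately show ?thesis by force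
  qed
  have "p tagged_division_of {a..b}"
  proof (rule tagged_division_ofI)
    show "finite p" using division_ofD(1)[OF q] by (simp add: p_def)
    show "x \<in> K" "K \<subseteq> {a..b}" "\<exists>u v. K = cbox u v" if "(x, K) \<in> p" for x K
      using that nonempty division_ofD(2)[OF q] by (fastforce simp: p_def)+
    show "interior K1 \<inter> interior K2 = {}" if "(x1, K1) \<in> p" "(x2, K2) \<in> p" "(x1, K1) \<noteq> (x2, K2)" for x1 K1 x2 K2
      using that division_ofD(5)[OF q] by (auto simp: p_def)
    have "{K. \<exists>x. (x, K) \<in> p} = q" by (auto simp: p_def)
    then show "\<Union>{K. \<exists>x. (x, K) \<in> p} = {a..b}" using division_ofD(6)[OF q] by simp
  qed
  from additive_tagged_division_1[OF assms(1) this, of f]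
  show ?thesis by (simp add: p_def sum.reindex inj_on_def)
qed

section \<open>Vitali covers by finitely many intervals\<close>

text \<open>Closed intervals are balls of the line, so the Vitali covering theorem leaves a null
  set, and continuity of the measure truncates the countable family to a finite one.
  \<open>Z\<close> collects the dropped intervals and the null set; it is measurable even where
  \<open>S\<close> is not.\<close>

lemma finite_Vitali_cover:
  fixes S :: "real set"
  assumes Q: "\<And>x d. x \<in> S \<Longrightarrow> 0 < d \<Longrightarrow> \<exists>u v. u \<le> x \<and> x \<le> v \<and> u < v \<and> v - u < d \<and> Q u v"
    and bounded: "\<And>u v. Q u v \<Longrightarrow> a \<le> u \<and> v \<le> b"
    and \<kappa>: "\<kappa> > 0"
  obtains F Z where "finite F" "\<forall>K\<in>F. \<exists>u v. K = {u..v} \<and> u < v \<and> Q u v"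
    "pairwise disjnt F" "Z \<in> lmeasurable" "measure lebesgue Z \<le> \<kappa>" "S \<subseteq> \<Union>F \<union> Z"
proof -
  define I where "I = {(u, v). u < v \<and> Q u v}"
  define c where "c = (\<lambda>(u :: real, v). (u + v) / 2)"
  define r where "r = (\<lambda>(u :: real, v). (v - u) / 2)"
  have cb: "cball (c (u, v)) (r (u, v)) = {u..v}" for u v
    by (simp add: cball_eq_atLeastAtMost c_def r_def field_simps)
  have rpos: "0 < r i" if "i \<in> I" for i using that by (auto simp: I_def r_def)
  have cover: "\<exists>i. i \<in> I \<and> x \<in> cball (c i) (r i) \<and> r i < d" if x: "x \<in> S" "0 < d" for x d
  proof -
    obtain u v where "u \<le> x" "x \<le> v" "u < v" "v - u < d" "Q u v" using Q[OF x] by blast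
    then have "(u, v) \<in> I" "x \<in> cball (c (u, v)) (r (u, v))" "r (u, v) < d"
      using x unfolding cb by (auto simp: I_def r_def)
    then show ?thesis by blast
  qed
  obtain C where C: "countable C" "C \<subseteq> I"
    "pairwise (\<lambda>i j. disjnt (cball (c i) (r i)) (cball (c j) (r j))) C"
    "negligible (S - (\<Union>i\<in>C. cball (c i) (r i)))"
    using Vitali_covering_theorem_cballs[of I r S c] rpos cover by blast
  define B where "B i = cball (c i) (r i)" for i
  have B: "\<exists>u v. B i = {u..v} \<and> u < v \<and> Q u v" if "i \<in> C" for i
  proof -
    obtain u v where "i = (u, v)" by (cases i)
    then show ?thesis using that C(2) cb[of u v] by (auto simp: B_def I_def)
  qed
  have BC: "(\<Union>i\<in>C. B i) \<subseteq> {a..b}" using B bounded by fastforce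
  show thesis
  proof (cases "C = {}")
    case True
    then have "negligible S" using C(4) by simp
    then show thesis
      using that[of "{}" S] \<kappa> by (auto simp: negligible_iff_measure)
  next
    case False
    define A where "A n = (\<Union>i\<in>from_nat_into C ` {..<n}. B i)" for n
    have "(\<Union>n. A n) = (\<Union>i\<in>range (from_nat_into C). B i)" unfolding A_def by auto
    then have UA: "(\<Union>n. A n) = (\<Union>i\<in>C. B i)"
      using range_from_nat_into[OF False C(1)] by simp
    have Am: "A n \<in> sets lebesgue" for n unfolding A_def B_def by auto
    have Um: "(\<Union>i\<in>C. B i) \<in> lmeasurable"
    proof (rule fmeasurableI2[of "{a..b}"])
      show "(\<Union>i\<in>C. B i) \<in> sets lebesgue" unfolding UA[symmetric] using Am by blast
    qed (use BC in auto)
    have "(\<lambda>n. measure lebesgue (A n)) \<longlonglongrightarrow> measure lebesgue (\<Union>n. A n)"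
    proof (rule Lim_measure_incseq)
      show "range A \<subseteq> sets lebesgue" using Am by auto
      show "incseq A" unfolding incseq_def A_def by fastforce
      show "emeasure lebesgue (\<Union>n. A n) \<noteq> \<infinity>" unfolding UA infinity_ennreal_def by (rule fmeasurableD2[OF Um])
    qed
    then have "\<forall>\<^sub>F n in sequentially. measure lebesgue (A n) > measure lebesgue (\<Union>n. A n) - \<kappa>"
      by (rule order_tendstoD(1)) (use \<kappa> in simp)
    then obtain n where n: "measure lebesgue (A n) > measure lebesgue (\<Union>i\<in>C. B i) - \<kappa>"
      unfolding UA by (auto simp: eventually_sequentially)
    define F where "F = B ` from_nat_into C ` {..<n}"
    define N where "N = S - (\<Union>i\<in>C. B i)"
    define Z where "Z = ((\<Union>i\<in>C. B i) - A n) \<union> N"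
    have sub: "from_nat_into C ` {..<n} \<subseteq> C" using from_nat_into[OF False] by auto
    have AU: "A n \<subseteq> (\<Union>i\<in>C. B i)" unfolding A_def using sub by blast
    have Anm: "A n \<in> lmeasurable" by (rule fmeasurableI2[OF Um AU Am])
    have Nn: "negligible N" using C(4) by (simp add: N_def B_def)
    show thesis
    proof (rule that[of F Z])
      show "finite F" by (simp add: F_def)
      show "\<forall>K\<in>F. \<exists>u v. K = {u..v} \<and> u < v \<and> Q u v"
        using B sub unfolding F_def by blast
      show "pairwise disjnt F"
      proof (rule pairwiseI)
        fix K L assume KL: "K \<in> F" "L \<in> F" "K \<noteq> L"
        obtain i where i: "i \<in> C" "K = B i" using KL(1) sub unfolding F_def by force
        obtain j where j: "j \<in> C" "L = B j" using KL(2) sub unfolding F_def by force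
        have "i \<noteq> j" using i j KL(3) by auto
        with pairwiseD[OF C(3) i(1) j(1)] show "disjnt K L" unfolding i j B_def .
      qed
      show "Z \<in> lmeasurable" unfolding Z_def
        by (rule fmeasurable.Un[OF fmeasurable.Diff[OF Um Anm] negligible_imp_measurable[OF Nn]])
      have "measure lebesgue Z = measure lebesgue ((\<Union>i\<in>C. B i) - A n)"
      proof (rule measure_negligible_symdiff)
        show "(\<Union>i\<in>C. B i) - A n \<in> lmeasurable" by (intro fmeasurable.Diff Um Anm)
        show "negligible (((\<Union>i\<in>C. B i) - A n) - Z \<union> (Z - ((\<Union>i\<in>C. B i) - A n)))"
          by (rule negligible_subset[OF Nn]) (auto simp: Z_def)
      qed
      also have "\<dots> = measure lebesgue (\<Union>i\<in>C. B i) - measure lebesgue (A n)"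
        by (rule measurable_measure_Diff[OF Um _ AU]) (rule Am)
      also have "\<dots> \<le> \<kappa>" using n by simp
      finally show "measure lebesgue Z \<le> \<kappa>" .
      show "S \<subseteq> \<Union>F \<union> Z" by (auto simp: Z_def N_def F_def A_def)
    qed
  qed
qed

lemma disjoint_intervals_division:
  fixes F :: "real set set"
  assumes "finite F" "\<And>K. K \<in> F \<Longrightarrow> \<exists>u v. K = {u..v} \<and> u < v" "pairwise disjnt F"
  shows "F division_of \<Union>F"
proof (rule division_ofI)
  show "K \<noteq> {}" "\<exists>a b. K = cbox a b" if "K \<in> F" for K using assms(2)[OF that] by auto
  show "interior K1 \<inter> interior K2 = {}" if "K1 \<in> F" "K2 \<in> F" "K1 \<noteq> K2" for K1 K2
    using assms(3) that interior_subset unfolding pairwise_def disjnt_def by blast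
qed (use assms in auto)

text \<open>Inside each interval of \<open>F1\<close> the intervals of \<open>F2\<close> extend to a
  division; \<open>D\<close> consists of the pieces added. Length and increments of \<open>f\<close>
  are both additive over divisions, which is why both sums over \<open>D\<close> are
  differences.\<close>

lemma nested_intervals_gaps:
  fixes f :: "real \<Rightarrow> 'a::real_normed_vector"
  assumes F1: "finite F1" "\<And>K. K \<in> F1 \<Longrightarrow> \<exists>u v. K = {u..v} \<and> u < v" "pairwise disjnt F1"
    and F2: "finite F2" "\<And>K. K \<in> F2 \<Longrightarrow> \<exists>u v. K = {u..v} \<and> u < v" "pairwise disjnt F2"
    and nested: "\<And>J. J \<in> F2 \<Longrightarrow> \<exists>I\<in>F1. J \<subseteq> I"
  obtains D where "D division_of \<Union>D" "\<Union>D \<subseteq> \<Union>F1"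
    "(\<Sum>K\<in>D. measure lborel K) = (\<Sum>K\<in>F1. measure lborel K) - (\<Sum>K\<in>F2. measure lborel K)"
    "(\<Sum>K\<in>D. f (Sup K) - f (Inf K)) =
       (\<Sum>K\<in>F1. f (Sup K) - f (Inf K)) - (\<Sum>K\<in>F2. f (Sup K) - f (Inf K))"
proof -
  define J where "J I = {K \<in> F2. K \<subseteq> I}" for I
  have "\<forall>I\<in>F1. \<exists>q. J I \<subseteq> q \<and> q division_of I"
  proof
    fix I assume "I \<in> F1"
    then obtain u v where I: "I = {u..v}" "u < v" using F1(2) by blast
    have "J I division_of \<Union>(J I)"
      using F2 by (intro disjoint_intervals_division) (auto simp: J_def pairwise_def)
    moreover have "\<Union>(J I) \<subseteq> cbox u v" using I by (auto simp: J_def)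
    ultimately obtain q where "J I \<subseteq> q" "q division_of cbox u v"
      by (rule partial_division_extend_interval)
    then show "\<exists>q. J I \<subseteq> q \<and> q division_of I" using I by auto
  qed
  then obtain q where q: "\<And>I. I \<in> F1 \<Longrightarrow> J I \<subseteq> q I" "\<And>I. I \<in> F1 \<Longrightarrow> q I division_of I" by metis
  define D where "D = (\<Union>I\<in>F1. q I - J I)"
  have qI: "K \<subseteq> I" "K \<noteq> {}" if "I \<in> F1" "K \<in> q I" for I K
    using division_ofD(2,3)[OF q(2)] that by blast+
  have disj: "q I \<inter> q I' = {}" if "I \<in> F1" "I' \<in> F1" "I \<noteq> I'" for I I'
  proof -
    have "I \<inter> I' = {}" using F1(3) that unfolding pairwise_def disjnt_def by blast
    then show ?thesis using qI that by blast
  qed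
  have F2_eq: "F2 = (\<Union>I\<in>F1. J I)" using nested by (auto simp: J_def)
  have fin: "finite (q I)" if "I \<in> F1" for I using division_ofD(1)[OF q(2)[OF that]] .
  have sums: "(\<Sum>K\<in>D. h K) = (\<Sum>K\<in>F1. h K) - (\<Sum>K\<in>F2. h K)"
    if h: "\<And>I. I \<in> F1 \<Longrightarrow> (\<Sum>K\<in>q I. h K) = h I" for h :: "real set \<Rightarrow> 'c::ab_group_add"
  proof -
    have "(\<Sum>K\<in>D. h K) = (\<Sum>I\<in>F1. \<Sum>K\<in>q I - J I. h K)"
      unfolding D_def by (rule sum.UNION_disjoint) (use F1 fin disj in blast)+
    also have "\<dots> = (\<Sum>I\<in>F1. h I - (\<Sum>K\<in>J I. h K))"
      using q(1) fin h by (intro sum.cong) (simp_all add: sum_diff)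
    also have "\<dots> = (\<Sum>I\<in>F1. h I) - (\<Sum>I\<in>F1. \<Sum>K\<in>J I. h K)" by (rule sum_subtractf)
    also have "(\<Sum>I\<in>F1. \<Sum>K\<in>J I. h K) = (\<Sum>K\<in>F2. h K)"
      unfolding F2_eq
    proof (rule sum.UNION_disjoint[symmetric])
      show "\<forall>I\<in>F1. finite (J I)" using F2(1) by (simp add: J_def)
      show "\<forall>I\<in>F1. \<forall>I'\<in>F1. I \<noteq> I' \<longrightarrow> J I \<inter> J I' = {}" using q(1) disj by blast
    qed (rule F1(1))
    finally show ?thesis .
  qed
  show thesis
  proof (rule that[of D])
    show "D division_of \<Union>D"
    proof (rule division_ofI)
      show "finite D" unfolding D_def using F1(1) fin by blast
      show "K \<noteq> {}" "\<exists>a b. K = cbox a b" if "K \<in> D" for K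
        using that division_ofD(3,4)[OF q(2)] unfolding D_def by blast+
      show "interior K1 \<inter> interior K2 = {}" if K: "K1 \<in> D" "K2 \<in> D" "K1 \<noteq> K2" for K1 K2
      proof -
        obtain I1 I2 where I: "I1 \<in> F1" "K1 \<in> q I1" "I2 \<in> F1" "K2 \<in> q I2"
          using K unfolding D_def by blast
        show ?thesis
        proof (cases "I1 = I2")
          case True
          then show ?thesis using division_ofD(5)[OF q(2)] I K by blast
        next
          case False
          then have "I1 \<inter> I2 = {}" using F1(3) I unfolding pairwise_def disjnt_def by blast
          then show ?thesis using qI(1)[of I1 K1] qI(1)[of I2 K2] I interior_subset by blast
        qed
      qed
    qed auto
    show "\<Union>D \<subseteq> \<Union>F1" unfolding D_def using qI by blast
    show "(\<Sum>K\<in>D. measure lborel K) = (\<Sum>K\<in>F1. measure lborel K) - (\<Sum>K\<in>F2. measure lborel K)"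
    proof (rule sums)
      fix I assume I: "I \<in> F1"
      then obtain u v where "I = cbox u v" using F1(2) by force
      then show "(\<Sum>K\<in>q I. measure lborel K) = measure lborel I"
        using additive_content_division q(2)[OF I] by blast
    qed
    show "(\<Sum>K\<in>D. f (Sup K) - f (Inf K)) =
       (\<Sum>K\<in>F1. f (Sup K) - f (Inf K)) - (\<Sum>K\<in>F2. f (Sup K) - f (Inf K))"
    proof (rule sums)
      fix I assume I: "I \<in> F1"
      then obtain u v where uv: "I = {u..v}" "u < v" using F1(2) by blast
      then show "(\<Sum>K\<in>q I. f (Sup K) - f (Inf K)) = f (Sup I) - f (Inf I)"
        using division_telescope[of u v "q I" f] q(2)[OF I] by simp
    qed
  qed
qed

lemma lmeasurable_outer_open_less:
  assumes "S \<in> lmeasurable" "(e::real) > 0"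
  obtains T where "open T" "S \<subseteq> T" "T \<in> lmeasurable" "measure lebesgue T < measure lebesgue S + e"
proof -
  obtain T where T: "open T" "S \<subseteq> T" "T - S \<in> lmeasurable" "emeasure lebesgue (T - S) < ennreal e"
    using sets_lebesgue_outer_open[OF fmeasurableD[OF assms(1)] assms(2)] by blast
  have "T = S \<union> (T - S)" using T(2) by blast
  then have Tm: "T \<in> lmeasurable" using fmeasurable.Un[OF assms(1) T(3)] by simp
  have "measure lebesgue (T - S) < e"
    using T(4) emeasure_eq_measure2[OF T(3)] assms(2) by (simp add: ennreal_less_iff)
  moreover have "measure lebesgue (T - S) = measure lebesgue T - measure lebesgue S"
    by (rule measurable_measure_Diff[OF Tm fmeasurableD[OF assms(1)] T(2)])
  ultimately show thesis using that T(1,2) Tm by simp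
qed

lemma measure_disjoint_intervals:
  fixes F :: "real set set"
  assumes "finite F" "\<And>K. K \<in> F \<Longrightarrow> \<exists>u v. K = {u..v} \<and> u < v" "pairwise disjnt F"
  shows "\<Union>F \<in> lmeasurable" "measure lebesgue (\<Union>F) = (\<Sum>K\<in>F. measure lborel K)"
proof -
  have K: "K \<in> lmeasurable" "measure lebesgue K = measure lborel K" if "K \<in> F" for K
    using assms(2)[OF that] by auto
  show "\<Union>F \<in> lmeasurable" using assms(1) K by (intro fmeasurable.finite_Union) auto
  have "measure lebesgue (\<Union>F) = (\<Sum>K\<in>F. measure lebesgue K)"
  proof (rule measure_negligible_finite_Union[OF assms(1) K(1)])
    show "pairwise (\<lambda>S T. negligible (S \<inter> T)) F"
      using assms(3) unfolding pairwise_def disjnt_def by simp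
  qed
  also have "\<dots> = (\<Sum>K\<in>F. measure lborel K)" by (rule sum.cong[OF refl K(2)])
  finally show "measure lebesgue (\<Union>F) = (\<Sum>K\<in>F. measure lborel K)" .
qed

section \<open>Null sets of extreme or oscillating slopes\<close>

lemma sum_interval_slopes:
  fixes g :: "real \<Rightarrow> real"
  assumes "\<And>K. K \<in> F \<Longrightarrow> \<exists>u v. K = {u..v} \<and> u < v \<and> R u v"
  shows "(\<And>u v. R u v \<Longrightarrow> g v - g u \<le> p * (v - u)) \<Longrightarrow>
      (\<Sum>K\<in>F. g (Sup K) - g (Inf K)) \<le> p * (\<Sum>K\<in>F. measure lborel K)"
    and "(\<And>u v. R u v \<Longrightarrow> g v - g u \<ge> p * (v - u)) \<Longrightarrow>
      (\<Sum>K\<in>F. g (Sup K) - g (Inf K)) \<ge> p * (\<Sum>K\<in>F. measure lborel K)"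
proof -
  assume *: "\<And>u v. R u v \<Longrightarrow> g v - g u \<le> p * (v - u)"
  have "g (Sup K) - g (Inf K) \<le> p * measure lborel K" if K: "K \<in> F" for K
  proof -
    obtain u v where "K = {u..v}" "u < v" "R u v" using assms[OF K] by blast
    then show ?thesis using *[of u v] by simp
  qed
  then show "(\<Sum>K\<in>F. g (Sup K) - g (Inf K)) \<le> p * (\<Sum>K\<in>F. measure lborel K)"
    unfolding sum_distrib_left by (rule sum_mono)
next
  assume *: "\<And>u v. R u v \<Longrightarrow> g v - g u \<ge> p * (v - u)"
  have "g (Sup K) - g (Inf K) \<ge> p * measure lborel K" if K: "K \<in> F" for K
  proof -
    obtain u v where "K = {u..v}" "u < v" "R u v" using assms[OF K] by blast
    then show ?thesis using *[of u v] by simp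
  qed
  then show "(\<Sum>K\<in>F. g (Sup K) - g (Inf K)) \<ge> p * (\<Sum>K\<in>F. measure lborel K)"
    unfolding sum_distrib_left by (rule sum_mono)
qed

text \<open>If slopes below \<open>p\<close> and slopes above \<open>q\<close> accumulate at every point of a set of outer measure
  \<open>m\<close>, nested Vitali covers by such intervals differ by gaps of small total length, on which an
  absolutely continuous function hardly changes; hence \<open>q m \<le> p m\<close>.\<close>

lemma ac_on_slope_gap_negligible:
  fixes g :: "real \<Rightarrow> real"
  assumes ac: "ac_on a b g" and pq: "p < q"
    and lo: "\<And>x d. x \<in> E \<Longrightarrow> 0 < d \<Longrightarrow>
      \<exists>u v. u \<le> x \<and> x \<le> v \<and> u < v \<and> v - u < d \<and> a \<le> u \<and> v \<le> b \<and> g v - g u \<le> p * (v - u)"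
    and hi: "\<And>x d. x \<in> E \<Longrightarrow> 0 < d \<Longrightarrow>
      \<exists>u v. u \<le> x \<and> x \<le> v \<and> u < v \<and> v - u < d \<and> a \<le> u \<and> v \<le> b \<and> g v - g u \<ge> q * (v - u)"
  shows "negligible E"
proof -
  \<comment> \<open>\<open>E\<close> is not known to be measurable; \<open>m\<close> is its outer
    measure.\<close>
  define M where "M = measure lebesgue ` {T. T \<in> lmeasurable \<and> E \<subseteq> T}"
  define m where "m = Inf M"
  have Eab: "E \<subseteq> {a..b}"
  proof
    fix x assume "x \<in> E"
    from lo[OF this zero_less_one] obtain u v where "u \<le> x" "x \<le> v" "a \<le> u" "v \<le> b" by blast
    then show "x \<in> {a..b}" by simp
  qed
  have "measure lebesgue {a..b} \<in> M" unfolding M_def using Eab by blast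
  then have "M \<noteq> {}" by blast
  have "bdd_below M" unfolding M_def by (rule bdd_belowI[of _ 0]) auto
  have m_le: "m \<le> measure lebesgue T" if "T \<in> lmeasurable" "E \<subseteq> T" for T
    unfolding m_def by (rule cInf_lower[OF _ \<open>bdd_below M\<close>]) (use that in \<open>auto simp: M_def\<close>)
  have m_approx: "\<exists>T. T \<in> lmeasurable \<and> E \<subseteq> T \<and> measure lebesgue T < c" if "m < c" for c
    using cInf_lessD[OF \<open>M \<noteq> {}\<close>, of c] that unfolding m_def M_def by auto
  have main: "(q - p) * (m - 2 * \<kappa>) \<le> \<epsilon> + 3 * \<bar>p\<bar> * \<kappa>"
    if \<epsilon>: "\<epsilon> > 0" and \<kappa>: "\<kappa> > 0" "3 * \<kappa> < \<delta>"
      and \<delta>: "\<And>D. D division_of \<Union>D \<Longrightarrow> \<Union>D \<subseteq> {a..b} \<Longrightarrow> (\<Sum>K\<in>D. measure lborel K) < \<delta>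
       \<Longrightarrow> (\<Sum>K\<in>D. norm (g (Sup K) - g (Inf K))) < \<epsilon>" for \<epsilon> \<kappa> \<delta>
  proof -
    have "m < m + \<kappa> / 2" using \<kappa> by simp
    then obtain T0 where T0: "T0 \<in> lmeasurable" "E \<subseteq> T0" "measure lebesgue T0 < m + \<kappa> / 2"
      using m_approx by blast
    have "\<kappa> / 2 > 0" using \<kappa> by simp
    from lmeasurable_outer_open_less[OF T0(1) this]
    obtain T where T: "open T" "T0 \<subseteq> T" "T \<in> lmeasurable" "measure lebesgue T < measure lebesgue T0 + \<kappa> / 2" .
    have Tm: "measure lebesgue T < m + \<kappa>" using T0 T by simp
    have ET: "E \<subseteq> T" using T0 T by blast
    define Q1 where "Q1 = (\<lambda>u v. a \<le> u \<and> v \<le> b \<and> {u..v} \<subseteq> T \<and> g v - g u \<le> p * (v - u))"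
    have 1: "\<exists>u v. u \<le> x \<and> x \<le> v \<and> u < v \<and> v - u < d \<and> Q1 u v" if x: "x \<in> E" "0 < d" for x d
    proof -
      obtain r where r: "r > 0" "ball x r \<subseteq> T" using T(1) ET x open_contains_ball by blast
      have "min d r > 0" using r x by simp
      from lo[OF x(1) this] obtain u v where uv: "u \<le> x" "x \<le> v" "u < v" "v - u < min d r"
        "a \<le> u" "v \<le> b" "g v - g u \<le> p * (v - u)" by blast
      have "{u..v} \<subseteq> ball x r" using uv by (auto simp: dist_real_def)
      then show ?thesis using uv r(2) unfolding Q1_def
        by (intro exI[of _ u] exI[of _ v]) auto
    qed
    have Q1b: "a \<le> u \<and> v \<le> b" if "Q1 u v" for u v using that by (simp add: Q1_def)
    obtain F1 Z1 where F1: "finite F1" "\<forall>K\<in>F1. \<exists>u v. K = {u..v} \<and> u < v \<and> Q1 u v"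
      "pairwise disjnt F1" and Z1: "Z1 \<in> lmeasurable" "measure lebesgue Z1 \<le> \<kappa>" "E \<subseteq> \<Union>F1 \<union> Z1"
      by (rule finite_Vitali_cover[OF 1 Q1b \<kappa>(1)])
    note F1 = F1(1) bspec[OF F1(2)] F1(3)
    have F1': "\<exists>u v. K = {u..v} \<and> u < v" if "K \<in> F1" for K using F1(2)[OF that] by blast
    \<comment> \<open>Intervals of the second cover have to fit into those of the first, which is
      guaranteed around interior points only; the endpoints left out form the null set
      \<open>N\<close>.\<close>
    define E2 where "E2 = E \<inter> (\<Union>K\<in>F1. interior K)"
    define Q2 where "Q2 = (\<lambda>u v. a \<le> u \<and> v \<le> b \<and> (\<exists>K\<in>F1. {u..v} \<subseteq> K) \<and> g v - g u \<ge> q * (v - u))"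
    have 2: "\<exists>u v. u \<le> x \<and> x \<le> v \<and> u < v \<and> v - u < d \<and> Q2 u v" if x: "x \<in> E2" "0 < d" for x d
    proof -
      obtain K where K: "K \<in> F1" "x \<in> interior K" and xE: "x \<in> E" using x(1) unfolding E2_def by blast
      obtain r where r: "r > 0" "ball x r \<subseteq> K" using K(2) mem_interior by blast
      have "min d r > 0" using r x by simp
      from hi[OF xE this] obtain u v where uv: "u \<le> x" "x \<le> v" "u < v" "v - u < min d r"
        "a \<le> u" "v \<le> b" "g v - g u \<ge> q * (v - u)" by blast
      have "{u..v} \<subseteq> ball x r" using uv by (auto simp: dist_real_def)
      then have "\<exists>K\<in>F1. {u..v} \<subseteq> K" using r(2) K(1) by blast
      then show ?thesis using uv unfolding Q2_def by (intro exI[of _ u] exI[of _ v]) auto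
    qed
    have Q2b: "a \<le> u \<and> v \<le> b" if "Q2 u v" for u v using that by (simp add: Q2_def)
    obtain F2 Z2 where F2: "finite F2" "\<forall>K\<in>F2. \<exists>u v. K = {u..v} \<and> u < v \<and> Q2 u v"
      "pairwise disjnt F2" and Z2: "Z2 \<in> lmeasurable" "measure lebesgue Z2 \<le> \<kappa>" "E2 \<subseteq> \<Union>F2 \<union> Z2"
      by (rule finite_Vitali_cover[OF 2 Q2b \<kappa>(1)])
    note F2 = F2(1) bspec[OF F2(2)] F2(3)
    have F2': "\<exists>u v. K = {u..v} \<and> u < v" if "K \<in> F2" for K using F2(2)[OF that] by blast
    have nested: "\<exists>I\<in>F1. J \<subseteq> I" if "J \<in> F2" for J using F2(2)[OF that] unfolding Q2_def by blast
    define s1 where "s1 = (\<Sum>K\<in>F1. measure lborel K)"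
    define s2 where "s2 = (\<Sum>K\<in>F2. measure lborel K)"
    have m1: "\<Union>F1 \<in> lmeasurable" "measure lebesgue (\<Union>F1) = (\<Sum>K\<in>F1. measure lborel K)"
      by (rule measure_disjoint_intervals[OF F1(1) _ F1(3)], erule F1')+
    have m2: "\<Union>F2 \<in> lmeasurable" "measure lebesgue (\<Union>F2) = (\<Sum>K\<in>F2. measure lborel K)"
      by (rule measure_disjoint_intervals[OF F2(1) _ F2(3)], erule F2')+
    have F1ab: "\<Union>F1 \<subseteq> {a..b}" and F1T: "\<Union>F1 \<subseteq> T"
      using F1(2) unfolding Q1_def by fastforce+
    have s1: "s1 < m + \<kappa>"
    proof -
      have "measure lebesgue (\<Union>F1) \<le> measure lebesgue T"
        by (rule measure_mono_fmeasurable[OF F1T fmeasurableD[OF m1(1)] T(3)])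
      then show ?thesis using Tm m1(2) by (simp add: s1_def)
    qed
    define N where "N = (\<Union>K\<in>F1. K - interior K)"
    have N: "negligible N" unfolding N_def
    proof (rule negligible_Union)
      show "finite ((\<lambda>K. K - interior K) ` F1)" using F1(1) by simp
      fix X assume "X \<in> (\<lambda>K. K - interior K) ` F1"
      then obtain K where K: "K \<in> F1" "X = K - interior K" by blast
      obtain u v where "K = {u..v}" using F1'[OF K(1)] by blast
      then have "X = {u..v} - {u<..<v}" using K(2) by simp
      then have "X \<subseteq> {u, v}" by auto
      then show "negligible X" by (intro negligible_subset[OF negligible_finite]) auto
    qed
    have s2: "m - 2 * \<kappa> \<le> s2"
    proof -
      have "E \<subseteq> (\<Union>F2 \<union> Z2) \<union> (Z1 \<union> N)"
      proof
        fix x assume x: "x \<in> E"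
        show "x \<in> (\<Union>F2 \<union> Z2) \<union> (Z1 \<union> N)"
        proof (cases "x \<in> E2 \<or> x \<in> Z1")
          case True
          then show ?thesis using Z2(3) by (meson UnI1 UnI2 subsetD)
        next
          case False
          then have "x \<in> \<Union>F1" using subsetD[OF Z1(3) x] by simp
          then obtain K where "K \<in> F1" "x \<in> K" by (rule UnionE)
          moreover have "x \<notin> interior K" using False x \<open>K \<in> F1\<close> unfolding E2_def by simp
          ultimately have "x \<in> N" unfolding N_def by (intro UN_I[of K]) simp_all
          then show ?thesis by simp
        qed
      qed
      moreover have *: "\<Union>F2 \<union> Z2 \<in> lmeasurable" "Z1 \<union> N \<in> lmeasurable"
        by (rule fmeasurable.Un[OF m2(1) Z2(1)])
          (rule fmeasurable.Un[OF Z1(1) negligible_imp_measurable[OF N]])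
      ultimately have "m \<le> measure lebesgue ((\<Union>F2 \<union> Z2) \<union> (Z1 \<union> N))"
        by (intro m_le[OF fmeasurable.Un[OF *]])
      also have "\<dots> \<le> measure lebesgue (\<Union>F2 \<union> Z2) + measure lebesgue (Z1 \<union> N)"
        using * by (intro measure_Un_le fmeasurableD)
      also have "measure lebesgue (\<Union>F2 \<union> Z2) \<le> s2 + \<kappa>"
        using measure_Un_le[OF fmeasurableD[OF m2(1)] fmeasurableD[OF Z2(1)]] Z2(2) m2(2) by (simp add: s2_def)
      also have "measure lebesgue (Z1 \<union> N) \<le> \<kappa>"
        using measure_Un_le[OF fmeasurableD[OF Z1(1)] fmeasurableD[OF negligible_imp_measurable[OF N]]]
          Z1(2) negligible_imp_measure0[OF N] by simp
      finally show ?thesis by simp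
    qed
    obtain D where D: "D division_of \<Union>D" "\<Union>D \<subseteq> \<Union>F1"
      "(\<Sum>K\<in>D. measure lborel K) = s1 - s2"
      "(\<Sum>K\<in>D. g (Sup K) - g (Inf K)) =
         (\<Sum>K\<in>F1. g (Sup K) - g (Inf K)) - (\<Sum>K\<in>F2. g (Sup K) - g (Inf K))"
      unfolding s1_def s2_def by (rule nested_intervals_gaps[OF F1(1) F1' F1(3) F2(1) F2' F2(3) nested])
    have "0 \<le> s1 - s2" unfolding D(3)[symmetric] by (intro sum_nonneg) simp
    \<comment> \<open>The gaps have total length \<open>s1 - s2\<close>, which is less than
      \<open>(m + \<kappa>) - (m - 2 * \<kappa>) = 3 * \<kappa>\<close> and hence less than
      \<open>\<delta>\<close>.\<close>
    have "(\<Sum>K\<in>D. norm (g (Sup K) - g (Inf K))) < \<epsilon>"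
      using D F1ab s1 s2 \<kappa> by (intro \<delta>) auto
    then have "\<bar>\<Sum>K\<in>D. g (Sup K) - g (Inf K)\<bar> < \<epsilon>"
      using sum_abs[of "\<lambda>K. g (Sup K) - g (Inf K)" D] unfolding real_norm_def by linarith
    moreover have "(\<Sum>K\<in>F1. g (Sup K) - g (Inf K)) \<le> p * s1"
      unfolding s1_def by (rule sum_interval_slopes(1)[OF F1(2)]) (auto simp: Q1_def)
    moreover have "(\<Sum>K\<in>F2. g (Sup K) - g (Inf K)) \<ge> q * s2"
      unfolding s2_def by (rule sum_interval_slopes(2)[OF F2(2)]) (auto simp: Q2_def)
    ultimately have "q * s2 - p * s1 \<le> \<epsilon>" using D(4) by linarith
    then have "(q - p) * s2 \<le> \<epsilon> + p * (s1 - s2)" by (simp add: algebra_simps)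
    also have "p * (s1 - s2) \<le> \<bar>p\<bar> * (s1 - s2)" using \<open>0 \<le> s1 - s2\<close> by (intro mult_right_mono) auto
    also have "\<dots> \<le> \<bar>p\<bar> * (3 * \<kappa>)" using s1 s2 by (intro mult_left_mono) auto
    finally have "(q - p) * s2 \<le> \<epsilon> + 3 * \<bar>p\<bar> * \<kappa>" by simp
    moreover have "(q - p) * (m - 2 * \<kappa>) \<le> (q - p) * s2" using s2 pq by (intro mult_left_mono) auto
    ultimately show ?thesis by linarith
  qed
  have "m \<le> 0"
  proof (rule ccontr)
    assume "\<not> ?thesis"
    then have m: "m > 0" by simp
    \<comment> \<open>With \<open>4 * \<epsilon> = (q - p) * m\<close> and the
      \<open>\<kappa>\<close> below, the terms of \<open>main\<close> containing
      \<open>\<kappa>\<close> amount to at most \<open>3 * (c * \<kappa>)\<close>, so that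
      \<open>main\<close> would give
      \<open>4 * \<epsilon> \<le> \<epsilon> + 3 / 2 * \<epsilon>\<close>.\<close>
    define \<epsilon> where "\<epsilon> = (q - p) * m / 4"
    have \<epsilon>: "\<epsilon> > 0" using m pq by (simp add: \<epsilon>_def)
    obtain \<delta> where \<delta>: "\<delta> > 0" "\<And>D. D division_of \<Union>D \<Longrightarrow> \<Union>D \<subseteq> {a..b} \<Longrightarrow> (\<Sum>K\<in>D. measure lborel K) < \<delta>
       \<Longrightarrow> (\<Sum>K\<in>D. norm (g (Sup K) - g (Inf K))) < \<epsilon>"
      using ac_onD[OF ac \<epsilon>] by metis
    define c where "c = q - p + \<bar>p\<bar>"
    have c: "c > 0" using pq by (simp add: c_def)
    define \<kappa> where "\<kappa> = min (\<delta> / 4) (\<epsilon> / (2 * c))"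
    have \<kappa>: "\<kappa> > 0" "3 * \<kappa> < \<delta>" "\<kappa> \<le> \<epsilon> / (2 * c)" using \<delta>(1) \<epsilon> c by (auto simp: \<kappa>_def)
    have "c * \<kappa> \<le> \<epsilon> / 2" using \<kappa>(3) c by (simp add: field_simps)
    have "(q - p) * (m - 2 * \<kappa>) \<le> \<epsilon> + 3 * \<bar>p\<bar> * \<kappa>" by (rule main[OF \<epsilon> \<kappa>(1,2) \<delta>(2)])
    moreover have "(q - p) * \<kappa> \<ge> 0" using \<kappa>(1) pq by simp
    moreover have "(q - p) * (m - 2 * \<kappa>) = (q - p) * m - 2 * ((q - p) * \<kappa>)"
      by (simp add: algebra_simps)
    moreover have "(q - p) * m = 4 * \<epsilon>" by (simp add: \<epsilon>_def)
    moreover have "c * \<kappa> = (q - p) * \<kappa> + \<bar>p\<bar> * \<kappa>" by (simp add: c_def algebra_simps)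
    ultimately have "4 * \<epsilon> \<le> \<epsilon> + 3 * (c * \<kappa>)" by linarith
    then show False using \<open>c * \<kappa> \<le> \<epsilon> / 2\<close> \<epsilon> by simp
  qed
  then have "\<exists>T. E \<subseteq> T \<and> T \<in> lmeasurable \<and> measure lebesgue T < e" if "e > 0" for e
    using m_approx[of e] that by auto
  then show ?thesis unfolding negligible_outer by blast
qed

text \<open>In a window shorter than the \<open>\<delta>\<close> that belongs to tolerance 1,
  disjoint intervals have total increment below 1; if their slopes are at least \<open>q\<close>,
  their total length is at most \<open>1 / q\<close>. Since \<open>q\<close> is arbitrary, the
  window meets \<open>E\<close> in a null set, and countably many windows cover
  \<open>E\<close>.\<close>

lemma ac_on_infinite_slope_negligible:
  fixes g :: "real \<Rightarrow> real"
  assumes ac: "ac_on a b g"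
    and hi: "\<And>x d q. x \<in> E \<Longrightarrow> 0 < d \<Longrightarrow>
      \<exists>u v. u \<le> x \<and> x \<le> v \<and> u < v \<and> v - u < d \<and> a \<le> u \<and> v \<le> b \<and> g v - g u \<ge> q * (v - u)"
  shows "negligible E"
proof -
  obtain \<delta> where \<delta>: "\<delta> > 0" "\<And>D. D division_of \<Union>D \<Longrightarrow> \<Union>D \<subseteq> {a..b} \<Longrightarrow> (\<Sum>K\<in>D. measure lborel K) < \<delta>
       \<Longrightarrow> (\<Sum>K\<in>D. norm (g (Sup K) - g (Inf K))) < 1"
    using ac_onD[OF ac zero_less_one] by metis
  have local: "negligible (E \<inter> {c<..<c + \<delta> / 2})" for c
    unfolding negligible_outer_le
  proof (intro allI impI)
    fix e :: real assume e: "e > 0"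
    \<comment> \<open>Then \<open>1 / q\<close> is the half of \<open>e\<close> that the Vitali
      remainder leaves over.\<close>
    define q where "q = 2 / e"
    have q: "q > 0" using e by (simp add: q_def)
    let ?E = "E \<inter> {c<..<c + \<delta> / 2}"
    define Q where "Q = (\<lambda>u v. a \<le> u \<and> v \<le> b \<and> {u..v} \<subseteq> {c<..<c + \<delta> / 2} \<and> g v - g u \<ge> q * (v - u))"
    have 1: "\<exists>u v. u \<le> x \<and> x \<le> v \<and> u < v \<and> v - u < d \<and> Q u v" if x: "x \<in> ?E" "0 < d" for x d
    proof -
      have "open {c<..<c + \<delta> / 2}" by simp
      then obtain r where r: "r > 0" "ball x r \<subseteq> {c<..<c + \<delta> / 2}" using x open_contains_ball by blast
      have "min d r > 0" using r x by simp
      from hi[OF _ this] x(1) obtain u v where uv: "u \<le> x" "x \<le> v" "u < v" "v - u < min d r"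
        "a \<le> u" "v \<le> b" "g v - g u \<ge> q * (v - u)" by blast
      have "{u..v} \<subseteq> ball x r" using uv by (auto simp: dist_real_def)
      then have "{u..v} \<subseteq> {c<..<c + \<delta> / 2}" using r(2) by (rule order_trans)
      then show ?thesis using uv unfolding Q_def
        by (intro exI[of _ u] exI[of _ v]) simp
    qed
    have Qb: "a \<le> u \<and> v \<le> b" if "Q u v" for u v using that by (simp add: Q_def)
    have e2: "e / 2 > 0" using e by simp
    obtain F Z where F: "finite F" "\<forall>K\<in>F. \<exists>u v. K = {u..v} \<and> u < v \<and> Q u v"
      "pairwise disjnt F" and Z: "Z \<in> lmeasurable" "measure lebesgue Z \<le> e / 2" "?E \<subseteq> \<Union>F \<union> Z"
      by (rule finite_Vitali_cover[OF 1 Qb e2])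
    note F = F(1) bspec[OF F(2)] F(3)
    have F': "\<exists>u v. K = {u..v} \<and> u < v" if "K \<in> F" for K using F(2)[OF that] by blast
    have mF: "\<Union>F \<in> lmeasurable" "measure lebesgue (\<Union>F) = (\<Sum>K\<in>F. measure lborel K)"
      by (rule measure_disjoint_intervals[OF F(1) _ F(3)], erule F')+
    have Fc: "\<Union>F \<subseteq> {c<..<c + \<delta> / 2}" "\<Union>F \<subseteq> {a..b}" using F(2) unfolding Q_def by fastforce+
    have "measure lebesgue (\<Union>F) \<le> measure lebesgue {c<..<c + \<delta> / 2}"
      using lmeasurable_box[of c "c + \<delta> / 2", unfolded box_real]
      by (intro measure_mono_fmeasurable[OF Fc(1) fmeasurableD[OF mF(1)]]) simp
    then have "(\<Sum>K\<in>F. measure lborel K) < \<delta>" using \<delta>(1) mF(2) by simp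
    then have "(\<Sum>K\<in>F. norm (g (Sup K) - g (Inf K))) < 1"
      by (intro \<delta>(2) disjoint_intervals_division F(1) F(3) F' Fc)
    then have "(\<Sum>K\<in>F. g (Sup K) - g (Inf K)) < 1"
      using sum_abs[of "\<lambda>K. g (Sup K) - g (Inf K)" F]
        abs_ge_self[of "\<Sum>K\<in>F. g (Sup K) - g (Inf K)"] unfolding real_norm_def by linarith
    moreover have "(\<Sum>K\<in>F. g (Sup K) - g (Inf K)) \<ge> q * (\<Sum>K\<in>F. measure lborel K)"
      by (rule sum_interval_slopes(2)[OF F(2)]) (auto simp: Q_def)
    ultimately have "q * measure lebesgue (\<Union>F) \<le> 1" using mF(2) by simp
    then have "measure lebesgue (\<Union>F) \<le> e / 2" using e by (simp add: q_def field_simps)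
    then have "measure lebesgue (\<Union>F \<union> Z) \<le> e"
      using measure_Un_le[OF fmeasurableD[OF mF(1)] fmeasurableD[OF Z(1)]] Z(2) by simp
    then show "\<exists>T. ?E \<subseteq> T \<and> T \<in> lmeasurable \<and> measure lebesgue T \<le> e"
      using Z(3) fmeasurable.Un[OF mF(1) Z(1)] by blast
  qed
  have "E \<subseteq> (\<Union>c\<in>\<rat>. E \<inter> {c<..<c + \<delta> / 2})"
  proof
    fix x assume "x \<in> E"
    obtain c where "c \<in> \<rat>" "x - \<delta> / 2 < c" "c < x"
      using Rats_dense_in_real[of "x - \<delta> / 2" x] \<delta>(1) by auto
    then show "x \<in> (\<Union>c\<in>\<rat>. E \<inter> {c<..<c + \<delta> / 2})" using \<open>x \<in> E\<close> by auto
  qed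
  moreover have "negligible (\<Union>c\<in>\<rat>. E \<inter> {c<..<c + \<delta> / 2})"
    by (rule negligible_countable_Union) (auto intro: countable_rat local)
  ultimately show ?thesis by (rule negligible_subset[rotated])
qed

section \<open>Permanence properties of absolute continuity\<close>

lemma division_real_intervalE:
  fixes K :: "real set"
  assumes "D division_of S" "K \<in> D"
  obtains u v where "u \<le> v" "K = {u..v}"
proof -
  obtain u v where "K = cbox u v" using division_ofD(4)[OF assms] by blast
  moreover have "K \<noteq> {}" by (rule division_ofD(3)[OF assms])
  ultimately show thesis using that[of u v] by simp
qed

text \<open>The common source of the closure properties below: components, differences, inner
  products and Lipschitz functions all have increments dominated in this way.\<close>

lemma ac_on_dominated:
  fixes f :: "real \<Rightarrow> 'a::real_normed_vector" and g :: "real \<Rightarrow> 'b::real_normed_vector"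
    and h :: "real \<Rightarrow> 'c::real_normed_vector"
  assumes f: "ac_on a b f" and g: "ac_on a b g" and M: "M > 0"
    and le: "\<And>s t. s \<in> {a..b} \<Longrightarrow> t \<in> {a..b} \<Longrightarrow> norm (h s - h t) \<le> M * (norm (f s - f t) + norm (g s - g t))"
  shows "ac_on a b h"
  unfolding ac_on_def
proof (intro allI impI)
  fix \<epsilon> :: real assume \<epsilon>: "\<epsilon> > 0"
  have \<epsilon>': "\<epsilon> / (2 * M) > 0" using \<epsilon> M by simp
  obtain \<delta>1 where \<delta>1: "\<delta>1 > 0" "\<And>D. D division_of \<Union>D \<Longrightarrow> \<Union>D \<subseteq> {a..b} \<Longrightarrow> (\<Sum>K\<in>D. measure lborel K) < \<delta>1
       \<Longrightarrow> (\<Sum>K\<in>D. norm (f (Sup K) - f (Inf K))) < \<epsilon> / (2 * M)"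
    using ac_onD[OF f \<epsilon>'] by metis
  obtain \<delta>2 where \<delta>2: "\<delta>2 > 0" "\<And>D. D division_of \<Union>D \<Longrightarrow> \<Union>D \<subseteq> {a..b} \<Longrightarrow> (\<Sum>K\<in>D. measure lborel K) < \<delta>2
       \<Longrightarrow> (\<Sum>K\<in>D. norm (g (Sup K) - g (Inf K))) < \<epsilon> / (2 * M)"
    using ac_onD[OF g \<epsilon>'] by metis
  show "\<exists>\<delta>>0. \<forall>D. D division_of \<Union>D \<and> \<Union>D \<subseteq> {a..b} \<and> (\<Sum>K\<in>D. measure lborel K) < \<delta> \<longrightarrow>
        (\<Sum>K\<in>D. norm (h (Sup K) - h (Inf K))) < \<epsilon>"
  proof (intro exI conjI allI impI)
    show "min \<delta>1 \<delta>2 > 0" using \<delta>1 \<delta>2 by simp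
    fix D :: "real set set"
    assume "D division_of \<Union>D \<and> \<Union>D \<subseteq> {a..b} \<and> (\<Sum>K\<in>D. measure lborel K) < min \<delta>1 \<delta>2"
    then have D: "D division_of \<Union>D" "\<Union>D \<subseteq> {a..b}"
      "(\<Sum>K\<in>D. measure lborel K) < \<delta>1" "(\<Sum>K\<in>D. measure lborel K) < \<delta>2" by auto
    have "(\<Sum>K\<in>D. norm (h (Sup K) - h (Inf K)))
      \<le> (\<Sum>K\<in>D. M * (norm (f (Sup K) - f (Inf K)) + norm (g (Sup K) - g (Inf K))))"
    proof (rule sum_mono, rule le)
      fix K assume K: "K \<in> D"
      obtain u v where uv: "u \<le> v" "K = {u..v}" by (rule division_real_intervalE[OF D(1) K])
      have "K \<subseteq> {a..b}" using K D(2) by blast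
      then show "Sup K \<in> {a..b}" "Inf K \<in> {a..b}" using uv by auto
    qed
    also have "\<dots> = M * ((\<Sum>K\<in>D. norm (f (Sup K) - f (Inf K))) + (\<Sum>K\<in>D. norm (g (Sup K) - g (Inf K))))"
      by (simp add: sum_distrib_left sum.distrib distrib_left)
    also have "\<dots> < M * (\<epsilon> / (2 * M) + \<epsilon> / (2 * M))"
      using M by (intro mult_strict_left_mono add_strict_mono \<delta>1(2) \<delta>2(2) D)
    also have "\<dots> = \<epsilon>" using M by simp
    finally show "(\<Sum>K\<in>D. norm (h (Sup K) - h (Inf K))) < \<epsilon>" .
  qed
qed

lemma ac_on_compose_norm_le:
  fixes f :: "real \<Rightarrow> 'a::real_normed_vector" and g :: "real \<Rightarrow> 'b::real_normed_vector"
  assumes ac: "ac_on a b f" and le: "\<And>s t. norm (g s - g t) \<le> norm (f s - f t)"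
  shows "ac_on a b g"
proof (rule ac_on_dominated[OF ac ac zero_less_one])
  show "norm (g s - g t) \<le> 1 * (norm (f s - f t) + norm (f s - f t))" for s t
    by (rule order_trans[OF le]) simp
qed

lemma ac_on_continuous:
  fixes f :: "real \<Rightarrow> 'a::real_normed_vector"
  assumes ac: "ac_on a b f"
  shows "continuous_on {a..b} f"
  unfolding continuous_on_iff
proof (intro ballI allI impI)
  fix x e :: real assume x: "x \<in> {a..b}" and e: "e > 0"
  obtain \<delta> where \<delta>: "\<delta> > 0" "\<And>D. D division_of \<Union>D \<Longrightarrow> \<Union>D \<subseteq> {a..b} \<Longrightarrow> (\<Sum>K\<in>D. measure lborel K) < \<delta>
       \<Longrightarrow> (\<Sum>K\<in>D. norm (f (Sup K) - f (Inf K))) < e"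
    using ac_onD[OF ac e] by metis
  have key: "norm (f v - f u) < e" if "u \<le> v" "a \<le> u" "v \<le> b" "v - u < \<delta>" for u v
    using \<delta>(2)[of "{{u..v}}"] division_of_self[of u v] that by simp
  have "dist (f y) (f x) < e" if "y \<in> {a..b}" "dist y x < \<delta>" for y
  proof (cases "x \<le> y")
    case True
    then show ?thesis using key[of x y] x that by (simp add: dist_norm)
  next
    case False
    then show ?thesis using key[of y x] x that by (simp add: dist_norm norm_minus_commute)
  qed
  then show "\<exists>d>0. \<forall>y\<in>{a..b}. dist y x < d \<longrightarrow> dist (f y) (f x) < e" using \<delta>(1) by blast
qed

lemma ac_on_diff:
  fixes f g :: "real \<Rightarrow> 'a::real_normed_vector"
  assumes "ac_on a b f" "ac_on a b g"
  shows "ac_on a b (\<lambda>t. f t - g t)"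
proof (rule ac_on_dominated[OF assms zero_less_one])
  show "norm (f s - g s - (f t - g t)) \<le> 1 * (norm (f s - f t) + norm (g s - g t))" for s t
    using norm_triangle_ineq4[of "f s - f t" "g s - g t"] by (simp add: algebra_simps)
qed

lemma ac_on_inner:
  fixes f g :: "real \<Rightarrow> 'a::real_inner"
  assumes f: "ac_on a b f" and g: "ac_on a b g"
  shows "ac_on a b (\<lambda>t. f t \<bullet> g t)"
proof -
  have "bounded (f ` {a..b})" "bounded (g ` {a..b})"
    using ac_on_continuous[OF f] ac_on_continuous[OF g]
    by (auto intro!: compact_imp_bounded compact_continuous_image)
  then obtain A B where A: "A > 0" "\<And>t. t \<in> {a..b} \<Longrightarrow> norm (f t) \<le> A"
    and B: "B > 0" "\<And>t. t \<in> {a..b} \<Longrightarrow> norm (g t) \<le> B"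
    unfolding bounded_pos by (metis image_eqI)
  show ?thesis
  proof (rule ac_on_dominated[OF f g, where M = "A + B"])
    show "A + B > 0" using A B by simp
    fix s t assume st: "s \<in> {a..b}" "t \<in> {a..b}"
    have "f s \<bullet> g s - f t \<bullet> g t = (f s - f t) \<bullet> g s + f t \<bullet> (g s - g t)"
      by (simp add: inner_diff_left inner_diff_right)
    then have "norm (f s \<bullet> g s - f t \<bullet> g t) \<le> norm (f s - f t) * norm (g s) + norm (f t) * norm (g s - g t)"
      using Cauchy_Schwarz_ineq2[of "f s - f t" "g s"] Cauchy_Schwarz_ineq2[of "f t" "g s - g t"]
      unfolding real_norm_def by linarith
    also have "\<dots> \<le> norm (f s - f t) * (A + B) + (A + B) * norm (g s - g t)"
    proof (intro add_mono mult_left_mono mult_right_mono)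
      show "norm (g s) \<le> A + B" "norm (f t) \<le> A + B" using A B st by (smt (verit))+
    qed auto
    finally show "norm (f s \<bullet> g s - f t \<bullet> g t) \<le> (A + B) * (norm (f s - f t) + norm (g s - g t))"
      by (simp add: algebra_simps)
  qed
qed

section \<open>Differentiability almost everywhere\<close>

text \<open>Slopes are taken over short intervals containing the point, endpoints allowed, so the
  difference quotients at the point are among them. Off \<open>Bad\<close> these slopes are
  eventually bounded on both sides and oscillate across no rational gap. \<open>Bad\<close> is null
  because there are only countably many such gaps.\<close>

lemma ac_on_real_AE_differentiable:
  fixes g :: "real \<Rightarrow> real"
  assumes ac: "ac_on a b g"
  shows "negligible {x \<in> {a<..<b}. \<nexists>D. (g has_real_derivative D) (at x)}"
proof -
  define near where "near = (\<lambda>x d u v. u \<le> x \<and> x \<le> v \<and> u < v \<and> v - u < d \<and> a \<le> u \<and> v \<le> b)"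
  define Up where "Up q = {x. \<forall>d>0. \<exists>u v. near x d u v \<and> g v - g u \<ge> q * (v - u)}" for q
  define Lo where "Lo p = {x. \<forall>d>0. \<exists>u v. near x d u v \<and> g v - g u \<le> p * (v - u)}" for p
  define Bad where "Bad = (\<Inter>q. Up q) \<union> (\<Inter>p. Lo p) \<union> (\<Union>(p, q)\<in>{(p, q)\<in>\<rat> \<times> \<rat>. p < q}. Lo p \<inter> Up q)"
  have UpD: "\<exists>u v. u \<le> x \<and> x \<le> v \<and> u < v \<and> v - u < d \<and> a \<le> u \<and> v \<le> b \<and> g v - g u \<ge> q * (v - u)"
    if "x \<in> Up q" "0 < d" for x d q
    using that unfolding Up_def near_def by (simp only: mem_Collect_eq conj_assoc)
  have LoD: "\<exists>u v. u \<le> x \<and> x \<le> v \<and> u < v \<and> v - u < d \<and> a \<le> u \<and> v \<le> b \<and> g v - g u \<le> p * (v - u)"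
    if "x \<in> Lo p" "0 < d" for x d p
    using that unfolding Lo_def near_def by (simp only: mem_Collect_eq conj_assoc)
  have not_Up: "\<exists>d>0. \<forall>u v. near x d u v \<longrightarrow> g v - g u < q * (v - u)" if "x \<notin> Up q" for x q
    using that unfolding Up_def mem_Collect_eq by (meson not_le)
  have not_Lo: "\<exists>d>0. \<forall>u v. near x d u v \<longrightarrow> g v - g u > p * (v - u)" if "x \<notin> Lo p" for x p
    using that unfolding Lo_def mem_Collect_eq by (meson not_le)
  have "negligible (\<Inter>q. Up q)"
    by (rule ac_on_infinite_slope_negligible[OF ac], rule UpD) auto
  moreover have "negligible (\<Inter>p. Lo p)"
  proof (rule ac_on_infinite_slope_negligible)
    show "ac_on a b (\<lambda>x. - g x)" by (rule ac_on_compose_norm_le[OF ac]) simp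
    fix x d q :: real assume x: "x \<in> (\<Inter>p. Lo p)" and d: "0 < d"
    then obtain u v where "near x d u v" "g v - g u \<le> (- q) * (v - u)" unfolding Lo_def by blast
    then show "\<exists>u v. u \<le> x \<and> x \<le> v \<and> u < v \<and> v - u < d \<and> a \<le> u \<and> v \<le> b \<and> - g v - - g u \<ge> q * (v - u)"
      unfolding near_def by (intro exI[of _ u] exI[of _ v]) simp
  qed
  moreover have "negligible (Lo p \<inter> Up q)" if "p < q" for p q
    by (rule ac_on_slope_gap_negligible[OF ac that LoD UpD]) auto
  then have "negligible (\<Union>(p, q)\<in>{(p, q)\<in>\<rat> \<times> \<rat>. p < q}. Lo p \<inter> Up q)"
    by (intro negligible_countable_Union countable_image countable_subset[OF _ countable_SIGMA[OF countable_rat countable_rat]]) auto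
  ultimately have "negligible Bad" unfolding Bad_def by (intro negligible_Un)
  moreover have "{x \<in> {a<..<b}. \<nexists>D. (g has_real_derivative D) (at x)} \<subseteq> Bad"
  proof (rule subsetI, rule ccontr)
    fix x assume x: "x \<in> {x \<in> {a<..<b}. \<nexists>D. (g has_real_derivative D) (at x)}" and good: "x \<notin> Bad"
    have ab: "a < x" "x < b" using x by auto
    obtain q0 where q0: "x \<notin> Up q0" using good unfolding Bad_def by blast
    obtain p0 where p0: "x \<notin> Lo p0" using good unfolding Bad_def by blast
    have gap: "x \<notin> Up q" if "x \<in> Lo p" "p \<in> \<rat>" "q \<in> \<rat>" "p < q" for p q
      using good that unfolding Bad_def by blast
    have Lo_mono: "x \<notin> Lo p'" if "x \<notin> Lo p" "p' \<le> p" for p p'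
    proof -
      obtain d where d: "d > 0" "\<And>u v. near x d u v \<Longrightarrow> g v - g u > p * (v - u)"
        using not_Lo[OF \<open>x \<notin> Lo p\<close>] by blast
      have "\<not> (g v - g u \<le> p' * (v - u))" if "near x d u v" for u v
      proof -
        have "p' * (v - u) \<le> p * (v - u)"
          using that \<open>p' \<le> p\<close> by (intro mult_right_mono) (auto simp: near_def)
        then show ?thesis using d(2)[OF that] by simp
      qed
      then show ?thesis using d(1) unfolding Lo_def by blast
    qed
    \<comment> \<open>The rational numbers that eventually bound the slopes from below; their
      supremum will be the derivative.\<close>
    define A where "A = {p \<in> \<rat>. x \<notin> Lo p}"
    have "A \<noteq> {}"
    proof -
      obtain p where "p \<in> \<rat>" "p < p0" using Rats_dense_in_real[of "p0 - 1" p0] by auto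
      then have "p \<in> A" using Lo_mono[OF p0, of p] by (simp add: A_def)
      then show ?thesis by blast
    qed
    have "bdd_above A"
    proof (rule bdd_aboveI[of _ q0])
      fix p assume "p \<in> A"
      then obtain d where d: "d > 0" "\<And>u v. near x d u v \<Longrightarrow> g v - g u > p * (v - u)"
        using not_Lo unfolding A_def by blast
      obtain d' where d': "d' > 0" "\<And>u v. near x d' u v \<Longrightarrow> g v - g u < q0 * (v - u)"
        using not_Up[OF q0] by blast
      define v where "v = x + min (min d d') (b - x) / 2"
      have v: "x < v" "v - x < d" "v - x < d'" "v \<le> b"
        using d(1) d'(1) ab by (auto simp: v_def min_def field_simps)
      then have "near x d x v" "near x d' x v" using ab by (auto simp: near_def)
      then have "p * (v - x) < q0 * (v - x)" using d(2) d'(2) by (meson order_less_trans)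
      then show "p \<le> q0" using v(1) by simp
    qed
    define D where "D = Sup A"
    have "((\<lambda>y. (g y - g x) / (y - x)) \<longlongrightarrow> D) (at x)"
    proof (rule tendstoI)
      fix e :: real assume e: "e > 0"
      obtain p where p: "p \<in> A" "D - e < p"
        using less_cSupD[OF \<open>A \<noteq> {}\<close>, of "D - e"] e unfolding D_def by auto
      obtain q where q: "q \<in> \<rat>" "D < q" "q < D + e" using Rats_dense_in_real[of D "D + e"] e by auto
      \<comment> \<open>As \<open>p1\<close> exceeds the supremum, slopes of at most
        \<open>p1\<close> persist. No oscillation crosses the rational gap from \<open>p1\<close> to
        \<open>q\<close>, so slopes of at least \<open>q\<close> die out.\<close>
      obtain p1 where p1: "p1 \<in> \<rat>" "D < p1" "p1 < q" using Rats_dense_in_real[of D q] q by auto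
      have "p1 \<notin> A" using cSup_upper[OF _ \<open>bdd_above A\<close>, of p1] p1(2) unfolding D_def by auto
      then have "x \<notin> Up q" using p1 q by (intro gap[of p1 q]) (auto simp: A_def)
      then obtain d' where d': "d' > 0" "\<And>u v. near x d' u v \<Longrightarrow> g v - g u < q * (v - u)"
        using not_Up by blast
      obtain d where d: "d > 0" "\<And>u v. near x d u v \<Longrightarrow> g v - g u > p * (v - u)"
        using p(1) not_Lo unfolding A_def by blast
      define r where "r = min (min d d') (min (x - a) (b - x))"
      have r: "r > 0" using d d' ab by (simp add: r_def)
      have slope: "dist ((g y - g x) / (y - x)) D < e" if y: "y \<noteq> x" "dist y x < r" for y
      proof -
        define u where "u = min x y" define v where "v = max x y"
        have "\<bar>y - x\<bar> < d" "\<bar>y - x\<bar> < d'" "\<bar>y - x\<bar> < x - a" "\<bar>y - x\<bar> < b - x"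
          using y(2) by (simp_all add: r_def dist_real_def)
        then have "near x d u v" "near x d' u v" and uv: "u < v"
          using y(1) unfolding near_def u_def v_def by (cases "x < y"; simp)+
        then have "p * (v - u) < g v - g u" "g v - g u < q * (v - u)" using d d' by auto
        then have "p < (g v - g u) / (v - u)" "(g v - g u) / (v - u) < q"
          using uv by (auto simp: field_simps)
        moreover have "(g v - g u) / (v - u) = (g y - g x) / (y - x)"
          using y(1) by (cases "x < y") (auto simp: u_def v_def min_def max_def field_simps divide_simps)
        ultimately show ?thesis using p(2) q(3) by (auto simp: dist_real_def abs_less_iff)
      qed
      show "\<forall>\<^sub>F y in at x. dist ((g y - g x) / (y - x)) D < e"
        unfolding eventually_at using r slope by blast
    qed
    then have "(g has_real_derivative D) (at x)" by (simp add: has_field_derivative_iff)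
    then show False using x by blast
  qed
  ultimately show ?thesis by (rule negligible_subset)
qed

lemma ac_on_complex_AE_differentiable:
  fixes f :: "real \<Rightarrow> complex"
  assumes ac: "ac_on a b f"
  shows "negligible {x \<in> {a<..<b}. \<nexists>D. (f has_vector_derivative D) (at x)}"
proof -
  have "ac_on a b (\<lambda>t. Re (f t))"
    by (rule ac_on_compose_norm_le[OF ac]) (metis abs_Re_le_cmod minus_complex.simps(1) real_norm_def)
  then have R: "negligible {x \<in> {a<..<b}. \<nexists>D. ((\<lambda>t. Re (f t)) has_real_derivative D) (at x)}"
    by (rule ac_on_real_AE_differentiable)
  have "ac_on a b (\<lambda>t. Im (f t))"
    by (rule ac_on_compose_norm_le[OF ac]) (metis abs_Im_le_cmod minus_complex.simps(2) real_norm_def)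
  then have I: "negligible {x \<in> {a<..<b}. \<nexists>D. ((\<lambda>t. Im (f t)) has_real_derivative D) (at x)}"
    by (rule ac_on_real_AE_differentiable)
  have "\<exists>D. (f has_vector_derivative D) (at x)"
    if r: "((\<lambda>t. Re (f t)) has_real_derivative r) (at x)" and i: "((\<lambda>t. Im (f t)) has_real_derivative i) (at x)" for x r i
  proof -
    have "((\<lambda>t. of_real (Re (f t)) + \<i> * of_real (Im (f t))) has_vector_derivative (of_real r + \<i> * of_real i)) (at x)"
      using r i unfolding has_real_derivative_iff_has_vector_derivative
      by (intro has_vector_derivative_add has_vector_derivative_mult_right
          bounded_linear.has_vector_derivative[OF bounded_linear_of_real])
    then show ?thesis by (simp add: complex_eq[symmetric]) blast
  qed
  then show ?thesis
    by (intro negligible_subset[OF negligible_Un[OF R I]]) blast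
qed

section \<open>The fundamental theorem of calculus\<close>

text \<open>A Henstock-Kurzweil gauge argument: off \<open>N\<close>, differentiability at the tag
  keeps the error below \<open>c\<close> times the length; intervals tagged in \<open>N\<close> are
  confined to an open set of measure less than \<open>\<delta>\<close>, where absolute continuity
  makes the increments small.\<close>

theorem ac_on_fundamental_theorem:
  fixes f :: "real \<Rightarrow> 'a::banach"
  assumes ac: "ac_on a b f" and ab: "a \<le> b" and N: "negligible N"
    and deriv: "\<And>x. x \<in> {a..b} - N \<Longrightarrow> (f has_vector_derivative h x) (at x within {a..b})"
  shows "(h has_integral (f b - f a)) {a..b}"
proof -
  \<comment> \<open>Zero on \<open>N\<close>, so an interval tagged there contributes only its
    increment to the error; the integral does not see the change.\<close>
  define h0 where "h0 x = (if x \<in> N then 0 else h x)" for x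
  have "(h0 has_integral (f b - f a)) {a..b}"
    unfolding has_integral_real
  proof (intro allI impI)
    fix e :: real assume e: "e > 0"
    obtain \<delta> where \<delta>: "\<delta> > 0" "\<And>D. D division_of \<Union>D \<Longrightarrow> \<Union>D \<subseteq> {a..b} \<Longrightarrow> (\<Sum>K\<in>D. measure lborel K) < \<delta>
       \<Longrightarrow> (\<Sum>K\<in>D. norm (f (Sup K) - f (Inf K))) < e / 2"
      using ac_onD[OF ac half_gt_zero[OF e]] by metis
    obtain T where T: "open T" "N \<subseteq> T" "T \<in> lmeasurable" "measure lebesgue T < \<delta>"
      by (rule lmeasurable_outer_open_less[OF negligible_imp_measurable[OF N] \<delta>(1)])
        (simp add: negligible_imp_measure0[OF N])
    define c where "c = e / (2 * (b - a + 1))"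
    have c: "c > 0" "c * (b - a) < e / 2"
    proof -
      show "c > 0" using e ab by (simp add: c_def)
      have "c * (b - a) < c * (b - a + 1)" using \<open>c > 0\<close> by simp
      also have "\<dots> = e / 2" using ab by (simp add: c_def field_simps)
      finally show "c * (b - a) < e / 2" .
    qed
    have "\<forall>x. \<exists>d>0. (x \<in> N \<longrightarrow> ball x d \<subseteq> T) \<and> (x \<in> {a..b} - N \<longrightarrow>
        (\<forall>y\<in>{a..b}. norm (y - x) < d \<longrightarrow> norm (f y - f x - (y - x) *\<^sub>R h x) \<le> c * norm (y - x)))"
    proof
      fix x
      show "\<exists>d>0. (x \<in> N \<longrightarrow> ball x d \<subseteq> T) \<and> (x \<in> {a..b} - N \<longrightarrow>
        (\<forall>y\<in>{a..b}. norm (y - x) < d \<longrightarrow> norm (f y - f x - (y - x) *\<^sub>R h x) \<le> c * norm (y - x)))"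
      proof (cases "x \<in> N")
        case True
        then obtain d where "d > 0" "ball x d \<subseteq> T" using T(1,2) open_contains_ball by blast
        then show ?thesis using True by auto
      next
        case False
        show ?thesis
        proof (cases "x \<in> {a..b}")
          case True
          then have "(f has_derivative (\<lambda>y. y *\<^sub>R h x)) (at x within {a..b})"
            using deriv[of x] False by (simp add: has_vector_derivative_def)
          then show ?thesis using c(1) False unfolding has_derivative_within_alt by (meson)
        next
          case F: False
          then show ?thesis using False by (intro exI[of _ 1]) auto
        qed
      qed
    qed
    then obtain d where d: "\<And>x. d x > 0" "\<And>x. x \<in> N \<Longrightarrow> ball x (d x) \<subseteq> T"
      "\<And>x y. x \<in> {a..b} - N \<Longrightarrow> y \<in> {a..b} \<Longrightarrow> norm (y - x) < d x \<Longrightarrow>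
         norm (f y - f x - (y - x) *\<^sub>R h x) \<le> c * norm (y - x)" by metis
    define \<gamma> where "\<gamma> x = ball x (d x)" for x
    have "norm ((\<Sum>(x, k)\<in>p. measure lborel k *\<^sub>R h0 x) - (f b - f a)) < e"
      if p: "p tagged_division_of {a..b}" "\<gamma> fine p" for p
    proof -
      note pD = tagged_division_ofD[OF p(1)]
      have pk: "\<exists>u v. k = {u..v} \<and> u \<le> x \<and> x \<le> v \<and> a \<le> u \<and> v \<le> b \<and> {u..v} \<subseteq> ball x (d x)" if xk: "(x, k) \<in> p" for x k
      proof -
        obtain u v where k: "k = {u..v}" using pD(4)[OF xk] by auto
        have "x \<in> k" "k \<subseteq> {a..b}" "k \<subseteq> ball x (d x)"
          using pD(2,3)[OF xk] p(2) xk by (auto simp: \<gamma>_def fine_def)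
        then show ?thesis using k by (intro exI[of _ u] exI[of _ v]) auto
      qed
      define p1 where "p1 = {xk \<in> p. fst xk \<in> N}"
      define err where "err = (\<lambda>(x, k). measure lborel k *\<^sub>R h0 x - (f (Sup k) - f (Inf k)))"
      have fin: "finite p" by (rule pD(1))
      have "(\<Sum>(x, k)\<in>p. measure lborel k *\<^sub>R h0 x) - (f b - f a) = (\<Sum>xk\<in>p. err xk)"
        unfolding additive_tagged_division_1[OF ab p(1), of f, symmetric] err_def
        by (simp add: sum_subtractf[symmetric] case_prod_beta)
      also have "\<dots> = (\<Sum>xk\<in>p1. err xk) + (\<Sum>xk\<in>p - p1. err xk)"
        using fin by (subst sum.union_disjoint[symmetric]) (auto simp: p1_def intro!: sum.cong)
      finally have split: "(\<Sum>(x, k)\<in>p. measure lborel k *\<^sub>R h0 x) - (f b - f a)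
          = (\<Sum>xk\<in>p1. err xk) + (\<Sum>xk\<in>p - p1. err xk)" .
      have "norm (\<Sum>xk\<in>p - p1. err xk) \<le> c * (b - a)"
      proof -
        have "norm (\<Sum>xk\<in>p - p1. err xk) \<le> (\<Sum>xk\<in>p - p1. c * measure lborel (snd xk))"
        proof (rule sum_norm_le)
          fix xk assume xk: "xk \<in> p - p1"
          obtain x k where eq: "xk = (x, k)" by (cases xk)
          have xp: "(x, k) \<in> p" "x \<notin> N" using xk eq by (auto simp: p1_def)
          obtain u v where uv: "k = {u..v}" "u \<le> x" "x \<le> v" "a \<le> u" "v \<le> b" "{u..v} \<subseteq> ball x (d x)"
            using pk[OF xp(1)] by blast
          have x: "x \<in> {a..b} - N" using uv xp by simp
          have "u \<in> {u..v}" "v \<in> {u..v}" using uv(2,3) by auto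
          then have "u \<in> ball x (d x)" "v \<in> ball x (d x)" using uv(6) by blast+
          then have "norm (u - x) < d x" "norm (v - x) < d x" by (auto simp: dist_real_def)
          then have 1: "norm (f u - f x - (u - x) *\<^sub>R h x) \<le> c * norm (u - x)"
            "norm (f v - f x - (v - x) *\<^sub>R h x) \<le> c * norm (v - x)"
            using uv by (intro d(3)[OF x]; simp)+
          \<comment> \<open>Straddle estimate: the tag lies between \<open>u\<close> and
            \<open>v\<close>, so the errors towards the two ends add up to \<open>c\<close> times
            the length.\<close>
          have err_eq: "err xk = (f u - f x - (u - x) *\<^sub>R h x) - (f v - f x - (v - x) *\<^sub>R h x)"
            using uv xp by (simp add: err_def eq h0_def algebra_simps)
          have "norm (err xk) \<le> c * norm (u - x) + c * norm (v - x)"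
            unfolding err_eq by (rule order_trans[OF norm_triangle_ineq4 add_mono[OF 1]])
          also have "\<dots> = c * measure lborel (snd xk)" using uv by (simp add: eq algebra_simps)
          finally show "norm (err xk) \<le> c * measure lborel (snd xk)" .
        qed
        also have "\<dots> \<le> (\<Sum>xk\<in>p. c * measure lborel (snd xk))"
          using fin c(1) by (intro sum_mono2) auto
        also have "\<dots> = c * (\<Sum>(x, k)\<in>p. measure lborel k)" by (simp add: sum_distrib_left case_prod_beta)
        also have "(\<Sum>(x, k)\<in>p. measure lborel k) = b - a"
          using additive_content_tagged_division[of p a b] p(1) ab by simp
        finally show ?thesis .
      qed
      moreover have "norm (\<Sum>xk\<in>p1. err xk) < e / 2"
      proof -
        have p1_part: "p1 tagged_partial_division_of {a..b}"
          using tagged_partial_division_subset[of p "{a..b}" p1] p(1)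
          by (auto simp: tagged_division_of_def p1_def)
        define D where "D = snd ` p1"
        have D: "D division_of \<Union>D" unfolding D_def by (rule partial_division_of_tagged_division[OF p1_part])
        have DN: "k \<subseteq> T \<and> k \<subseteq> {a..b} \<and> k \<in> lmeasurable" if k: "k \<in> D" for k
        proof -
          obtain x where x: "(x, k) \<in> p" "x \<in> N" using k by (auto simp: D_def p1_def)
          obtain u v where "k = {u..v}" "a \<le> u" "v \<le> b" "{u..v} \<subseteq> ball x (d x)"
            using pk[OF x(1)] by blast
          then show ?thesis using d(2)[OF x(2)] by auto
        qed
        have "(\<Sum>k\<in>D. measure lborel k) = (\<Sum>k\<in>D. measure lebesgue k)"
        proof (rule sum.cong[OF refl])
          fix k assume k: "k \<in> D"
          obtain u v where "k = {u..v}" by (rule division_real_intervalE[OF D k])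
          then show "measure lborel k = measure lebesgue k" by simp
        qed
        also have "\<dots> = measure lebesgue (\<Union>D)"
        proof (rule measure_negligible_finite_Union[symmetric])
          show "pairwise (\<lambda>S T. negligible (S \<inter> T)) D"
          proof (rule pairwiseI)
            fix k k' assume k: "k \<in> D" "k' \<in> D" "k \<noteq> k'"
            have "interior k \<inter> interior k' = {}" using division_ofD(5)[OF D k] .
            then have "k \<inter> k' \<subseteq> (k - interior k) \<union> (k' - interior k')" by blast
            moreover have "negligible (k - interior k)" if k: "k \<in> D" for k
            proof -
              obtain u v where "k = {u..v}" by (rule division_real_intervalE[OF D k])
              then have "k - interior k \<subseteq> {u, v}" by auto
              then show ?thesis by (intro negligible_subset[OF negligible_finite]) auto
            qed
            ultimately show "negligible (k \<inter> k')" using k by (meson negligible_Un negligible_subset)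
          qed
        qed (use division_ofD(1)[OF D] DN in auto)
        also have "\<dots> \<le> measure lebesgue T"
          using DN division_ofD(1)[OF D] T(3)
          by (intro measure_mono_fmeasurable) (auto intro: sets.finite_Union fmeasurableD)
        finally have "(\<Sum>k\<in>D. measure lborel k) < \<delta>" using T(4) by simp
        then have "(\<Sum>k\<in>D. norm (f (Sup k) - f (Inf k))) < e / 2"
          using D DN by (intro \<delta>(2)) auto
        moreover have "norm (\<Sum>xk\<in>p1. err xk) \<le> (\<Sum>(x, k)\<in>p1. norm (f (Sup k) - f (Inf k)))"
          by (rule sum_norm_le) (auto simp: err_def p1_def h0_def norm_minus_commute)
        moreover have "(\<Sum>(x, k)\<in>p1. norm (f (Sup k) - f (Inf k))) = (\<Sum>k\<in>D. norm (f (Sup k) - f (Inf k)))"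
        proof -
          \<comment> \<open>One interval can carry two tags only if it is degenerate, and then its
            increment is zero, so the sum over pairs is a sum over intervals. \<open>w\<close> also
            vanishes on the empty set, where \<open>Sup\<close> and \<open>Inf\<close> mean
            nothing.\<close>
          define w where "w k = (if k = {} then 0 else norm (f (Sup k) - f (Inf k)))" for k
          have ne: "k \<noteq> {}" if "k \<in> D" for k using division_ofD(3)[OF D that] .
          have "(\<Sum>(x, k)\<in>p1. norm (f (Sup k) - f (Inf k))) = (\<Sum>(x, k)\<in>p1. w k)"
            using ne by (intro sum.cong) (force simp: w_def D_def)+
          also have "\<dots> = (\<Sum>k\<in>D. w k)"
            unfolding D_def
          proof (rule sum.over_tagged_division_lemma)
            show "p1 tagged_division_of \<Union>(snd ` p1)" by (rule tagged_partial_division_of_Union_self[OF p1_part])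
            show "w (cbox u v) = 0" if "box u v = {}" for u v
              using that by (cases "u = v") (auto simp: w_def)
          qed
          also have "\<dots> = (\<Sum>k\<in>D. norm (f (Sup k) - f (Inf k)))"
            using ne by (intro sum.cong) (auto simp: w_def)
          finally show ?thesis .
        qed
        ultimately show ?thesis by simp
      qed
      ultimately show ?thesis unfolding split
        using c(2) norm_triangle_ineq[of "\<Sum>xk\<in>p1. err xk" "\<Sum>xk\<in>p - p1. err xk"] by linarith
    qed
    moreover have "gauge \<gamma>" unfolding \<gamma>_def using d(1) by (intro gaugeI) auto
    ultimately show "\<exists>\<gamma>. gauge \<gamma> \<and> (\<forall>\<D>. \<D> tagged_division_of {a..b} \<and> \<gamma> fine \<D> \<longrightarrow>
        norm ((\<Sum>(x, k)\<in>\<D>. measure lborel k *\<^sub>R h0 x) - (f b - f a)) < e)" by blast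
  qed
  from has_integral_spike[OF N _ this, of h] show ?thesis by (simp add: h0_def)
qed

section \<open>Symmetry of the minimal operator\<close>

locale interaction_sequence =
  fixes x :: "nat \<Rightarrow> real"
  assumes x_0: "x 0 = 0" and x_mono: "strict_mono x" and x_lim: "filterlim x at_top sequentially"
begin

lemma x_nonneg: "0 \<le> x n"
  using strict_mono_mono[OF x_mono] x_0 by (metis le0 monoD)

lemma x_pos: "n \<ge> 1 \<Longrightarrow> 0 < x n"
  using strict_monoD[OF x_mono, of 0 n] x_0 by simp

lemma x_Suc_less: "x n < x (Suc n)"
  using strict_monoD[OF x_mono] by simp

lemma x_unbounded: "\<exists>n. t < x n"
proof -
  have "\<forall>\<^sub>F n in sequentially. t < x n" using x_lim by (simp add: filterlim_at_top_dense)
  then show ?thesis by (auto simp: eventually_sequentially)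
qed

lemma bracket:
  assumes "0 \<le> t"
  obtains n where "x n \<le> t" "t < x (Suc n)"
proof -
  define m where "m = (LEAST n. t < x n)"
  have m: "t < x m" unfolding m_def by (rule LeastI_ex[OF x_unbounded])
  then have "m \<noteq> 0" using x_0 assms by (intro notI) simp
  then obtain n where n: "m = Suc n" using not0_implies_Suc by blast
  have "\<not> t < x n" by (rule not_less_Least) (simp add: m_def[symmetric] n)
  then show thesis using that[of n] m n by simp
qed

lemma open_piece_subset: "{x n<..<x (Suc n)} \<subseteq> punctured x"
proof
  fix t assume t: "t \<in> {x n<..<x (Suc n)}"
  have "t \<noteq> x k" for k
  proof
    assume "t = x k"
    then have "n < k" "k < Suc n" using t strict_mono_less[OF x_mono] by auto
    then show False by simp
  qed
  then show "t \<in> punctured x" using t x_nonneg[of n] by (auto simp: punctured_def interaction_points_def)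
qed

lemma initial_piece_subset: "{0..<x 1} \<subseteq> punctured x"
proof
  fix t assume t: "t \<in> {0..<x 1}"
  have "t \<noteq> x k" if "k \<ge> 1" for k
    using t strict_mono_mono[OF x_mono] that monoD by fastforce
  then show "t \<in> punctured x" using t by (auto simp: punctured_def interaction_points_def)
qed

text \<open>Replaces the filter within the punctured half-line by one within a compact interval,
  where the standard theorems on derivatives apply. At 0 the interval is one-sided, so
  \<open>c < t\<close> is claimed for positive \<open>t\<close> only.\<close>

lemma punctured_local_interval:
  assumes t: "t \<in> punctured x"
  obtains c d where "c \<le> t" "t < d" "{c..d} \<subseteq> punctured x" "0 < t \<longrightarrow> c < t"
    "at t within punctured x = at t within {c..d}"
proof -
  have "0 \<le> t" using t by (simp add: punctured_def)
  show thesis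
  proof (cases "t = 0")
    case True
    define d where "d = x 1 / 2"
    have d: "0 < d" "d < x 1" using x_pos[of 1] by (auto simp: d_def)
    have sub: "{0..d} \<subseteq> punctured x" using initial_piece_subset d by auto
    have "at t within punctured x = at t within {0..d}"
    proof (rule at_within_nhd[of t "{..<d}"])
      show "punctured x \<inter> {..<d} - {t} = {0..d} \<inter> {..<d} - {t}"
        using sub by (auto simp: punctured_def)
    qed (use True d in auto)
    then show thesis using that[of 0 d] d True sub by simp
  next
    case False
    then have "t > 0" using \<open>0 \<le> t\<close> by simp
    obtain n where n: "x n \<le> t" "t < x (Suc n)" by (rule bracket[OF \<open>0 \<le> t\<close>])
    have "x n < t"
    proof (cases "n = 0")
      case True
      then show ?thesis using x_0 \<open>t > 0\<close> by simp
    next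
      case False
      then have "t \<noteq> x n" using t by (auto simp: punctured_def interaction_points_def)
      then show ?thesis using n by simp
    qed
    define c where "c = (x n + t) / 2"
    define d where "d = (t + x (Suc n)) / 2"
    have cd: "x n < c" "c < t" "t < d" "d < x (Suc n)" using \<open>x n < t\<close> n by (auto simp: c_def d_def)
    have sub: "{c..d} \<subseteq> punctured x" using open_piece_subset[of n] cd by (auto simp: subset_iff)
    have int: "t \<in> interior {c..d}" using cd by simp
    have "at t within punctured x = at t within {c..d}"
      unfolding at_within_interior[OF int] at_within_interior[OF subsetD[OF interior_mono[OF sub] int]] ..
    then show thesis using that[of c d] cd(2,3) sub by simp
  qed
qed

lemma at_within_punctured_interior:
  assumes "t \<in> {c<..<d}" "{c<..<d} \<subseteq> punctured x"
  shows "at t within punctured x = at t"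
  using assms by (intro at_within_interior interiorI[of "{c<..<d}"]) auto

lemma AC_loc_ac_on:
  assumes "AC_loc (punctured x) f" "{c..d} \<subseteq> punctured x" "c \<le> d"
  shows "ac_on c d f"
  using assms unfolding AC_loc_def abs_continuous_on_iff by blast

text \<open>\<open>pderivative\<close> is a value picked by choice; wherever a two-sided derivative
  exists, it is the value picked. The ends \<open>c\<close> and \<open>d\<close> are put into the
  null set.\<close>

lemma AC_loc_AE_derivative:
  assumes f: "AC_loc (punctured x) f" and cd: "{c..d} \<subseteq> punctured x" "c \<le> d"
  shows "negligible {s \<in> {c..d}. \<not> (f has_vector_derivative pderivative x f s) (at s)}"
proof (rule negligible_subset)
  show "negligible ({s \<in> {c<..<d}. \<nexists>D. (f has_vector_derivative D) (at s)} \<union> {c, d})"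
    by (intro negligible_Un ac_on_complex_AE_differentiable AC_loc_ac_on[OF f cd] negligible_finite) simp
  have "(f has_vector_derivative pderivative x f s) (at s)"
    if "s \<in> {c<..<d}" "(f has_vector_derivative D) (at s)" for s D
  proof -
    have "at s within punctured x = at s"
      using cd by (intro at_within_punctured_interior[OF that(1)]) auto
    then show ?thesis using vector_derivative_at[OF that(2)] that(2) by (simp add: pderivative_def)
  qed
  then show "{s \<in> {c..d}. \<not> (f has_vector_derivative pderivative x f s) (at s)}
    \<subseteq> {s \<in> {c<..<d}. \<nexists>D. (f has_vector_derivative D) (at s)} \<union> {c, d}" by force
qed

lemma AC_loc_pderivative_has_integral:
  assumes f: "AC_loc (punctured x) f" and cd: "{c..d} \<subseteq> punctured x" "c \<le> d"
  shows "(pderivative x f has_integral f d - f c) {c..d}"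
  by (rule ac_on_fundamental_theorem[OF AC_loc_ac_on[OF f cd] cd(2) AC_loc_AE_derivative[OF f cd]])
    (auto intro: has_vector_derivative_at_within)

section \<open>Green's identity for the minimal operator\<close>

definition wronskian :: "(real \<Rightarrow> complex) \<Rightarrow> (real \<Rightarrow> complex) \<Rightarrow> real \<Rightarrow> real" where
  "wronskian f g t = pderivative x f t \<bullet> g t - f t \<bullet> pderivative x g t"

text \<open>The derivative of \<open>wronskian\<close>, the boundary form of Green's identity, after
  the products of first derivatives have cancelled. Its integral measures the failure of
  symmetry.\<close>

definition wronskian_density :: "(real \<Rightarrow> complex) \<Rightarrow> (real \<Rightarrow> complex) \<Rightarrow> real \<Rightarrow> real" where
  "wronskian_density f g t = pderivative x (pderivative x f) t \<bullet> g t - f t \<bullet> pderivative x (pderivative x g) t"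

lemma wronskian_has_integral:
  assumes f: "f \<in> W22 x" and g: "g \<in> W22 x" and cd: "{c..d} \<subseteq> punctured x" "c \<le> d"
  shows "(wronskian_density f g has_integral wronskian f g d - wronskian f g c) {c..d}"
proof -
  have AC: "AC_loc (punctured x) f" "AC_loc (punctured x) (pderivative x f)"
    "AC_loc (punctured x) g" "AC_loc (punctured x) (pderivative x g)"
    using f g by (auto simp: W22_def)
  define N where "N h = {s \<in> {c..d}. \<not> (h has_vector_derivative pderivative x h s) (at s)}" for h
  have N: "negligible (N h)" if "AC_loc (punctured x) h" for h
    unfolding N_def by (rule AC_loc_AE_derivative[OF that cd])
  show ?thesis
  proof (rule ac_on_fundamental_theorem[OF _ cd(2)])
    show "ac_on c d (wronskian f g)" unfolding wronskian_def
      by (intro ac_on_diff ac_on_inner AC_loc_ac_on[OF _ cd] AC)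
    show "negligible (N f \<union> N (pderivative x f) \<union> N g \<union> N (pderivative x g))"
      by (intro negligible_Un N AC)
    fix s assume "s \<in> {c..d} - (N f \<union> N (pderivative x f) \<union> N g \<union> N (pderivative x g))"
    then have d: "(f has_vector_derivative pderivative x f s) (at s within {c..d})"
      "(pderivative x f has_vector_derivative pderivative x (pderivative x f) s) (at s within {c..d})"
      "(g has_vector_derivative pderivative x g s) (at s within {c..d})"
      "(pderivative x g has_vector_derivative pderivative x (pderivative x g) s) (at s within {c..d})"
      by (auto simp: N_def intro: has_vector_derivative_at_within)
    note inner_deriv = bounded_bilinear.has_vector_derivative[OF bounded_bilinear_inner]
    have "(wronskian f g has_vector_derivative
        (pderivative x f s \<bullet> pderivative x g s + pderivative x (pderivative x f) s \<bullet> g s)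
        - (f s \<bullet> pderivative x (pderivative x g) s + pderivative x f s \<bullet> pderivative x g s)) (at s within {c..d})"
      unfolding wronskian_def by (intro has_vector_derivative_diff inner_deriv d)
    then show "(wronskian f g has_vector_derivative wronskian_density f g s) (at s within {c..d})"
      by (simp add: wronskian_density_def)
  qed
qed

lemma wronskian_density_integrable:
  assumes f: "f \<in> W22 x" and g: "g \<in> W22 x"
  shows "integrable half_line_measure (wronskian_density f g)"
  using assms unfolding wronskian_density_def W22_def
  by (intro Bochner_Integration.integrable_diff L2_integrable_inner) auto

lemma wronskian_density_integrable_on:
  assumes f: "f \<in> W22 x" and g: "g \<in> W22 x" and "0 \<le> a"
  shows "wronskian_density f g integrable_on {a..b}"
proof (rule integrable_on_subinterval)
  show "wronskian_density f g integrable_on {0..}"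
    by (rule integrable_on_lebesgue_on[OF wronskian_density_integrable[OF f g]]) simp
qed (use assms in auto)

text \<open>At the ends of the piece \<open>f\<close> and \<open>g\<close> may jump, so the
  fundamental theorem applies inside only. The primitive \<open>H\<close> of the density is
  continuous up to the ends and differs from the Wronskian by the constant \<open>k\<close>, so
  their one-sided limits can be compared.\<close>

lemma wronskian_piece_integral:
  assumes f: "f \<in> W22 x" and g: "g \<in> W22 x"
    and r: "(wronskian f g \<longlongrightarrow> r) (at_right (x n))" and l: "(wronskian f g \<longlongrightarrow> l) (at_left (x (Suc n)))"
  shows "integral {x n..x (Suc n)} (wronskian_density f g) = l - r"
proof -
  define a where "a = x n"
  define b where "b = x (Suc n)"
  have ab: "0 \<le> a" "a < b" using x_nonneg x_Suc_less by (auto simp: a_def b_def)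
  define H where "H t = integral {a..t} (wronskian_density f g)" for t
  have int: "wronskian_density f g integrable_on {s..t}" if "0 \<le> s" for s t
    by (rule wronskian_density_integrable_on[OF f g that])
  have H: "continuous_on {a..b} H" unfolding H_def
    by (rule indefinite_integral_continuous_1[OF int[OF ab(1)]])
  define m where "m = (a + b) / 2"
  have m: "a < m" "m < b" using ab by (auto simp: m_def)
  define k where "k = wronskian f g m - H m"
  have incr: "wronskian f g t - wronskian f g s = H t - H s" if "a < s" "s \<le> t" "t < b" for s t
  proof -
    have "{s..t} \<subseteq> punctured x" using open_piece_subset[of n] that by (auto simp: a_def b_def subset_iff)
    then have "integral {s..t} (wronskian_density f g) = wronskian f g t - wronskian f g s"
      using wronskian_has_integral[OF f g] that by (intro integral_unique) auto
    moreover have "integral {a..s} (wronskian_density f g) + integral {s..t} (wronskian_density f g) = H t"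
      unfolding H_def using that by (intro Henstock_Kurzweil_Integration.integral_combine int ab) auto
    ultimately show ?thesis by (simp add: H_def)
  qed
  have eq: "wronskian f g t = H t + k" if "a < t" "t < b" for t
    using incr[of t m] incr[of m t] that m by (cases "t \<le> m") (auto simp: k_def)
  have Hends: "(H \<longlongrightarrow> H a) (at_right a)" "(H \<longlongrightarrow> H b) (at_left b)"
    using H ab unfolding continuous_on_def
    by (auto simp: at_within_Icc_at_right[symmetric] at_within_Icc_at_left[symmetric])
  have Hlim: "((\<lambda>t. H t + k) \<longlongrightarrow> H a + k) (at_right a)" "((\<lambda>t. H t + k) \<longlongrightarrow> H b + k) (at_left b)"
    by (intro tendsto_add Hends tendsto_const)+
  have "(wronskian f g \<longlongrightarrow> H a + k) (at_right a)"
    by (rule Lim_transform_eventually[OF Hlim(1)])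
      (use eventually_at_right_real[OF ab(2)] eq in \<open>auto elim: eventually_mono\<close>)
  then have 1: "r = H a + k" using tendsto_unique[OF _ r] by (simp add: a_def)
  have "(wronskian f g \<longlongrightarrow> H b + k) (at_left b)"
    by (rule Lim_transform_eventually[OF Hlim(2)])
      (use eventually_at_left_real[OF ab(2)] eq in \<open>auto elim: eventually_mono\<close>)
  then have 2: "l = H b + k" using tendsto_unique[OF _ l] by (simp add: b_def)
  have "H a = 0" by (simp add: H_def)
  then show ?thesis using 1 2 by (simp add: H_def a_def b_def)
qed

text \<open>Telescoping over the pieces, as the two one-sided limits at \<open>x n\<close> agree;
  \<open>L 0 = 0\<close> will come from the Neumann condition.\<close>

lemma wronskian_integral_upto:
  assumes f: "f \<in> W22 x" and g: "g \<in> W22 x"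
    and r: "\<And>n. (wronskian f g \<longlongrightarrow> L n) (at_right (x n))"
    and l: "\<And>n. n \<ge> 1 \<Longrightarrow> (wronskian f g \<longlongrightarrow> L n) (at_left (x n))" and "L 0 = 0"
  shows "integral {0..x n} (wronskian_density f g) = L n"
proof (induction n)
  case 0
  then show ?case using \<open>L 0 = 0\<close> by (simp add: x_0)
next
  case (Suc n)
  have "integral {0..x n} (wronskian_density f g) + integral {x n..x (Suc n)} (wronskian_density f g)
      = integral {0..x (Suc n)} (wronskian_density f g)"
    using x_nonneg[of n] x_Suc_less[of n]
    by (intro Henstock_Kurzweil_Integration.integral_combine wronskian_density_integrable_on[OF f g]) auto
  moreover have "integral {x n..x (Suc n)} (wronskian_density f g) = L (Suc n) - L n"
    by (intro wronskian_piece_integral[OF f g] r l) simp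
  ultimately show ?case using Suc by simp
qed

lemma W22_comp_support:
  assumes "f \<in> W22_comp x"
  obtains R where "0 \<le> R" "\<forall>t\<in>punctured x. R < t \<longrightarrow> f t = 0"
proof -
  have "bounded {t \<in> punctured x. f t \<noteq> 0}"
    using assms bounded_subset[OF compact_imp_bounded closure_subset] by (auto simp: W22_comp_def)
  then obtain R where R: "\<And>t. t \<in> punctured x \<Longrightarrow> f t \<noteq> 0 \<Longrightarrow> \<bar>t\<bar> \<le> R" unfolding bounded_iff by auto
  have "f t = 0" if "t \<in> punctured x" "max 0 R < t" for t using R[of t] that by (intro ccontr[of "f t = 0"]) auto
  then show thesis using that[of "max 0 R"] by simp
qed

lemma negligible_interaction_points: "negligible (interaction_points x)"
proof -
  have "interaction_points x = \<Union>((\<lambda>n. {x n}) ` {1..})" by (auto simp: interaction_points_def)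
  also have "negligible \<dots>" by (rule negligible_countable_Union) auto
  finally show ?thesis .
qed

text \<open>The Wronskian does not jump at \<open>x n\<close>, because both functions satisfy the
  interface condition with the same real coefficient. It tends to 0 at the origin by the Neumann
  condition and vanishes beyond the supports, so the integral of its density is zero.\<close>

lemma H_min_symmetric:
  assumes f: "f \<in> H_min_domain x \<beta>" and g: "g \<in> H_min_domain x \<beta>"
  shows "(\<integral>t. wronskian_density f g t \<partial>half_line_measure) = 0"
proof -
  have comp: "f \<in> W22_comp x" "g \<in> W22_comp x" using f g by (auto simp: H_min_domain_def)
  then have W: "f \<in> W22 x" "g \<in> W22 x" by (auto simp: W22_comp_def)
  have at0: "(h \<longlongrightarrow> h 0) (at_right 0)" if "h \<in> W22 x" for h
  proof -
    define d where "d = x 1 / 2"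
    have d: "0 < d" "d < x 1" using x_pos[of 1] by (auto simp: d_def)
    have "{0..d} \<subseteq> punctured x" using initial_piece_subset d by (auto simp: subset_iff)
    then have "continuous_on {0..d} h"
      using that d by (intro ac_on_continuous AC_loc_ac_on) (auto simp: W22_def)
    then show ?thesis using d by (auto simp: continuous_on_def at_within_Icc_at_right[symmetric])
  qed
  have lim0: "(wronskian f g \<longlongrightarrow> 0) (at_right (x 0))"
  proof -
    have "(pderivative x f \<longlongrightarrow> 0) (at_right 0)" "(pderivative x g \<longlongrightarrow> 0) (at_right 0)"
      using f g by (auto simp: H_min_domain_def)
    then have "(wronskian f g \<longlongrightarrow> 0 \<bullet> g 0 - f 0 \<bullet> 0) (at_right 0)"
      unfolding wronskian_def by (intro tendsto_intros at0 W)
    then show ?thesis by (simp add: x_0)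
  qed
  have "\<exists>l. (wronskian f g \<longlongrightarrow> l) (at_right (x n)) \<and> (wronskian f g \<longlongrightarrow> l) (at_left (x n))" if n: "n \<ge> 1" for n
  proof -
    obtain fr fl f' where F: "(f \<longlongrightarrow> fr) (at_right (x n))" "(f \<longlongrightarrow> fl) (at_left (x n))"
      "(pderivative x f \<longlongrightarrow> f') (at_right (x n))" "(pderivative x f \<longlongrightarrow> f') (at_left (x n))"
      "fr - fl = complex_of_real (\<beta> n) * f'"
      using f n unfolding H_min_domain_def by blast
    obtain gr gl g' where G: "(g \<longlongrightarrow> gr) (at_right (x n))" "(g \<longlongrightarrow> gl) (at_left (x n))"
      "(pderivative x g \<longlongrightarrow> g') (at_right (x n))" "(pderivative x g \<longlongrightarrow> g') (at_left (x n))"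
      "gr - gl = complex_of_real (\<beta> n) * g'"
      using g n unfolding H_min_domain_def by blast
    have "(wronskian f g \<longlongrightarrow> f' \<bullet> gr - fr \<bullet> g') (at_right (x n))"
      unfolding wronskian_def by (intro tendsto_intros F G)
    moreover have "(wronskian f g \<longlongrightarrow> f' \<bullet> gl - fl \<bullet> g') (at_left (x n))"
      unfolding wronskian_def by (intro tendsto_intros F G)
    moreover have "f' \<bullet> gr - fr \<bullet> g' = f' \<bullet> gl - fl \<bullet> g'"
    proof -
      have "f' \<bullet> gr - fr \<bullet> g' - (f' \<bullet> gl - fl \<bullet> g') = f' \<bullet> (gr - gl) - (fr - fl) \<bullet> g'"
        by (simp add: inner_diff_left inner_diff_right)
      also have "\<dots> = 0" unfolding F(5) G(5) by (simp flip: scaleR_conv_of_real)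
      finally show ?thesis by simp
    qed
    ultimately show ?thesis by auto
  qed
  then obtain L0 where L0: "\<And>n. n \<ge> 1 \<Longrightarrow> (wronskian f g \<longlongrightarrow> L0 n) (at_right (x n))"
    "\<And>n. n \<ge> 1 \<Longrightarrow> (wronskian f g \<longlongrightarrow> L0 n) (at_left (x n))" by metis
  define L where "L n = (if n = 0 then 0 else L0 n)" for n
  have int: "integral {0..x n} (wronskian_density f g) = L n" for n
    by (rule wronskian_integral_upto[OF W]) (use L0 lim0 in \<open>auto simp: L_def\<close>)
  obtain R1 where R1: "0 \<le> R1" "\<forall>t\<in>punctured x. R1 < t \<longrightarrow> f t = 0"
    by (rule W22_comp_support[OF comp(1)])
  obtain R2 where R2: "0 \<le> R2" "\<forall>t\<in>punctured x. R2 < t \<longrightarrow> g t = 0"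
    by (rule W22_comp_support[OF comp(2)])
  define R where "R = max R1 R2"
  have R: "0 \<le> R" and zero: "f t = 0" "g t = 0" if "t \<in> punctured x" "R < t" for t
    using R1 R2 that by (auto simp: R_def)
  have W0: "wronskian f g t = 0" and D0: "wronskian_density f g t = 0" if t: "t \<in> punctured x" "R < t" for t
    using zero[OF t] by (simp_all add: wronskian_def wronskian_density_def)
  obtain m where m: "R < x m" using x_unbounded by blast
  \<comment> \<open>The successor, so that the whole piece to the left of \<open>x n\<close> lies
    beyond the supports.\<close>
  define n where "n = Suc m"
  have "\<forall>\<^sub>F t in at_left (x n). wronskian f g t = 0"
  proof -
    have "\<forall>\<^sub>F t in at_left (x n). t \<in> {x m<..<x n}"
      using eventually_at_left_real[OF x_Suc_less[of m]] by (simp add: n_def)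
    then show ?thesis
      by eventually_elim (use open_piece_subset[of m] m in \<open>auto simp: n_def intro!: W0\<close>)
  qed
  then have "(wronskian f g \<longlongrightarrow> 0) (at_left (x n))" by (rule tendsto_eventually)
  moreover have "(wronskian f g \<longlongrightarrow> L n) (at_left (x n))" using L0(2) by (simp add: L_def n_def)
  ultimately have "L n = 0" using tendsto_unique[OF trivial_limit_at_left_real] by blast
  have "integral {0..} (wronskian_density f g) = integral {0..x n} (wronskian_density f g)"
  proof (rule integral_spike_set)
    have "x m < x n" by (simp add: n_def x_Suc_less)
    then show "negligible {t \<in> {0..} - {0..x n}. wronskian_density f g t \<noteq> 0}"
      by (intro negligible_subset[OF negligible_interaction_points])
        (use D0 m in \<open>force simp: punctured_def\<close>)
    show "negligible {t \<in> {0..x n} - {0..}. wronskian_density f g t \<noteq> 0}"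
      by (rule negligible_subset[of "{}"]) auto
  qed
  also have "\<dots> = 0" using int \<open>L n = 0\<close> by simp
  finally show ?thesis
    using lebesgue_integral_eq_integral[OF wronskian_density_integrable[OF W]] by simp
qed

end

section \<open>Test functions\<close>

text \<open>The square makes the derivative vanish at the edge of the support. One continuous
  derivative is enough: bumps serve as \<open>f'\<close>, and their derivative as \<open>f''\<close>
  merely has to be square integrable.\<close>

definition bump :: "real \<Rightarrow> real \<Rightarrow> real \<Rightarrow> real" where
  "bump c \<delta> t = (max 0 (1 - ((t - c) / \<delta>)\<^sup>2))\<^sup>2"

definition bump_deriv :: "real \<Rightarrow> real \<Rightarrow> real \<Rightarrow> real" where
  "bump_deriv c \<delta> t = - 4 * ((t - c) / \<delta>) * max 0 (1 - ((t - c) / \<delta>)\<^sup>2) / \<delta>"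

lemma positive_part_square_has_derivative:
  "((\<lambda>u::real. (max 0 u)\<^sup>2) has_real_derivative 2 * max 0 u) (at u)"
proof -
  consider "u > 0" | "u < 0" | "u = 0" by linarith
  then show ?thesis
  proof cases
    case 1
    have "((\<lambda>u. u\<^sup>2) has_real_derivative 2 * max 0 u) (at u)"
      using 1 by (auto intro!: derivative_eq_intros)
    then show ?thesis
      by (rule has_field_derivative_transform_within_open[where S = "{0<..}"]) (use 1 in auto)
  next
    case 2
    have "((\<lambda>u. 0) has_real_derivative 2 * max 0 u) (at u)"
      using 2 by simp
    then show ?thesis
      by (rule has_field_derivative_transform_within_open[where S = "{..<0}"]) (use 2 in auto)
  next
    case 3
    have "((\<lambda>y::real. ((max 0 y)\<^sup>2 - (max 0 0)\<^sup>2) / (y - 0)) \<longlongrightarrow> 0) (at 0)"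
    proof (rule Lim_null_comparison)
      show "\<forall>\<^sub>F y::real in at 0. norm (((max 0 y)\<^sup>2 - (max 0 0)\<^sup>2) / (y - 0)) \<le> \<bar>y\<bar>"
        by (rule always_eventually) (auto simp: max_def power2_eq_square)
      show "((\<lambda>y::real. \<bar>y\<bar>) \<longlongrightarrow> 0) (at 0)"
        using tendsto_rabs[OF tendsto_ident_at[of "0::real" UNIV]] by simp
    qed
    then show ?thesis using 3 by (simp add: has_field_derivative_iff)
  qed
qed

lemma bump_has_derivative:
  assumes "\<delta> > 0"
  shows "(bump c \<delta> has_real_derivative bump_deriv c \<delta> t) (at t)"
proof -
  have "((\<lambda>t. 1 - ((t - c) / \<delta>)\<^sup>2) has_real_derivative - (2 * ((t - c) / \<delta>) / \<delta>)) (at t)"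
  proof -
    have "((\<lambda>t. (t - c) / \<delta>) has_real_derivative 1 / \<delta>) (at t)"
      using assms by (auto intro!: derivative_eq_intros)
    from DERIV_diff[OF DERIV_const DERIV_power[OF this, of 2], of 1] show ?thesis by simp
  qed
  from DERIV_chain2[OF positive_part_square_has_derivative this]
  have "((\<lambda>t. (max 0 (1 - ((t - c) / \<delta>)\<^sup>2))\<^sup>2) has_real_derivative
      2 * max 0 (1 - ((t - c) / \<delta>)\<^sup>2) * - (2 * ((t - c) / \<delta>) / \<delta>)) (at t)" .
  moreover have "2 * max 0 (1 - ((t - c) / \<delta>)\<^sup>2) * - (2 * ((t - c) / \<delta>) / \<delta>) = bump_deriv c \<delta> t"
  proof -
    have "2 * m * - (2 * u / \<delta>) = - 4 * u * m / \<delta>" for m u :: real by simp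
    then show ?thesis unfolding bump_deriv_def .
  qed
  moreover have "bump c \<delta> = (\<lambda>t. (max 0 (1 - ((t - c) / \<delta>)\<^sup>2))\<^sup>2)" by (simp add: fun_eq_iff bump_def)
  ultimately show ?thesis by simp
qed

lemma bump_continuous: "\<delta> > 0 \<Longrightarrow> continuous_on S (bump c \<delta>)"
  by (rule DERIV_continuous_on[OF has_field_derivative_at_within[OF bump_has_derivative]])

lemma bump_deriv_continuous: "\<delta> > 0 \<Longrightarrow> continuous_on S (bump_deriv c \<delta>)"
  unfolding bump_deriv_def by (intro continuous_intros) auto

lemma bump_outside:
  assumes "\<delta> > 0" "\<delta> \<le> \<bar>t - c\<bar>"
  shows "bump c \<delta> t = 0" "bump_deriv c \<delta> t = 0"
proof -
  have "1 \<le> \<bar>(t - c) / \<delta>\<bar>" using assms by simp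
  then have "1 \<le> ((t - c) / \<delta>)\<^sup>2" unfolding power2_abs[of "(t - c) / \<delta>", symmetric] by (rule one_le_power)
  then show "bump c \<delta> t = 0" "bump_deriv c \<delta> t = 0" by (simp_all add: bump_def bump_deriv_def)
qed

lemma bump_bounds: "0 \<le> bump c \<delta> t" "bump c \<delta> t \<le> 1" "bump c \<delta> c = 1"
proof -
  have "0 \<le> max 0 (1 - ((t - c) / \<delta>)\<^sup>2)" "max 0 (1 - ((t - c) / \<delta>)\<^sup>2) \<le> 1" by auto
  then show "0 \<le> bump c \<delta> t" "bump c \<delta> t \<le> 1" unfolding bump_def by (auto simp: power_le_one)
  show "bump c \<delta> c = 1" by (simp add: bump_def)
qed

lemma bump_deriv_bound:
  assumes "\<delta> > 0"
  shows "\<bar>bump_deriv c \<delta> t\<bar> \<le> 4 / \<delta>"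
proof (cases "\<delta> \<le> \<bar>t - c\<bar>")
  case True
  then show ?thesis using bump_outside(2)[OF assms True] assms by simp
next
  case False
  define s where "s = (t - c) / \<delta>"
  define m where "m = max 0 (1 - s\<^sup>2)"
  have "\<bar>s\<bar> \<le> 1" using False assms by (simp add: s_def)
  moreover have m: "0 \<le> m" "m \<le> 1" by (auto simp: m_def)
  ultimately have "\<bar>s\<bar> * m \<le> 1 * 1" by (intro mult_mono) auto
  then have "4 * (\<bar>s\<bar> * m) / \<delta> \<le> 4 / \<delta>" using assms by (intro divide_right_mono) auto
  moreover have "bump_deriv c \<delta> t = - 4 * s * m / \<delta>" by (simp add: bump_deriv_def s_def m_def)
  ultimately show ?thesis using assms m by (simp add: abs_mult)
qed

lemma bump_half:
  assumes "\<delta> > 0" "\<bar>t - c\<bar> \<le> \<delta> / 2"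
  shows "1 / 2 \<le> bump c \<delta> t"
proof -
  have "\<bar>(t - c) / \<delta>\<bar> \<le> 1 / 2" using assms by (simp add: field_simps)
  then have "\<bar>(t - c) / \<delta>\<bar>\<^sup>2 \<le> (1 / 2)\<^sup>2" by (intro power_mono) auto
  then have "3 / 4 \<le> 1 - ((t - c) / \<delta>)\<^sup>2" by (simp add: power2_eq_square)
  then have "3 / 4 \<le> max 0 (1 - ((t - c) / \<delta>)\<^sup>2)" by (rule order_trans) simp
  then have "(3 / 4)\<^sup>2 \<le> (max 0 (1 - ((t - c) / \<delta>)\<^sup>2))\<^sup>2" by (rule power_mono) simp
  then have "(3 / 4)\<^sup>2 \<le> bump c \<delta> t" unfolding bump_def .
  moreover have "(1 / 2 :: real) \<le> (3 / 4)\<^sup>2" by (simp add: power2_eq_square)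
  ultimately show ?thesis by linarith
qed

lemma bump_integrable: "\<delta> > 0 \<Longrightarrow> bump c \<delta> integrable_on {a..b}"
  by (intro integrable_continuous_real bump_continuous)

lemma bump_integral_support:
  assumes "\<delta> > 0" "a \<le> c - \<delta>" "c + \<delta> \<le> b"
  shows "integral {a..b} (bump c \<delta>) = integral {c - \<delta>..c + \<delta>} (bump c \<delta>)"
proof (rule integral_spike_set)
  show "negligible {t \<in> {a..b} - {c - \<delta>..c + \<delta>}. bump c \<delta> t \<noteq> 0}"
  proof (rule negligible_subset[of "{}"])
    have "bump c \<delta> t = 0" if "t \<notin> {c - \<delta>..c + \<delta>}" for t
      using that by (intro bump_outside(1)[OF assms(1)]) (auto simp: abs_if)
    then show "{t \<in> {a..b} - {c - \<delta>..c + \<delta>}. bump c \<delta> t \<noteq> 0} \<subseteq> {}" by blast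
  qed simp
  show "negligible {t \<in> {c - \<delta>..c + \<delta>} - {a..b}. bump c \<delta> t \<noteq> 0}"
    by (rule negligible_subset[of "{}"]) (use assms in auto)
qed

text \<open>The bump is at least \<open>1 / 2\<close> on the middle half of its support, of length
  \<open>\<delta>\<close>, and at most 1 on the whole support, of length
  \<open>2 * \<delta>\<close>.\<close>

lemma bump_integral_bounds:
  assumes \<delta>: "\<delta> > 0" and "a \<le> c - \<delta>" "c + \<delta> \<le> b"
  shows "\<delta> / 2 \<le> integral {a..b} (bump c \<delta>)" "integral {a..b} (bump c \<delta>) \<le> 2 * \<delta>"
proof -
  have "integral {c - \<delta>/2..c + \<delta>/2} (\<lambda>t. 1/2) \<le> integral {c - \<delta>/2..c + \<delta>/2} (bump c \<delta>)"
  proof (intro integral_le bump_integrable \<delta>)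
    fix t assume "t \<in> {c - \<delta>/2..c + \<delta>/2}"
    then have "\<bar>t - c\<bar> \<le> \<delta> / 2" unfolding atLeastAtMost_iff abs_le_iff by linarith
    then show "1/2 \<le> bump c \<delta> t" by (rule bump_half[OF \<delta>])
  qed auto
  also have "\<dots> \<le> integral {a..b} (bump c \<delta>)"
    using assms by (intro integral_subset_le bump_integrable \<delta>) (auto simp: bump_bounds)
  finally show "\<delta> / 2 \<le> integral {a..b} (bump c \<delta>)" using \<delta> by simp
  have "integral {c - \<delta>..c + \<delta>} (bump c \<delta>) \<le> integral {c - \<delta>..c + \<delta>} (\<lambda>t. 1)"
    by (intro integral_le bump_integrable \<delta> bump_bounds) auto
  then show "integral {a..b} (bump c \<delta>) \<le> 2 * \<delta>"
    unfolding bump_integral_support[OF assms] using \<delta> by simp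
qed

section \<open>Integrals of bumps against the measure\<close>

context interaction_sequence begin

lemma finite_below: "finite {n. x n \<le> r}"
proof -
  obtain N where N: "r < x N" using x_unbounded by blast
  have "n \<le> N" if "x n \<le> r" for n
  proof -
    have "x n < x N" using that N by simp
    then show ?thesis using strict_mono_less[OF x_mono, of n N] by simp
  qed
  then have "{n. x n \<le> r} \<subseteq> {..N}" by blast
  then show ?thesis by (rule finite_subset) simp
qed

lemma gap_pos: "n \<ge> 1 \<Longrightarrow> gap x n > 0"
  using strict_monoD[OF x_mono, of "n - 1" n] by (simp add: gap_def)

text \<open>The threshold is on the position \<open>x n\<close> rather than on the index, because
  bumps are placed by position.\<close>

lemma gap_small_eventually:
  assumes "gap x \<longlonglongrightarrow> 0" "\<eta> > 0"
  obtains A where "A > 0" "\<And>n. x n \<ge> A \<Longrightarrow> n \<ge> 1 \<and> gap x n \<le> \<eta> \<and> gap x (Suc n) \<le> \<eta>"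
proof -
  have "\<forall>\<^sub>F n in sequentially. gap x n < \<eta>" using order_tendstoD(2)[OF assms] .
  then obtain N where N: "\<And>n. n \<ge> N \<Longrightarrow> gap x n < \<eta>" by (auto simp: eventually_sequentially)
  have "n \<ge> Suc N" if "x n \<ge> x (Suc N)" for n using that strict_mono_less_eq[OF x_mono] by simp
  then have "n \<ge> 1 \<and> gap x n \<le> \<eta> \<and> gap x (Suc n) \<le> \<eta>" if "x n \<ge> x (Suc N)" for n
    using that N[of n] N[of "Suc n"] by fastforce
  then show thesis using that[of "x (Suc N)"] x_pos[of "Suc N"] by simp
qed

text \<open>The gaps are non-overlapping intervals ending in \<open>[l, r]\<close>; the leftmost may
  begin before \<open>l\<close>, which costs at most \<open>\<eta>\<close>.\<close>

lemma gap_sum_le: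
  assumes T: "finite T" and "\<eta> \<ge> 0"
    and mem: "\<And>n. n \<in> T \<Longrightarrow> n \<ge> 1 \<and> l \<le> x n \<and> x n \<le> r \<and> gap x n \<le> \<eta>" and "l \<le> r"
  shows "(\<Sum>n\<in>T. gap x n) \<le> r - l + \<eta>"
proof (cases "T = {}")
  case True
  then show ?thesis using assms by simp
next
  case False
  have telescope: "(\<Sum>n=Suc k..m. gap x n) = x m - x k" if "k \<le> m" for k m
    using that by (induction m rule: dec_induct) (auto simp: gap_def)
  define k where "k = Min T - 1"
  have MinT: "Min T \<in> T" and MaxT: "Max T \<in> T" using T False by auto
  have k: "Min T = Suc k" using mem[OF MinT] by (simp add: k_def)
  have kM: "Suc k \<le> Max T" unfolding k[symmetric] using T MaxT by simp
  have "T \<subseteq> {Suc k..Max T}" using T False by (auto simp: k[symmetric])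
  then have "(\<Sum>n\<in>T. gap x n) \<le> (\<Sum>n=Suc k..Max T. gap x n)"
    using gap_pos by (intro sum_mono2) (auto simp: less_imp_le)
  also have "\<dots> = x (Max T) - x k" using kM by (intro telescope) simp
  also have "\<dots> = x (Max T) - x (Suc k) + gap x (Suc k)" by (simp add: gap_def)
  also have "\<dots> \<le> r - l + \<eta>" using mem[OF MaxT] mem[OF MinT] unfolding k by linarith
  finally show ?thesis .
qed

text \<open>The integral of \<open>w\<close> against \<open>dM = dx + \<Sum> \<beta>\<^sub>n \<delta>(x - x\<^sub>n)\<close>, where \<open>K\<close> lists the points that matter.
  A function in the domain satisfies \<open>df = f' dM\<close>.\<close>

definition mass :: "(nat \<Rightarrow> real) \<Rightarrow> nat set \<Rightarrow> real \<Rightarrow> (real \<Rightarrow> real) \<Rightarrow> real" where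
  "mass \<beta> K R w = integral {0..R} w + (\<Sum>n\<in>K. \<beta> n * w (x n))"

text \<open>The Lebesgue part contributes at least \<open>1/8\<close>. Each point mass is at least
  \<open>- C * \<eta>\<^sup>2 * gap x n\<close>, and the gaps concerned add up to at most 1, so the
  point masses together cost at most \<open>1/16\<close>.\<close>

lemma mass_bump_positive:
  assumes K: "finite K" "K \<subseteq> {1..}" and a: "0 \<le> a" "a + 1 \<le> R" and C: "C > 0"
    and \<eta>: "0 < \<eta>" "\<eta> \<le> 1/4" "C * \<eta>\<^sup>2 \<le> 1/16"
    and gap: "\<And>n. x n \<ge> a \<Longrightarrow> gap x n \<le> \<eta>"
    and \<beta>: "\<And>n. n \<ge> 1 \<Longrightarrow> a + 1/4 \<le> x n \<Longrightarrow> x n \<le> a + 3/4 \<Longrightarrow> \<beta> n \<ge> - C * gap x n ^ 3"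
  shows "mass \<beta> K R (bump (a + 1/2) (1/4)) \<ge> 1/16"
proof -
  let ?b = "bump (a + 1/2) (1/4)"
  define T where "T = {n \<in> K. a + 1/4 \<le> x n \<and> x n \<le> a + 3/4}"
  have T: "finite T" "T \<subseteq> K" using K(1) by (auto simp: T_def)
  have n1: "n \<ge> 1" if "n \<in> K" for n using that K(2) by auto
  have "1/8 \<le> integral {0..R} ?b"
    using bump_integral_bounds(1)[of "1/4" 0 "a + 1/2" R] a by simp
  moreover have "(\<Sum>n\<in>K. \<beta> n * ?b (x n)) = (\<Sum>n\<in>T. \<beta> n * ?b (x n))"
  proof (rule sum.mono_neutral_right[OF K(1) T(2)])
    show "\<forall>n\<in>K - T. \<beta> n * ?b (x n) = 0"
    proof
      fix n assume "n \<in> K - T"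
      then have "1/4 \<le> \<bar>x n - (a + 1/2)\<bar>" by (auto simp: T_def abs_if)
      then show "\<beta> n * ?b (x n) = 0" using bump_outside(1)[of "1/4" "x n" "a + 1/2"] by simp
    qed
  qed
  moreover have "(\<Sum>n\<in>T. \<beta> n * ?b (x n)) \<ge> (\<Sum>n\<in>T. - (C * \<eta>\<^sup>2) * gap x n)"
  proof (rule sum_mono)
    fix n assume n: "n \<in> T"
    have g: "0 < gap x n" "gap x n \<le> \<eta>" using n T(2) n1 gap_pos gap[of n] by (auto simp: T_def)
    have "gap x n ^ 3 = (gap x n)\<^sup>2 * gap x n" by (simp add: power2_eq_square power3_eq_cube)
    also have "\<dots> \<le> \<eta>\<^sup>2 * gap x n" using g by (intro mult_right_mono power_mono) auto
    finally have cube: "C * gap x n ^ 3 \<le> C * \<eta>\<^sup>2 * gap x n" using C by (simp add: mult.assoc)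
    have "\<beta> n \<ge> - C * gap x n ^ 3" using n T(2) n1 by (intro \<beta>) (auto simp: T_def)
    then have "\<beta> n * ?b (x n) \<ge> (- C * gap x n ^ 3) * ?b (x n)" using bump_bounds(1) by (rule mult_right_mono)
    moreover have "(C * gap x n ^ 3) * ?b (x n) \<le> (C * gap x n ^ 3) * 1"
      using C g bump_bounds(2) by (intro mult_left_mono) auto
    ultimately show "- (C * \<eta>\<^sup>2) * gap x n \<le> \<beta> n * ?b (x n)" using cube by simp
  qed
  moreover have "(\<Sum>n\<in>T. - (C * \<eta>\<^sup>2) * gap x n) \<ge> - (1/16)"
  proof -
    have "(\<Sum>n\<in>T. gap x n) \<le> (a + 3/4) - (a + 1/4) + \<eta>"
      using T n1 gap \<eta> by (intro gap_sum_le) (auto simp: T_def)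
    then have "(\<Sum>n\<in>T. gap x n) \<le> 1" using \<eta> by simp
    then have "(C * \<eta>\<^sup>2) * (\<Sum>n\<in>T. gap x n) \<le> (C * \<eta>\<^sup>2) * 1" using C by (intro mult_left_mono) auto
    then show ?thesis using \<eta>(3) by (simp add: sum_distrib_left[symmetric] sum_negf)
  qed
  ultimately show ?thesis by (simp add: mass_def)
qed

text \<open>With the smaller adjacent gap as half-width, the bump is 1 at \<open>x n\<close> and 0
  at all other points, so its mass is at most \<open>2 * \<delta> + \<beta> n\<close>. As
  \<open>1 / \<delta>\<close> is one of the two reciprocals,
  \<open>\<beta> n \<le> - (C / \<delta>)\<close>, and \<open>\<delta>\<^sup>2 \<le> C / 4\<close>
  lets half of this absorb \<open>2 * \<delta>\<close>.\<close>

lemma mass_bump_negative: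
  assumes K: "finite K" "K \<subseteq> {1..}" "n \<in> K" and C: "C > 0"
    and \<delta>_def: "\<delta> = min (gap x n) (gap x (Suc n))" and \<delta>: "\<delta>\<^sup>2 \<le> C / 4"
    and R: "0 \<le> x n - \<delta>" "x n + \<delta> \<le> R"
    and \<beta>: "\<beta> n \<le> - C * (1 / gap x n + 1 / gap x (Suc n))"
  shows "mass \<beta> K R (bump (x n) \<delta>) \<le> - (C / (2 * \<delta>))"
proof -
  let ?b = "bump (x n) \<delta>"
  have n: "n \<ge> 1" using K by auto
  have g: "gap x n > 0" "gap x (Suc n) > 0" using gap_pos n by auto
  then have \<delta>0: "\<delta> > 0" by (simp add: \<delta>_def)
  have "(\<Sum>m\<in>K. \<beta> m * ?b (x m)) = (\<Sum>m\<in>K. if m = n then \<beta> n else 0)"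
  proof (rule sum.cong[OF refl])
    fix m
    consider "m = n" | "m < n" | "m > n" by linarith
    then show "\<beta> m * ?b (x m) = (if m = n then \<beta> n else 0)"
    proof cases
      case 1
      then show ?thesis by (simp add: bump_bounds)
    next
      case 2
      then have "x m \<le> x (n - 1)" using strict_mono_less_eq[OF x_mono] by simp
      then have "\<delta> \<le> \<bar>x m - x n\<bar>" using g by (simp add: \<delta>_def gap_def)
      then show ?thesis using bump_outside(1)[OF \<delta>0] 2 by simp
    next
      case 3
      then have "x (Suc n) \<le> x m" using strict_mono_less_eq[OF x_mono] by simp
      then have "\<delta> \<le> \<bar>x m - x n\<bar>" using g by (simp add: \<delta>_def gap_def)
      then show ?thesis using bump_outside(1)[OF \<delta>0] 3 by simp
    qed
  qed
  also have "\<dots> = \<beta> n" using K by simp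
  finally have "mass \<beta> K R ?b = integral {0..R} ?b + \<beta> n" by (simp add: mass_def)
  moreover have "integral {0..R} ?b \<le> 2 * \<delta>" by (rule bump_integral_bounds(2)[OF \<delta>0 R])
  moreover have "\<beta> n \<le> - (C / \<delta>)"
  proof -
    have "1 / \<delta> \<le> 1 / gap x n + 1 / gap x (Suc n)" using g by (auto simp: \<delta>_def min_def)
    then have "C * (1 / \<delta>) \<le> C * (1 / gap x n + 1 / gap x (Suc n))" using C by (intro mult_left_mono) auto
    then show ?thesis using \<beta> by simp
  qed
  moreover have "2 * \<delta> \<le> C / (2 * \<delta>)" using \<delta> \<delta>0 by (simp add: field_simps power2_eq_square)
  moreover have "C / \<delta> = C / (2 * \<delta>) + C / (2 * \<delta>)" using \<delta>0 by (simp add: field_simps)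
  ultimately show ?thesis by linarith
qed

text \<open>\<open>K\<close> and \<open>R\<close> stay free, since each bump is later paired with a
  second one on a longer interval. The choice between the wide and the narrow bump looks only at
  points in the middle half, so that a narrow bump centred there stays inside.\<close>

lemma normalizable_bumps:
  assumes gap0: "gap x \<longlonglongrightarrow> 0" and C: "C > 0"
    and \<beta>: "(\<forall>n\<ge>1. \<beta> n \<ge> - C * gap x n ^ 3) \<or>
      (\<forall>n\<ge>1. \<beta> n < 0 \<longrightarrow> \<beta> n \<le> - C * (1 / gap x n + 1 / gap x (Suc n)))"
  obtains A M where "A > 0" "M > 0"
    "\<forall>a\<ge>A. \<exists>c \<delta>. 0 < \<delta> \<and> a \<le> c - \<delta> \<and> c + \<delta> \<le> a + 1 \<and>
      (\<forall>K R. finite K \<longrightarrow> K \<subseteq> {1..} \<longrightarrow> {n. 1 \<le> n \<and> x n \<le> a + 1} \<subseteq> K \<longrightarrow> a + 1 \<le> R \<longrightarrow>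
         4 / \<delta> \<le> M * \<bar>mass \<beta> K R (bump c \<delta>)\<bar>)"
proof -
  \<comment> \<open>\<open>1/4\<close> keeps a bump centred in \<open>[a + 1/4, a + 3/4]\<close>
    inside \<open>[a, a + 1]\<close>; the square roots provide
    \<open>\<eta>\<^sup>2 \<le> C / 4\<close> and \<open>C * \<eta>\<^sup>2 \<le> 1/16\<close>, as
    the two mass estimates require.\<close>
  define \<eta> where "\<eta> = min (1/4) (min (sqrt (C / 4)) (sqrt (1 / (16 * C))))"
  have \<eta>: "0 < \<eta>" "\<eta> \<le> 1/4" "\<eta> \<le> sqrt (C / 4)" "\<eta> \<le> sqrt (1 / (16 * C))" using C by (auto simp: \<eta>_def)
  have \<eta>2: "\<eta>\<^sup>2 \<le> C / 4"
    using power_mono[OF \<eta>(3), of 2] \<eta>(1) C by (simp add: real_sqrt_pow2)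
  have "\<eta>\<^sup>2 \<le> 1 / (16 * C)"
    using power_mono[OF \<eta>(4), of 2] \<eta>(1) C by (simp add: real_sqrt_pow2)
  then have \<eta>3: "C * \<eta>\<^sup>2 \<le> 1/16" using C by (simp add: field_simps)
  obtain A where A: "A > 0" and gap: "\<And>n. x n \<ge> A \<Longrightarrow> n \<ge> 1 \<and> gap x n \<le> \<eta> \<and> gap x (Suc n) \<le> \<eta>"
    using gap_small_eventually[OF gap0 \<eta>(1)] by metis
  \<comment> \<open>Slope over mass: \<open>(4 / (1/4)) / (1/16) = 256\<close> for the wide bump,
    \<open>(4 / \<delta>) / (C / (2 * \<delta>)) = 8 / C\<close> for the narrow one.\<close>
  define M where "M = max 256 (8 / C)"
  have "\<exists>c \<delta>. 0 < \<delta> \<and> a \<le> c - \<delta> \<and> c + \<delta> \<le> a + 1 \<and>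
      (\<forall>K R. finite K \<longrightarrow> K \<subseteq> {1..} \<longrightarrow> {n. 1 \<le> n \<and> x n \<le> a + 1} \<subseteq> K \<longrightarrow> a + 1 \<le> R \<longrightarrow>
         4 / \<delta> \<le> M * \<bar>mass \<beta> K R (bump c \<delta>)\<bar>)" if a: "a \<ge> A" for a
  proof (cases "\<forall>n\<ge>1. a + 1/4 \<le> x n \<longrightarrow> x n \<le> a + 3/4 \<longrightarrow> \<beta> n \<ge> - C * gap x n ^ 3")
    case True
    have "4 / (1/4) \<le> M * \<bar>mass \<beta> K R (bump (a + 1/2) (1/4))\<bar>"
      if "finite K" "K \<subseteq> {1..}" "a + 1 \<le> R" for K R
    proof -
      have "1/16 \<le> mass \<beta> K R (bump (a + 1/2) (1/4))"
        by (rule mass_bump_positive[OF that(1,2) _ that(3) C \<eta>(1,2) \<eta>3]) (use True gap a A in auto)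
      then have "256 * (1/16) \<le> M * \<bar>mass \<beta> K R (bump (a + 1/2) (1/4))\<bar>"
        by (intro mult_mono) (auto simp: M_def)
      then show ?thesis by simp
    qed
    then show ?thesis by (intro exI[of _ "a + 1/2"] exI[of _ "1/4"]) auto
  next
    case False
    then obtain n where n: "n \<ge> 1" "a + 1/4 \<le> x n" "x n \<le> a + 3/4" "\<not> \<beta> n \<ge> - C * gap x n ^ 3" by blast
    \<comment> \<open>Failure of the cubic bound makes \<open>\<beta> n\<close> negative and refutes
      the first alternative, so the second one applies to \<open>n\<close>.\<close>
    have "\<beta> n < - C * gap x n ^ 3" using n(4) by simp
    also have "\<dots> \<le> 0" using C gap_pos[OF n(1)] by simp
    finally have \<beta>n: "\<beta> n \<le> - C * (1 / gap x n + 1 / gap x (Suc n))" using \<beta> n by blast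
    define \<delta> where "\<delta> = min (gap x n) (gap x (Suc n))"
    have \<delta>: "0 < \<delta>" "\<delta> \<le> \<eta>" using gap_pos[of n] gap_pos[of "Suc n"] gap[of n] n a by (auto simp: \<delta>_def)
    have \<delta>2: "\<delta>\<^sup>2 \<le> C / 4" using power_mono[OF \<delta>(2), of 2] \<delta>(1) \<eta>2 by simp
    have "4 / \<delta> \<le> M * \<bar>mass \<beta> K R (bump (x n) \<delta>)\<bar>"
      if K: "finite K" "K \<subseteq> {1..}" "{n. 1 \<le> n \<and> x n \<le> a + 1} \<subseteq> K" "a + 1 \<le> R" for K R
    proof -
      have "n \<in> K" using K(3) n by auto
      have "mass \<beta> K R (bump (x n) \<delta>) \<le> - (C / (2 * \<delta>))"
        by (rule mass_bump_negative[where \<beta> = \<beta>, OF K(1,2) \<open>n \<in> K\<close> C \<delta>_def \<delta>2 _ _ \<beta>n])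
          (use n a A \<delta> \<eta> K(4) in linarith)+
      moreover have "0 < C / (2 * \<delta>)" using C \<delta> by simp
      ultimately have "C / (2 * \<delta>) \<le> \<bar>mass \<beta> K R (bump (x n) \<delta>)\<bar>" by linarith
      then have "(8 / C) * (C / (2 * \<delta>)) \<le> M * \<bar>mass \<beta> K R (bump (x n) \<delta>)\<bar>"
        using C \<delta> by (intro mult_mono) (auto simp: M_def)
      then show ?thesis using C by simp
    qed
    then show ?thesis using n \<delta> \<eta> by (intro exI[of _ "x n"] exI[of _ \<delta>]) auto
  qed
  moreover have "M > 0" by (simp add: M_def)
  ultimately show thesis using that[of A M] A by blast
qed

end

section \<open>Criteria for regularity and square integrability\<close>

lemma ac_on_lipschitz:
  fixes f :: "real \<Rightarrow> 'a::real_normed_vector"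
  assumes "M \<ge> 0" and lip: "\<And>s t. s \<in> {a..b} \<Longrightarrow> t \<in> {a..b} \<Longrightarrow> norm (f s - f t) \<le> M * \<bar>s - t\<bar>"
  shows "ac_on a b f"
proof -
  have id: "ac_on a b (\<lambda>t::real. t)"
    unfolding ac_on_def
  proof (intro allI impI)
    fix \<epsilon> :: real assume "\<epsilon> > 0"
    have "(\<Sum>K\<in>D. norm (Sup K - Inf K)) = (\<Sum>K\<in>D. measure lborel K)"
      if D: "D division_of \<Union>D" for D :: "real set set"
    proof (rule sum.cong[OF refl])
      fix K assume K: "K \<in> D"
      obtain u v where "u \<le> v" "K = {u..v}" by (rule division_real_intervalE[OF D K])
      then show "norm (Sup K - Inf K) = measure lborel K" by simp
    qed
    then show "\<exists>\<delta>>0. \<forall>D. D division_of \<Union>D \<and> \<Union>D \<subseteq> {a..b} \<and> (\<Sum>K\<in>D. measure lborel K) < \<delta> \<longrightarrow>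
        (\<Sum>K\<in>D. norm (Sup K - Inf K)) < \<epsilon>" using \<open>\<epsilon> > 0\<close> by (intro exI[of _ \<epsilon>]) auto
  qed
  show ?thesis
  proof (rule ac_on_dominated[OF id id])
    show "M + 1 > 0" using \<open>M \<ge> 0\<close> by simp
    fix s t assume "s \<in> {a..b}" "t \<in> {a..b}"
    then have "norm (f s - f t) \<le> M * \<bar>s - t\<bar>" by (rule lip)
    also have "\<dots> \<le> (M + 1) * (\<bar>s - t\<bar> + \<bar>s - t\<bar>)" using \<open>M \<ge> 0\<close> by (intro mult_mono) auto
    finally show "norm (f s - f t) \<le> (M + 1) * (norm (s - t) + norm (s - t))" by simp
  qed
qed

lemma half_line_integrable_indicator:
  "integrable half_line_measure (indicat_real {a..b})"
proof -
  have "{a..b} \<in> lmeasurable" by simp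
  then have "integrable lebesgue (indicat_real {a..b})" by (simp add: lmeasurable_iff_integrable)
  then have "integrable lebesgue (\<lambda>t. indicat_real {0..} t *\<^sub>R indicat_real {a..b} t)"
    by (rule integrable_mult_indicator[rotated]) simp
  then show ?thesis by (simp add: integrable_restrict_space)
qed

context interaction_sequence begin

lemma AC_loc_bounded_derivative:
  assumes d: "\<And>t. t \<in> punctured x \<Longrightarrow> (f has_vector_derivative h t) (at t within punctured x)"
    and M: "\<And>t. t \<in> punctured x \<Longrightarrow> norm (h t) \<le> M" and "M \<ge> 0"
  shows "AC_loc (punctured x) f"
  unfolding AC_loc_def abs_continuous_on_iff
proof (intro allI impI, elim conjE)
  fix a b :: real assume ab: "a \<le> b" "{a..b} \<subseteq> punctured x"
  show "ac_on a b f"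
  proof (rule ac_on_lipschitz[OF \<open>M \<ge> 0\<close>])
    fix s t assume st: "s \<in> {a..b}" "t \<in> {a..b}"
    have "norm (f s - f t) \<le> M * norm (s - t)"
    proof (rule differentiable_bound[OF convex_real_interval(5)])
      fix u assume "u \<in> {a..b}"
      then have u: "u \<in> punctured x" using ab by blast
      show "(f has_derivative (\<lambda>y. y *\<^sub>R h u)) (at u within {a..b})"
        using has_vector_derivative_within_subset[OF d[OF u] ab(2)] by (simp add: has_vector_derivative_def)
      show "onorm (\<lambda>y. y *\<^sub>R h u) \<le> M"
      proof (rule onorm_bound[OF \<open>M \<ge> 0\<close>])
        show "norm (y *\<^sub>R h u) \<le> M * norm y" for y
          using mult_left_mono[OF M[OF u], of "\<bar>y\<bar>"] by (simp add: mult.commute)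
      qed
    qed (use st in auto)
    then show "norm (f s - f t) \<le> M * \<bar>s - t\<bar>" by simp
  qed
qed

lemma pderivative_eqI:
  assumes t: "t \<in> punctured x" and d: "(f has_vector_derivative D) (at t within punctured x)"
  shows "pderivative x f t = D"
proof -
  obtain c e where ce: "c \<le> t" "t < e" "{c..e} \<subseteq> punctured x" "0 < t \<longrightarrow> c < t"
    "at t within punctured x = at t within {c..e}" by (rule punctured_local_interval[OF t])
  have "vector_derivative f (at t within cbox c e) = D"
    using ce d by (intro vector_derivative_within_cbox) auto
  then show ?thesis using ce(5) by (simp add: pderivative_def)
qed

lemma AE_punctured: "AE t in half_line_measure. t \<in> punctured x"
proof -
  have "interaction_points x \<in> null_sets lebesgue"
    using negligible_interaction_points by (simp add: negligible_iff_null_sets)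
  then have "AE t in lebesgue. t \<notin> interaction_points x" by (rule AE_not_in)
  then show ?thesis by (subst AE_restrict_space_iff) (auto simp: punctured_def)
qed

lemma countable_interaction_points: "countable (interaction_points x)"
  by (simp add: interaction_points_def)

text \<open>Agreement is asked for on the punctured half-line because \<open>pderivative\<close> is
  unspecified at the interaction points; these are countably many, so neither measurability nor the
  integral is affected.\<close>

lemma L2_bounded_support:
  assumes g: "g \<in> borel_measurable borel" and hg: "\<And>t. t \<in> punctured x \<Longrightarrow> h t = g t"
    and B: "\<And>t. t \<in> punctured x \<Longrightarrow> cmod (g t) \<le> B" and r: "\<And>t. t \<in> punctured x \<Longrightarrow> r < t \<Longrightarrow> g t = 0"
  shows "h \<in> L2_half_line"
proof -
  have "g \<in> borel_measurable lebesgue" using measurable_completion[of g lborel borel] g by simp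
  then have g': "g \<in> borel_measurable half_line_measure" by (rule measurable_restrict_space1)
  have h: "h \<in> borel_measurable half_line_measure"
  proof (rule measurable_discrete_difference[OF g' countable_interaction_points])
    fix y assume "y \<in> interaction_points x"
    then have "y \<ge> 0" using x_nonneg by (auto simp: interaction_points_def)
    then show "{y} \<in> sets half_line_measure" by (simp add: sets_restrict_space_iff)
  next
    fix y assume "y \<in> space half_line_measure" "y \<notin> interaction_points x"
    then show "g y = h y" using hg[of y] by (simp add: punctured_def space_restrict_space)
  qed auto
  have "integrable half_line_measure (\<lambda>t. (cmod (h t))\<^sup>2)"
  proof (rule Bochner_Integration.integrable_bound)
    show "integrable half_line_measure (\<lambda>t. B\<^sup>2 * indicat_real {0..r} t)"
      using half_line_integrable_indicator by simp
    show "AE t in half_line_measure. norm ((cmod (h t))\<^sup>2) \<le> norm (B\<^sup>2 * indicat_real {0..r} t)"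
      using AE_punctured
    proof eventually_elim
      case (elim t)
      show ?case
      proof (cases "r < t")
        case True
        then show ?thesis using hg[OF elim] r[OF elim] by simp
      next
        case False
        then have "t \<in> {0..r}" using elim by (simp add: punctured_def)
        then show ?thesis using hg[OF elim] power_mono[OF B[OF elim], of 2] by simp
      qed
    qed
  qed (use h in measurable)
  then show ?thesis using h by (simp add: L2_half_line_def)
qed

section \<open>Domain functions built from their derivative\<close>

text \<open>The primitive of \<open>w\<close> against the measure, started at 0. The strict
  inequality leaves the mass at \<open>x n\<close> out of the value at \<open>x n\<close>, which
  makes the primitive left-continuous.\<close>

definition step :: "(nat \<Rightarrow> real) \<Rightarrow> nat set \<Rightarrow> (real \<Rightarrow> real) \<Rightarrow> real \<Rightarrow> real" where
  "step \<beta> K w t = integral {0..t} w + (\<Sum>n\<in>K. if x n < t then \<beta> n * w (x n) else 0)"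

lemma step_before:
  assumes "\<And>s. s \<le> l \<Longrightarrow> w s = 0" "t \<le> l"
  shows "step \<beta> K w t = 0"
proof -
  have "integral {0..t} w = integral {0..t} (\<lambda>s. 0)" using assms by (intro integral_cong) auto
  moreover have "(\<Sum>n\<in>K. if x n < t then \<beta> n * w (x n) else 0) = 0"
    using assms by (intro sum.neutral) auto
  ultimately show ?thesis by (simp add: step_def)
qed

lemma step_after:
  assumes w: "continuous_on UNIV w" "\<And>s. r \<le> s \<Longrightarrow> w s = 0" and "0 \<le> r" "r \<le> t" "r \<le> R"
  shows "step \<beta> K w t = mass \<beta> K R w"
proof -
  have tail: "integral {0..u} w = integral {0..r} w" if "r \<le> u" for u
  proof -
    have int: "w integrable_on {0..u}" by (intro integrable_continuous_real continuous_on_subset[OF w(1)]) auto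
    have "integral {r..u} w = integral {r..u} (\<lambda>s. 0)" using w(2) by (intro integral_cong) auto
    then show ?thesis
      using Henstock_Kurzweil_Integration.integral_combine[OF \<open>0 \<le> r\<close> that int] by simp
  qed
  have "(\<Sum>n\<in>K. if x n < t then \<beta> n * w (x n) else 0) = (\<Sum>n\<in>K. \<beta> n * w (x n))"
    using w(2) assms(4) by (intro sum.cong) auto
  then show ?thesis using tail[OF assms(4)] tail[OF assms(5)] by (simp add: step_def mass_def)
qed

end

text \<open>\<open>w\<close> is the prescribed \<open>f'\<close>. Total mass zero makes its
  primitive return to 0 after the support, and \<open>M\<close> is the bound for the second
  derivative.\<close>

locale test_weight = interaction_sequence +
  fixes \<beta> :: "nat \<Rightarrow> real" and K :: "nat set" and w w' :: "real \<Rightarrow> real" and l r M :: real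
  assumes K: "finite K" "K \<subseteq> {1..}" "{n. 1 \<le> n \<and> x n \<le> r} \<subseteq> K"
    and w_deriv: "\<And>t. (w has_real_derivative w' t) (at t)" and w'_cont: "continuous_on UNIV w'"
    and w'_bound: "\<And>t. \<bar>w' t\<bar> \<le> M"
    and supp: "0 \<le> l" "l \<le> r" "\<And>t. t \<le> l \<or> r \<le> t \<Longrightarrow> w t = 0 \<and> w' t = 0"
    and balanced: "mass \<beta> K r w = 0"
begin

definition f :: "real \<Rightarrow> complex" where "f t = complex_of_real (step \<beta> K w t)"

lemma w_cont: "continuous_on S w"
  by (rule DERIV_continuous_on[OF has_field_derivative_at_within[OF w_deriv]])

lemma w_bounded: obtains B where "B \<ge> 0" "\<forall>t. \<bar>w t\<bar> \<le> B"
proof -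
  have "compact (w ` {l..r})" by (intro compact_continuous_image w_cont) simp
  then have "bounded (w ` {l..r})" by (rule compact_imp_bounded)
  then obtain B where B: "\<forall>y\<in>w ` {l..r}. norm y \<le> B" unfolding bounded_iff by blast
  have "\<bar>w t\<bar> \<le> \<bar>B\<bar>" for t
  proof (cases "t \<le> l \<or> r \<le> t")
    case True
    then show ?thesis using supp(3)[of t] by simp
  next
    case False
    then have "norm (w t) \<le> B" using B by auto
    then show ?thesis by simp
  qed
  then show thesis using that[of "\<bar>B\<bar>"] by simp
qed

lemma f_zero: "t \<le> l \<or> r \<le> t \<Longrightarrow> f t = 0"
  using step_before[of l w t \<beta> K] step_after[OF w_cont, of r t r \<beta> K] supp balanced
  by (auto simp: f_def)

lemma w_points: "n \<ge> 1 \<Longrightarrow> n \<notin> K \<Longrightarrow> w (x n) = 0"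
  using K(3) supp(3)[of "x n"] by force

lemma primitive_continuous: "continuous_on {0..b} (\<lambda>t. integral {0..t} w)"
  by (intro indefinite_integral_continuous_1 integrable_continuous_real w_cont)

text \<open>Near \<open>t\<close> there is no interaction point, so the jump sum is frozen at its
  value at \<open>t\<close> and only the integral is differentiated.\<close>

lemma f_has_derivative:
  assumes t: "t \<in> punctured x"
  shows "(f has_vector_derivative complex_of_real (w t)) (at t within punctured x)"
proof -
  obtain c d where cd: "c \<le> t" "t < d" "{c..d} \<subseteq> punctured x" "0 < t \<longrightarrow> c < t"
    "at t within punctured x = at t within {c..d}" by (rule punctured_local_interval[OF t])
  have "c \<in> punctured x" using cd by (intro subsetD[OF cd(3)]) simp
  then have c: "0 \<le> c" by (simp add: punctured_def)
  have "((\<lambda>s. integral {0..s} w) has_vector_derivative w t) (at t within {0..d})"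
    using cd c by (intro integral_has_vector_derivative w_cont) auto
  then have "((\<lambda>s. integral {0..s} w) has_vector_derivative w t) (at t within {c..d})"
    by (rule has_vector_derivative_within_subset) (use c in auto)
  then have "((\<lambda>s. integral {0..s} w + (\<Sum>n\<in>K. if x n < t then \<beta> n * w (x n) else 0))
      has_vector_derivative w t + 0) (at t within {c..d})"
    by (intro has_vector_derivative_add has_vector_derivative_const)
  then have "((\<lambda>s. integral {0..s} w + (\<Sum>n\<in>K. if x n < t then \<beta> n * w (x n) else 0))
      has_vector_derivative w t) (at t within {c..d})" by simp
  then have deriv: "((\<lambda>s. complex_of_real (integral {0..s} w + (\<Sum>n\<in>K. if x n < t then \<beta> n * w (x n) else 0)))
      has_vector_derivative complex_of_real (w t)) (at t within {c..d})"
    by (rule bounded_linear.has_vector_derivative[OF bounded_linear_of_real])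
  have eq: "f s = complex_of_real (integral {0..s} w + (\<Sum>n\<in>K. if x n < t then \<beta> n * w (x n) else 0))"
    if s: "s \<in> {c..d}" for s
  proof -
    have "x n < s \<longleftrightarrow> x n < t" if "n \<in> K" for n
    proof -
      have "x n \<in> interaction_points x" using K(2) that unfolding interaction_points_def by blast
      then have "x n \<notin> {c..d}" using cd(3) unfolding punctured_def by blast
      then show ?thesis using s cd by auto
    qed
    then have "(\<Sum>n\<in>K. if x n < s then \<beta> n * w (x n) else 0) = (\<Sum>n\<in>K. if x n < t then \<beta> n * w (x n) else 0)"
      by (intro sum.cong) auto
    then show ?thesis by (simp add: f_def step_def)
  qed
  have "t \<in> {c..d}" using cd by simp
  from has_vector_derivative_transform[OF this eq deriv] show ?thesis unfolding cd(5) .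
qed

lemma pderivative_f: "t \<in> punctured x \<Longrightarrow> pderivative x f t = complex_of_real (w t)"
  by (rule pderivative_eqI[OF _ f_has_derivative])

lemma pderivative_f_has_derivative:
  assumes t: "t \<in> punctured x"
  shows "(pderivative x f has_vector_derivative complex_of_real (w' t)) (at t within punctured x)"
proof -
  have "((\<lambda>t. complex_of_real (w t)) has_vector_derivative complex_of_real (w' t)) (at t)"
    using w_deriv[of t] unfolding has_real_derivative_iff_has_vector_derivative
    by (intro bounded_linear.has_vector_derivative[OF bounded_linear_of_real])
  from has_vector_derivative_transform[OF t pderivative_f has_vector_derivative_at_within[OF this]]
  show ?thesis .
qed

lemma pderivative2_f: "t \<in> punctured x \<Longrightarrow> pderivative x (pderivative x f) t = complex_of_real (w' t)"
  by (rule pderivative_eqI[OF _ pderivative_f_has_derivative])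

lemma f_L2: "f \<in> L2_half_line"
proof -
  \<comment> \<open>\<open>f\<close> vanishes beyond \<open>r\<close>, so the cut-off changes
    nothing on the half-line; Borel measurability then follows from continuity of the primitive on
    \<open>{0..r}\<close>.\<close>
  define g where "g t = complex_of_real (indicat_real {0..r} t *\<^sub>R integral {0..t} w
      + indicat_real {0..r} t * (\<Sum>n\<in>K. if x n < t then \<beta> n * w (x n) else 0))" for t
  have [measurable]: "(\<lambda>t. indicat_real {0..r} t *\<^sub>R integral {0..t} w) \<in> borel_measurable borel"
    by (rule borel_measurable_continuous_on_indicator[OF _ primitive_continuous]) simp
  have "compact ((\<lambda>t. integral {0..t} w) ` {0..r})"
    by (intro compact_continuous_image primitive_continuous) simp
  then have "bounded ((\<lambda>t. integral {0..t} w) ` {0..r})" by (rule compact_imp_bounded)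
  then obtain B where "\<forall>y\<in>(\<lambda>t. integral {0..t} w) ` {0..r}. norm y \<le> B" unfolding bounded_iff by blast
  then have B: "\<bar>integral {0..t} w\<bar> \<le> B" if "t \<in> {0..r}" for t using that by auto
  define J where "J = (\<Sum>n\<in>K. \<bar>\<beta> n * w (x n)\<bar>)"
  show ?thesis
  proof (rule L2_bounded_support)
    show "g \<in> borel_measurable borel" unfolding g_def by measurable
    fix t assume t: "t \<in> punctured x"
    then have "0 \<le> t" by (simp add: punctured_def)
    show "f t = g t"
      using \<open>0 \<le> t\<close> f_zero[of t] by (cases "t \<le> r") (auto simp: g_def f_def step_def)
    show "g t = 0" if "r < t" using that by (simp add: g_def)
    have "\<bar>\<Sum>n\<in>K. if x n < t then \<beta> n * w (x n) else 0\<bar> \<le> J"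
      unfolding J_def by (rule order_trans[OF sum_abs]) (intro sum_mono, auto)
    moreover have "0 \<le> J" unfolding J_def by (intro sum_nonneg) simp
    ultimately show "cmod (g t) \<le> \<bar>B\<bar> + J"
      using B[of t] \<open>0 \<le> t\<close> by (cases "t \<le> r") (auto simp: g_def norm_of_real simp del: of_real_add of_real_mult)
  qed
qed

lemma pderivative2_f_L2: "pderivative x (pderivative x f) \<in> L2_half_line"
proof (rule L2_bounded_support)
  have "w' \<in> borel_measurable borel" by (rule borel_measurable_continuous_onI[OF w'_cont])
  then show "(\<lambda>t. complex_of_real (w' t)) \<in> borel_measurable borel" by measurable
  fix t assume t: "t \<in> punctured x"
  show "pderivative x (pderivative x f) t = complex_of_real (w' t)" by (rule pderivative2_f[OF t])
  show "cmod (complex_of_real (w' t)) \<le> M" using w'_bound[of t] by simp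
  show "complex_of_real (w' t) = 0" if "r < t" using supp(3)[of t] that by simp
qed

lemma f_W22: "f \<in> W22 x"
proof -
  obtain B where B: "B \<ge> 0" "\<forall>t. \<bar>w t\<bar> \<le> B" by (rule w_bounded)
  have "AC_loc (punctured x) f"
    by (rule AC_loc_bounded_derivative[OF f_has_derivative _ B(1)]) (use B in auto)
  moreover have "0 \<le> M" using w'_bound[of 0] by linarith
  then have "AC_loc (punctured x) (pderivative x f)"
    by (intro AC_loc_bounded_derivative[OF pderivative_f_has_derivative]) (use w'_bound in auto)
  ultimately show ?thesis unfolding W22_def using f_L2 pderivative2_f_L2 by blast
qed

lemma f_W22_comp: "f \<in> W22_comp x"
proof -
  have "{t \<in> punctured x. f t \<noteq> 0} \<subseteq> {l..r}"
  proof
    fix t assume "t \<in> {t \<in> punctured x. f t \<noteq> 0}"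
    then have "\<not> (t \<le> l \<or> r \<le> t)" using f_zero by blast
    then show "t \<in> {l..r}" by simp
  qed
  then have "bounded {t \<in> punctured x. f t \<noteq> 0}" by (rule bounded_subset[rotated]) simp
  then show ?thesis using f_W22 by (simp add: W22_comp_def compact_closure)
qed

text \<open>On an open piece \<open>x m < t\<close> is an index condition independent of
  \<open>t\<close>. The two limits of \<open>f\<close> differ in whether the mass at
  \<open>x n\<close> has been passed: \<open>m \<le> n\<close> on the right, \<open>m < n\<close> on
  the left.\<close>

lemma piece_limits:
  assumes n: "n \<ge> 1"
  shows "(pderivative x f \<longlongrightarrow> complex_of_real (w (x n))) (at_right (x n))"
    "(pderivative x f \<longlongrightarrow> complex_of_real (w (x n))) (at_left (x n))"
    "(f \<longlongrightarrow> complex_of_real (integral {0..x n} w + (\<Sum>m\<in>K. if m \<le> n then \<beta> m * w (x m) else 0))) (at_right (x n))"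
    "(f \<longlongrightarrow> complex_of_real (integral {0..x n} w + (\<Sum>m\<in>K. if m < n then \<beta> m * w (x m) else 0))) (at_left (x n))"
proof -
  obtain k where k: "n = Suc k" using n by (cases n) auto
  have r: "\<forall>\<^sub>F t in at_right (x n). t \<in> {x n<..<x (Suc n)}"
    by (rule eventually_at_right_real[OF x_Suc_less])
  have l: "\<forall>\<^sub>F t in at_left (x n). t \<in> {x k<..<x n}"
    unfolding k by (rule eventually_at_left_real[OF x_Suc_less])
  have "isCont w (x n)" using w_cont[of UNIV] by (simp add: continuous_on_eq_continuous_at)
  then have "((\<lambda>t. complex_of_real (w t)) \<longlongrightarrow> complex_of_real (w (x n))) (at (x n))"
    by (intro tendsto_of_real) (simp add: isCont_def)
  then have wlim: "((\<lambda>t. complex_of_real (w t)) \<longlongrightarrow> complex_of_real (w (x n))) (at (x n) within S)" for S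
    by (rule tendsto_within_subset) simp
  have "isCont (\<lambda>t. integral {0..t} w) (x n)"
    using x_pos[OF n] by (intro continuous_on_interior[OF primitive_continuous[of "x n + 1"]]) auto
  then have "((\<lambda>t. integral {0..t} w) \<longlongrightarrow> integral {0..x n} w) (at (x n))" by (simp add: isCont_def)
  then have Ilim: "((\<lambda>t. integral {0..t} w) \<longlongrightarrow> integral {0..x n} w) (at (x n) within S)" for S
    by (rule tendsto_within_subset) simp
  show "(pderivative x f \<longlongrightarrow> complex_of_real (w (x n))) (at_right (x n))"
    by (rule Lim_transform_eventually[OF wlim])
      (use r in eventually_elim, use open_piece_subset[of n] pderivative_f in force)
  show "(pderivative x f \<longlongrightarrow> complex_of_real (w (x n))) (at_left (x n))"
    by (rule Lim_transform_eventually[OF wlim])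
      (use l in eventually_elim, use open_piece_subset[of k] pderivative_f k in force)
  have right: "f t = complex_of_real (integral {0..t} w + (\<Sum>m\<in>K. if m \<le> n then \<beta> m * w (x m) else 0))"
    if t: "t \<in> {x n<..<x (Suc n)}" for t
  proof -
    have "x m < t \<longleftrightarrow> m \<le> n" for m
    proof
      assume "x m < t"
      then have "x m < x (Suc n)" using t by simp
      then show "m \<le> n" using strict_mono_less[OF x_mono, of m "Suc n"] by simp
    next
      assume "m \<le> n"
      then have "x m \<le> x n" using strict_mono_less_eq[OF x_mono] by simp
      then show "x m < t" using t by simp
    qed
    then show ?thesis by (simp add: f_def step_def)
  qed
  have left: "f t = complex_of_real (integral {0..t} w + (\<Sum>m\<in>K. if m < n then \<beta> m * w (x m) else 0))"
    if t: "t \<in> {x k<..<x n}" for t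
  proof -
    have "x m < t \<longleftrightarrow> m < n" for m
    proof
      assume "x m < t"
      then have "x m < x n" using t by simp
      then show "m < n" using strict_mono_less[OF x_mono, of m n] by simp
    next
      assume "m < n"
      then have "x m \<le> x k" using strict_mono_less_eq[OF x_mono] k by simp
      then show "x m < t" using t by simp
    qed
    then show ?thesis by (simp add: f_def step_def)
  qed
  show "(f \<longlongrightarrow> complex_of_real (integral {0..x n} w + (\<Sum>m\<in>K. if m \<le> n then \<beta> m * w (x m) else 0))) (at_right (x n))"
    by (rule Lim_transform_eventually[OF tendsto_of_real[OF tendsto_add[OF Ilim tendsto_const]]])
      (use r in eventually_elim, simp only: right)
  show "(f \<longlongrightarrow> complex_of_real (integral {0..x n} w + (\<Sum>m\<in>K. if m < n then \<beta> m * w (x m) else 0))) (at_left (x n))"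
    by (rule Lim_transform_eventually[OF tendsto_of_real[OF tendsto_add[OF Ilim tendsto_const]]])
      (use l in eventually_elim, simp only: left)
qed

text \<open>If \<open>n\<close> is not in \<open>K\<close>, the point lies beyond the support and
  both sides are zero.\<close>

lemma jump_sum:
  assumes n: "n \<ge> 1"
  shows "(\<Sum>m\<in>K. if m \<le> n then \<beta> m * w (x m) else 0) - (\<Sum>m\<in>K. if m < n then \<beta> m * w (x m) else 0) = \<beta> n * w (x n)"
proof -
  have "(\<Sum>m\<in>K. if m \<le> n then \<beta> m * w (x m) else 0) - (\<Sum>m\<in>K. if m < n then \<beta> m * w (x m) else 0)
    = (\<Sum>m\<in>K. if m = n then \<beta> n * w (x n) else 0)"
    unfolding sum_subtractf[symmetric] by (intro sum.cong) auto
  also have "\<dots> = \<beta> n * w (x n)" using K(1) w_points[OF n] by simp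
  finally show ?thesis .
qed

lemma f_in_domain: "f \<in> H_min_domain x \<beta>"
proof -
  have "w 0 = 0" using supp(3)[of 0] supp(1) by simp
  have "isCont w 0" using w_cont[of UNIV] by (simp add: continuous_on_eq_continuous_at)
  then have "((\<lambda>t. complex_of_real (w t)) \<longlongrightarrow> complex_of_real (w 0)) (at 0)"
    by (intro tendsto_of_real) (simp add: isCont_def)
  then have "((\<lambda>t. complex_of_real (w t)) \<longlongrightarrow> 0) (at_right 0)"
    using \<open>w 0 = 0\<close> tendsto_within_subset[OF _ subset_UNIV] by fastforce
  moreover have "\<forall>\<^sub>F t in at_right 0. complex_of_real (w t) = pderivative x f t"
  proof -
    have "\<forall>\<^sub>F t in at_right 0. t \<in> {0<..<x 1}" by (rule eventually_at_right_real) (simp add: x_pos)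
    then show ?thesis
    proof eventually_elim
      case (elim t)
      then have "t \<in> punctured x" by (intro subsetD[OF initial_piece_subset]) simp
      then show ?case by (simp add: pderivative_f)
    qed
  qed
  ultimately have "(pderivative x f \<longlongrightarrow> 0) (at_right 0)" by (rule Lim_transform_eventually)
  moreover have "\<exists>fr fl f'.
        (f \<longlongrightarrow> fr) (at_right (x n)) \<and> (f \<longlongrightarrow> fl) (at_left (x n)) \<and>
        (pderivative x f \<longlongrightarrow> f') (at_right (x n)) \<and>
        (pderivative x f \<longlongrightarrow> f') (at_left (x n)) \<and>
        fr - fl = complex_of_real (\<beta> n) * f'" if n: "n \<ge> 1" for n
  proof -
    have "complex_of_real (integral {0..x n} w + (\<Sum>m\<in>K. if m \<le> n then \<beta> m * w (x m) else 0))
        - complex_of_real (integral {0..x n} w + (\<Sum>m\<in>K. if m < n then \<beta> m * w (x m) else 0))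
        = complex_of_real (\<beta> n) * complex_of_real (w (x n))"
      unfolding of_real_diff[symmetric] of_real_mult[symmetric] jump_sum[OF n, symmetric] by simp
    then show ?thesis using piece_limits[OF n] by blast
  qed
  ultimately show ?thesis using f_W22_comp by (simp add: H_min_domain_def)
qed

end

section \<open>Plateaus of height one\<close>

context interaction_sequence begin

lemma step_diff_divide:
  assumes "continuous_on UNIV u" "continuous_on UNIV v"
  shows "step \<beta> K (\<lambda>t. u t / p - v t / q) t = step \<beta> K u t / p - step \<beta> K v t / q"
    and "mass \<beta> K R (\<lambda>t. u t / p - v t / q) = mass \<beta> K R u / p - mass \<beta> K R v / q"
proof -
  have int: "u integrable_on {0..b}" "v integrable_on {0..b}" for b
    by (rule integrable_continuous_real[OF continuous_on_subset[OF assms(1) subset_UNIV]])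
      (rule integrable_continuous_real[OF continuous_on_subset[OF assms(2) subset_UNIV]])
  have I: "integral {0..b} (\<lambda>t. u t / p - v t / q) = integral {0..b} u / p - integral {0..b} v / q" for b
    by (rule integral_unique[OF has_integral_diff[OF has_integral_divide[OF integrable_integral[OF int(1)]]
          has_integral_divide[OF integrable_integral[OF int(2)]]]])
  have "(\<Sum>n\<in>K. if x n < t then \<beta> n * (u (x n) / p - v (x n) / q) else 0)
    = (\<Sum>n\<in>K. (if x n < t then \<beta> n * u (x n) else 0) / p - (if x n < t then \<beta> n * v (x n) else 0) / q)"
    by (intro sum.cong) (auto simp: algebra_simps)
  then show "step \<beta> K (\<lambda>t. u t / p - v t / q) t = step \<beta> K u t / p - step \<beta> K v t / q"
    by (simp add: step_def I sum_subtractf sum_divide_distrib[symmetric] add_divide_distrib)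
  have "(\<Sum>n\<in>K. \<beta> n * (u (x n) / p - v (x n) / q)) = (\<Sum>n\<in>K. \<beta> n * u (x n) / p - \<beta> n * v (x n) / q)"
    by (intro sum.cong) (auto simp: algebra_simps)
  then show "mass \<beta> K R (\<lambda>t. u t / p - v t / q) = mass \<beta> K R u / p - mass \<beta> K R v / q"
    by (simp add: mass_def I sum_subtractf sum_divide_distrib[symmetric] add_divide_distrib)
qed

text \<open>\<open>w\<close> is the difference of two bumps, each divided by its mass
  \<open>S1\<close> or \<open>S2\<close> of either sign: the primitive reaches 1 after the first
  bump and 0 after the second. The hypotheses on \<open>4 / \<delta>1\<close> and
  \<open>4 / \<delta>2\<close> make both masses nonzero and bound each normalised slope by
  \<open>M\<close>, whence \<open>2 * M\<close>.\<close>

lemma test_function: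
  assumes a: "0 \<le> a" and M: "M > 0"
    and b1: "0 < \<delta>1" "a \<le> c1 - \<delta>1" "c1 + \<delta>1 \<le> a + 1"
    and b2: "0 < \<delta>2" "a + 2 \<le> c2 - \<delta>2" "c2 + \<delta>2 \<le> a + 3"
    and m1: "4 / \<delta>1 \<le> M * \<bar>mass \<beta> {n. 1 \<le> n \<and> x n \<le> a + 3} (a + 3) (bump c1 \<delta>1)\<bar>"
    and m2: "4 / \<delta>2 \<le> M * \<bar>mass \<beta> {n. 1 \<le> n \<and> x n \<le> a + 3} (a + 3) (bump c2 \<delta>2)\<bar>"
  shows "\<exists>f\<in>H_min_domain x \<beta>.
    (\<forall>t\<in>punctured x. t \<notin> {a..a + 3} \<longrightarrow> f t = 0 \<and> pderivative x (pderivative x f) t = 0) \<and>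
    (\<forall>t\<in>punctured x. cmod (pderivative x (pderivative x f) t) \<le> 2 * M) \<and>
    (\<forall>t\<in>{a + 1..a + 2}. f t = 1)"
proof -
  define K where "K = {n. 1 \<le> n \<and> x n \<le> a + 3}"
  define S1 where "S1 = mass \<beta> K (a + 3) (bump c1 \<delta>1)"
  define S2 where "S2 = mass \<beta> K (a + 3) (bump c2 \<delta>2)"
  define w where "w = (\<lambda>t. bump c1 \<delta>1 t / S1 - bump c2 \<delta>2 t / S2)"
  define w' where "w' = (\<lambda>t. bump_deriv c1 \<delta>1 t / S1 - bump_deriv c2 \<delta>2 t / S2)"
  have S1: "S1 \<noteq> 0" "4 / \<delta>1 \<le> M * \<bar>S1\<bar>" using m1 b1(1) by (auto simp: S1_def K_def divide_le_0_iff)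
  have S2: "S2 \<noteq> 0" "4 / \<delta>2 \<le> M * \<bar>S2\<bar>" using m2 b2(1) by (auto simp: S2_def K_def divide_le_0_iff)
  have out1: "bump c1 \<delta>1 t = 0 \<and> bump_deriv c1 \<delta>1 t = 0" if "t \<le> a \<or> a + 1 \<le> t" for t
    using bump_outside[OF b1(1), of t c1] that b1 by (auto simp: abs_if)
  have out2: "bump c2 \<delta>2 t = 0 \<and> bump_deriv c2 \<delta>2 t = 0" if "t \<le> a + 2 \<or> a + 3 \<le> t" for t
    using bump_outside[OF b2(1), of t c2] that b2 by (auto simp: abs_if)
  have cont: "continuous_on UNIV (bump c1 \<delta>1)" "continuous_on UNIV (bump c2 \<delta>2)"
    using b1 b2 by (auto intro: bump_continuous)
  interpret test_weight x \<beta> K w w' a "a + 3" "2 * M"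
  proof
    have "K \<subseteq> {n. x n \<le> a + 3}" by (auto simp: K_def)
    then show "finite K" using finite_below finite_subset by blast
    show "K \<subseteq> {1..}" "{n. 1 \<le> n \<and> x n \<le> a + 3} \<subseteq> K" by (auto simp: K_def)
    show "(w has_real_derivative w' t) (at t)" for t
      unfolding w_def w'_def using b1 b2 by (intro DERIV_diff DERIV_cdivide bump_has_derivative)
    show "continuous_on UNIV w'"
      unfolding w'_def using S1 S2 b1 b2 by (intro continuous_intros bump_deriv_continuous) auto
    show "\<bar>w' t\<bar> \<le> 2 * M" for t
    proof -
      have "\<bar>bump_deriv c1 \<delta>1 t\<bar> \<le> M * \<bar>S1\<bar>" "\<bar>bump_deriv c2 \<delta>2 t\<bar> \<le> M * \<bar>S2\<bar>"
        using bump_deriv_bound[OF b1(1), of c1 t] bump_deriv_bound[OF b2(1), of c2 t] S1 S2 by linarith+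
      then have "\<bar>bump_deriv c1 \<delta>1 t / S1\<bar> \<le> M" "\<bar>bump_deriv c2 \<delta>2 t / S2\<bar> \<le> M"
        using S1 S2 by (simp_all add: abs_divide divide_le_eq)
      then show ?thesis unfolding w'_def by linarith
    qed
    show "0 \<le> a" "a \<le> a + 3" using a by auto
    show "w t = 0 \<and> w' t = 0" if "t \<le> a \<or> a + 3 \<le> t" for t
      using out1[of t] out2[of t] that by (auto simp: w_def w'_def)
    show "mass \<beta> K (a + 3) w = 0"
      unfolding w_def step_diff_divide(2)[OF cont] using S1 S2 by (simp add: S1_def S2_def)
  qed
  have "f t = 1" if t: "t \<in> {a + 1..a + 2}" for t
  proof -
    have "step \<beta> K (bump c1 \<delta>1) t = S1" unfolding S1_def
      by (rule step_after[OF cont(1), of "a + 1"]) (use t out1 a in auto)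
    moreover have "step \<beta> K (bump c2 \<delta>2) t = 0"
      by (rule step_before[of "a + 2"]) (use t out2 in auto)
    moreover have "step \<beta> K w t = step \<beta> K (bump c1 \<delta>1) t / S1 - step \<beta> K (bump c2 \<delta>2) t / S2"
      unfolding w_def by (rule step_diff_divide(1)[OF cont])
    ultimately show ?thesis using S1(1) unfolding f_def by simp
  qed
  moreover have "f t = 0 \<and> pderivative x (pderivative x f) t = 0" if "t \<in> punctured x" "t \<notin> {a..a + 3}" for t
    using that f_zero[of t] supp(3)[of t] by (auto simp: pderivative2_f)
  moreover have "cmod (pderivative x (pderivative x f) t) \<le> 2 * M" if "t \<in> punctured x" for t
    using w'_bound[of t] that by (simp add: pderivative2_f)
  ultimately show ?thesis using f_in_domain by blast
qed

end

section \<open>Non-discreteness\<close>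

text \<open>Symmetry and surjectivity of \<open>T - a\<close> make its inverse single-valued and linear; the points
  \<open>z\<close> correspond to the points \<open>\<mu> = 1 / (z - a)\<close> of the inverse.\<close>

theorem symmetric_relation_not_discrete:
  fixes T :: "('a::{real_inner,complete_space} \<times> 'a) set" and \<rho> :: "real set"
  assumes sym: "\<And>u v u' v'. (u, v) \<in> T \<Longrightarrow> (u', v') \<in> T \<Longrightarrow> v \<bullet> u' = u \<bullet> v'"
    and bound: "\<And>z. z \<in> \<rho> \<Longrightarrow> \<exists>K. \<forall>(u, v)\<in>T. norm u \<le> K * norm (v - z *\<^sub>R u)"
    and onto: "\<And>z h. z \<in> \<rho> \<Longrightarrow> \<exists>(u, v)\<in>T. v - z *\<^sub>R u = h"
    and a: "a \<in> \<rho>"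
    and iso: "\<And>z. z \<notin> \<rho> \<Longrightarrow> \<exists>e>0. \<forall>w. 0 < \<bar>w - z\<bar> \<and> \<bar>w - z\<bar> < e \<longrightarrow> w \<in> \<rho>"
    and fin: "\<And>z. z \<notin> \<rho> \<Longrightarrow> \<exists>B. finite B \<and> {u. (u, z *\<^sub>R u) \<in> T} \<subseteq> span B"
    and uv: "\<And>k :: nat. (u k, v k) \<in> T"
    and orth: "\<And>i j. i \<noteq> j \<Longrightarrow> u i \<bullet> u j = 0 \<and> u i \<bullet> v j = 0 \<and> v i \<bullet> v j = 0"
    and nz: "\<And>k. u k \<noteq> 0" and M: "\<And>k. norm (v k) \<le> M * norm (u k)"
  shows False
proof -
  have "\<forall>h. \<exists>s. (s, h + a *\<^sub>R s) \<in> T"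
  proof
    fix h
    obtain s t where "(s, t) \<in> T" "t - a *\<^sub>R s = h" using onto[OF a, of h] by blast
    then show "\<exists>s. (s, h + a *\<^sub>R s) \<in> T" by (intro exI[of _ s]) (auto simp: algebra_simps)
  qed
  then obtain S where S: "\<And>h. (S h, h + a *\<^sub>R S h) \<in> T" by metis
  have graph: "(s, t) \<in> T \<Longrightarrow> s \<bullet> k = (t - a *\<^sub>R s) \<bullet> S k" for s t k
    using sym[OF _ S[of k], of s t] by (simp add: inner_diff_left inner_add_right)
  have S_sym: "S h \<bullet> k = h \<bullet> S k" for h k
    using graph[OF S[of h], of k] by simp
  have S_eq: "S (t - a *\<^sub>R s) = s" if "(s, t) \<in> T" for s t
  proof -
    have "(S (t - a *\<^sub>R s) - s) \<bullet> k = 0" for k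
      using graph[OF that, of k] S_sym[of "t - a *\<^sub>R s" k] by (simp add: inner_diff_left)
    then have "S (t - a *\<^sub>R s) - s = 0" using inner_eq_zero_iff by blast
    then show ?thesis by simp
  qed
  obtain K where K: "\<forall>(u, v)\<in>T. norm u \<le> K * norm (v - a *\<^sub>R u)" using bound[OF a] by blast
  have S_lin: "bounded_linear S"
  proof (rule bounded_linear_intro[where K = K])
    fix h k :: 'a and r :: real
    have "(S (h + k) - S h - S k) \<bullet> y = 0" for y
      by (simp add: inner_diff_left S_sym inner_add_left)
    then have "S (h + k) - S h - S k = 0" using inner_eq_zero_iff by blast
    then show "S (h + k) = S h + S k" by (simp add: algebra_simps)
    have "(S (r *\<^sub>R h) - r *\<^sub>R S h) \<bullet> y = 0" for y
      by (simp add: inner_diff_left S_sym)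
    then have "S (r *\<^sub>R h) - r *\<^sub>R S h = 0" using inner_eq_zero_iff by blast
    then show "S (r *\<^sub>R h) = r *\<^sub>R S h" by simp
    show "norm (S h) \<le> norm h * K" using K S[of h] by (auto simp: mult.commute)
  qed
  interpret S: bounded_linear S by (rule S_lin)
  have reg: "regular_value S \<mu>" if \<mu>: "\<mu> \<noteq> 0" and z: "a + 1 / \<mu> \<in> \<rho>" for \<mu>
    unfolding regular_value_def
  proof
    obtain L where L: "\<forall>(u, v)\<in>T. norm u \<le> L * norm (v - (a + 1 / \<mu>) *\<^sub>R u)" using bound[OF z] by blast
    have "norm h \<le> ((\<bar>L\<bar> / \<bar>\<mu>\<bar> + 1) / \<bar>\<mu>\<bar>) * norm (S h - \<mu> *\<^sub>R h)" for h
    proof -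
      let ?d = "S h - \<mu> *\<^sub>R h"
      \<comment> \<open>The identity \<open>(T - z) S h = - (1 / \<mu>) (S - \<mu>) h\<close> for
        \<open>z = a + 1 / \<mu>\<close> turns the lower bound at \<open>z\<close> into one at
        \<open>\<mu>\<close>; read backwards it gives surjectivity.\<close>
      have eq: "(h + a *\<^sub>R S h) - (a + 1 / \<mu>) *\<^sub>R S h = (- 1 / \<mu>) *\<^sub>R ?d"
        using \<mu> by (simp add: algebra_simps)
      have "norm (S h) \<le> L * norm ((h + a *\<^sub>R S h) - (a + 1 / \<mu>) *\<^sub>R S h)" using L S[of h] by blast
      also have "\<dots> = L * (norm ?d / \<bar>\<mu>\<bar>)" unfolding eq by simp
      also have "\<dots> \<le> \<bar>L\<bar> * (norm ?d / \<bar>\<mu>\<bar>)" by (intro mult_right_mono) auto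
      finally have 1: "norm (S h) \<le> (\<bar>L\<bar> / \<bar>\<mu>\<bar>) * norm ?d" by simp
      have "\<bar>\<mu>\<bar> * norm h = norm (S h - ?d)" by simp
      also have "\<dots> \<le> norm (S h) + norm ?d" by (rule norm_triangle_ineq4)
      also have "\<dots> \<le> (\<bar>L\<bar> / \<bar>\<mu>\<bar> + 1) * norm ?d" using 1 by (simp add: algebra_simps)
      finally have "norm h \<le> ((\<bar>L\<bar> / \<bar>\<mu>\<bar> + 1) * norm ?d) / \<bar>\<mu>\<bar>"
        using \<mu> by (subst pos_le_divide_eq) (simp_all only: zero_less_abs_iff mult.commute[of _ "\<bar>\<mu>\<bar>"] not_False_eq_True)
      then show ?thesis by simp
    qed
    then show "\<exists>K. \<forall>h. norm h \<le> K * norm (S h - \<mu> *\<^sub>R h)" by blast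
    show "\<forall>k. \<exists>h. S h - \<mu> *\<^sub>R h = k"
    proof
      fix k
      obtain s t where st: "(s, t) \<in> T" "t - (a + 1 / \<mu>) *\<^sub>R s = (- 1 / \<mu>) *\<^sub>R k"
        using onto[OF z, of "(- 1 / \<mu>) *\<^sub>R k"] by blast
      have "S (t - a *\<^sub>R s) - \<mu> *\<^sub>R (t - a *\<^sub>R s) = (- \<mu>) *\<^sub>R (t - (a + 1 / \<mu>) *\<^sub>R s)"
        using \<mu> by (simp add: S_eq[OF st(1)] algebra_simps)
      also have "\<dots> = k" unfolding st(2) using \<mu> by simp
      finally show "\<exists>h. S h - \<mu> *\<^sub>R h = k" by blast
    qed
  qed
  show False
  proof (rule discrete_spectrum_no_bounded_below_sequence[OF S_lin S_sym])
    fix \<mu> :: real assume \<mu>: "\<mu> \<noteq> 0" "\<not> regular_value S \<mu>"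
    then have z: "a + 1 / \<mu> \<notin> \<rho>" using reg by blast
    obtain e where e: "e > 0" "\<And>w. 0 < \<bar>w - (a + 1 / \<mu>)\<bar> \<Longrightarrow> \<bar>w - (a + 1 / \<mu>)\<bar> < e \<Longrightarrow> w \<in> \<rho>"
      using iso[OF z] by blast
    \<comment> \<open>Inversion is continuous and injective away from 0, so the regular punctured
      neighbourhood of \<open>a + 1 / \<mu>\<close> pulls back to one of
      \<open>\<mu>\<close>.\<close>
    have "((\<lambda>\<nu>. 1 / \<nu>) \<longlongrightarrow> 1 / \<mu>) (at \<mu>)" using \<mu>(1) by (intro tendsto_intros)
    then have "\<forall>\<^sub>F \<nu> in at \<mu>. dist (1 / \<nu>) (1 / \<mu>) < e" using e(1) by (rule tendstoD)
    moreover have "\<forall>\<^sub>F \<nu> in at \<mu>. \<nu> \<noteq> 0" using tendsto_imp_eventually_ne[OF tendsto_ident_at \<mu>(1)] .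
    ultimately have "\<forall>\<^sub>F \<nu> in at \<mu>. dist (1 / \<nu>) (1 / \<mu>) < e \<and> \<nu> \<noteq> 0" by (rule eventually_conj)
    then obtain d where d: "d > 0" "\<And>\<nu>. \<nu> \<noteq> \<mu> \<Longrightarrow> dist \<nu> \<mu> < d \<Longrightarrow> dist (1 / \<nu>) (1 / \<mu>) < e \<and> \<nu> \<noteq> 0"
      unfolding eventually_at by blast
    have "regular_value S \<nu>" if \<nu>: "0 < \<bar>\<nu> - \<mu>\<bar>" "\<bar>\<nu> - \<mu>\<bar> < d" for \<nu>
    proof -
      have *: "\<nu> \<noteq> \<mu>" "\<bar>1 / \<nu> - 1 / \<mu>\<bar> < e" "\<nu> \<noteq> 0" using d(2)[of \<nu>] \<nu> by (auto simp: dist_real_def)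
      have "1 / \<nu> \<noteq> 1 / \<mu>" using * \<mu>(1) by (simp add: field_simps)
      then have "a + 1 / \<nu> \<in> \<rho>" using * by (intro e(2)) auto
      then show ?thesis by (rule reg[OF *(3)])
    qed
    then show "\<exists>\<delta>>0. \<forall>\<nu>. 0 < \<bar>\<nu> - \<mu>\<bar> \<and> \<bar>\<nu> - \<mu>\<bar> < \<delta> \<longrightarrow> regular_value S \<nu>" using d(1) by blast
    obtain B where B: "finite B" "{u. (u, (a + 1 / \<mu>) *\<^sub>R u) \<in> T} \<subseteq> span B" using fin[OF z] by blast
    have "h \<in> span B" if h: "S h = \<mu> *\<^sub>R h" for h
    proof -
      have "h + a *\<^sub>R S h = (a + 1 / \<mu>) *\<^sub>R S h" using \<mu>(1) by (simp add: h algebra_simps)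
      then have "S h \<in> span B" using S[of h] B(2) by auto
      then have "(1 / \<mu>) *\<^sub>R S h \<in> span B" by (rule span_scale)
      then show ?thesis using \<mu>(1) by (simp add: h)
    qed
    then show "\<exists>B. finite B \<and> {h. S h = \<mu> *\<^sub>R h} \<subseteq> span B" using B(1) by blast
  next
    \<comment> \<open>The sequence fed to \<open>S\<close> is \<open>h i = v i - a u i\<close>, for
      which \<open>S (h i) = u i\<close>; expanding the product uses all the orthogonality relations
      between the \<open>u\<close> and the \<open>v\<close>.\<close>
    show "(v i - a *\<^sub>R u i) \<bullet> (v j - a *\<^sub>R u j) = 0" if "i \<noteq> j" for i j
      using orth[OF that] orth[OF that[symmetric]]
      by (simp add: inner_diff_left inner_diff_right inner_commute)
    show "v i - a *\<^sub>R u i \<noteq> 0" for i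
      using S_eq[OF uv[of i]] nz[of i] S.zero by auto
    have "M \<ge> 0"
    proof -
      have "0 \<le> M * norm (u 0)" using M[of 0] norm_ge_zero[of "v 0"] by linarith
      then show ?thesis using nz[of 0] by (simp add: zero_le_mult_iff)
    qed
    then show "1 / (M + \<bar>a\<bar> + 1) > 0" by simp
    show "1 / (M + \<bar>a\<bar> + 1) * norm (v i - a *\<^sub>R u i) \<le> norm (S (v i - a *\<^sub>R u i))" for i
    proof -
      have "norm (v i - a *\<^sub>R u i) \<le> norm (v i) + \<bar>a\<bar> * norm (u i)"
        using norm_triangle_ineq4[of "v i" "a *\<^sub>R u i"] by simp
      also have "\<dots> \<le> (M + \<bar>a\<bar> + 1) * norm (u i)"
        using M[of i] by (simp add: algebra_simps add_increasing)
      finally show ?thesis using \<open>M \<ge> 0\<close> by (simp add: S_eq[OF uv] field_simps)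
    qed
  qed
qed

section \<open>Complex eigenspaces over the reals\<close>

lemma abs_l2_cmult_in_span:
  assumes "b \<in> L2_half_line" "abs_l2 b \<in> span V" "abs_l2 (\<lambda>t. \<i> * b t) \<in> span V"
  shows "abs_l2 (\<lambda>t. c * b t) \<in> span V"
proof -
  have "abs_l2 (\<lambda>t. c * b t) = Re c *\<^sub>R abs_l2 b + Im c *\<^sub>R abs_l2 (\<lambda>t. \<i> * b t)"
  proof -
    have "c * b t = Re c *\<^sub>R b t + Im c *\<^sub>R (\<i> * b t)" for t
      by (subst complex_eq[of c]) (simp add: scaleR_conv_of_real algebra_simps)
    then show ?thesis using assms(1) by (simp add: abs_l2_simps L2_scaleR L2_cmult)
  qed
  then show ?thesis using assms by (simp add: span_add span_scale)
qed

lemma abs_l2_sum_in_span: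
  assumes "finite B" "B \<subseteq> L2_half_line" "\<And>b. b \<in> B \<Longrightarrow> abs_l2 b \<in> span V \<and> abs_l2 (\<lambda>t. \<i> * b t) \<in> span V"
  shows "(\<lambda>t. \<Sum>b\<in>B. c b * b t) \<in> L2_half_line \<and> abs_l2 (\<lambda>t. \<Sum>b\<in>B. c b * b t) \<in> span V"
  using assms
proof (induction B rule: finite_induct)
  case empty
  have "abs_l2 (\<lambda>t. 0) = 0" by (simp add: zero_l2_def)
  then show ?case by (simp add: L2_zero span_zero)
next
  case (insert b B)
  have "B \<subseteq> L2_half_line" using insert.prems(1) by simp
  from insert.IH[OF this insert.prems(2)]
  have IH: "(\<lambda>t. \<Sum>b\<in>B. c b * b t) \<in> L2_half_line" "abs_l2 (\<lambda>t. \<Sum>b\<in>B. c b * b t) \<in> span V" by simp_all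
  have b: "b \<in> L2_half_line" using insert.prems(1) by simp
  have 1: "abs_l2 (\<lambda>t. c b * b t) \<in> span V"
    by (rule abs_l2_cmult_in_span[OF b]) (use insert.prems(2)[of b] in simp_all)
  have "(\<lambda>t. \<Sum>b\<in>insert b B. c b * b t) = (\<lambda>t. c b * b t + (\<Sum>b\<in>B. c b * b t))"
    using insert.hyps by simp
  moreover have "abs_l2 (\<lambda>t. c b * b t + (\<Sum>b\<in>B. c b * b t)) = abs_l2 (\<lambda>t. c b * b t) + abs_l2 (\<lambda>t. \<Sum>b\<in>B. c b * b t)"
    by (simp add: abs_l2_simps(2)[OF L2_cmult[OF b] IH(1)])
  ultimately show ?case using L2_add[OF L2_cmult[OF b] IH(1)] span_add[OF 1 IH(2)] by simp
qed

text \<open>A complex spanning set together with its multiples by \<open>\<i>\<close> spans over the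
  reals, so finite multiplicity survives the restriction to real scalars.\<close>

lemma eigenspace_finite_real_span:
  assumes A: "A \<subseteq> L2_half_line \<times> L2_half_line" and m: "has_finite_multiplicity A z"
  obtains V :: "l2 set" where "finite V" "\<forall>f\<in>eigenspace A z. abs_l2 f \<in> span V"
proof -
  obtain B where B: "finite B" "B \<subseteq> eigenspace A z"
    "\<And>f. f \<in> eigenspace A z \<Longrightarrow> \<exists>c. ae_eq f (\<lambda>t. \<Sum>b\<in>B. c b * b t)"
    using m unfolding has_finite_multiplicity_def by blast
  have L2: "f \<in> L2_half_line" if "f \<in> eigenspace A z" for f using that A by (auto simp: eigenspace_def)
  define V where "V = abs_l2 ` B \<union> (\<lambda>b. abs_l2 (\<lambda>t. \<i> * b t)) ` B"
  have "abs_l2 f \<in> span V" if f: "f \<in> eigenspace A z" for f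
  proof -
    obtain c where c: "ae_eq f (\<lambda>t. \<Sum>b\<in>B. c b * b t)" using B(3)[OF f] by blast
    have *: "(\<lambda>t. \<Sum>b\<in>B. c b * b t) \<in> L2_half_line \<and> abs_l2 (\<lambda>t. \<Sum>b\<in>B. c b * b t) \<in> span V"
      using B(1,2) L2 by (intro abs_l2_sum_in_span) (auto simp: V_def intro: span_base)
    then have "abs_l2 f = abs_l2 (\<lambda>t. \<Sum>b\<in>B. c b * b t)" using c abs_l2_eq_iff[OF L2[OF f]] by blast
    then show ?thesis using * by simp
  qed
  moreover have "finite V" using B(1) by (simp add: V_def)
  ultimately show thesis using that by blast
qed

section \<open>The closure of a symmetric operator\<close>

lemma op_closure_L2: "op_closure A \<subseteq> L2_half_line \<times> L2_half_line"
  by (auto simp: op_closure_def)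

lemma op_closure_superset:
  assumes "(f, g) \<in> A" "f \<in> L2_half_line" "g \<in> L2_half_line"
  shows "(f, g) \<in> op_closure A"
  unfolding op_closure_def mem_Collect_eq case_prod_conv
proof (intro conjI assms)
  show "\<exists>F G. (\<forall>k::nat. (F k, G k) \<in> A) \<and>
        (\<lambda>k. L2_norm (\<lambda>t. F k t - f t)) \<longlonglongrightarrow> 0 \<and> (\<lambda>k. L2_norm (\<lambda>t. G k t - g t)) \<longlonglongrightarrow> 0"
    by (rule exI[of _ "\<lambda>_. f"], rule exI[of _ "\<lambda>_. g"]) (simp add: assms(1) L2_norm_def)
qed

text \<open>The inner product is continuous, so the identity survives limits in both components of
  the graph.\<close>

lemma op_closure_symmetric:
  assumes A: "A \<subseteq> L2_half_line \<times> L2_half_line"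
    and sym: "\<And>f g f' g'. (f, g) \<in> A \<Longrightarrow> (f', g') \<in> A \<Longrightarrow> abs_l2 g \<bullet> abs_l2 f' = abs_l2 f \<bullet> abs_l2 g'"
    and fg: "(f, g) \<in> op_closure A" "(f', g') \<in> op_closure A"
  shows "abs_l2 g \<bullet> abs_l2 f' = abs_l2 f \<bullet> abs_l2 g'"
proof -
  have lim: "(\<lambda>k. abs_l2 (F k)) \<longlonglongrightarrow> abs_l2 h"
    if "\<And>k. F k \<in> L2_half_line" "h \<in> L2_half_line" "(\<lambda>k. L2_norm (\<lambda>t. F k t - h t)) \<longlonglongrightarrow> 0" for F h
  proof -
    have "(\<lambda>k. norm (abs_l2 (F k) - abs_l2 h)) \<longlonglongrightarrow> 0"
      using that by (simp add: abs_l2_simps L2_diff)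
    then show ?thesis using LIM_zero_cancel tendsto_norm_zero_iff by blast
  qed
  have seq: "\<exists>F G. (\<forall>k::nat. (F k, G k) \<in> A) \<and> (\<lambda>k. abs_l2 (F k)) \<longlonglongrightarrow> abs_l2 p \<and> (\<lambda>k. abs_l2 (G k)) \<longlonglongrightarrow> abs_l2 q"
    if pq: "(p, q) \<in> op_closure A" for p q
  proof -
    obtain F G where FG: "\<forall>k::nat. (F k, G k) \<in> A"
      "(\<lambda>k. L2_norm (\<lambda>t. F k t - p t)) \<longlonglongrightarrow> 0" "(\<lambda>k. L2_norm (\<lambda>t. G k t - q t)) \<longlonglongrightarrow> 0"
      "p \<in> L2_half_line" "q \<in> L2_half_line"
      using pq unfolding op_closure_def by blast
    have "F k \<in> L2_half_line" "G k \<in> L2_half_line" for k using FG(1) A by auto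
    then show ?thesis using FG lim[of F p] lim[of G q] by blast
  qed
  obtain F G where FG: "\<forall>k::nat. (F k, G k) \<in> A" "(\<lambda>k. abs_l2 (F k)) \<longlonglongrightarrow> abs_l2 f" "(\<lambda>k. abs_l2 (G k)) \<longlonglongrightarrow> abs_l2 g"
    using seq[OF fg(1)] by blast
  obtain F' G' where FG': "\<forall>k::nat. (F' k, G' k) \<in> A" "(\<lambda>k. abs_l2 (F' k)) \<longlonglongrightarrow> abs_l2 f'" "(\<lambda>k. abs_l2 (G' k)) \<longlonglongrightarrow> abs_l2 g'"
    using seq[OF fg(2)] by blast
  have eq: "abs_l2 (G k) \<bullet> abs_l2 (F' k) = abs_l2 (F k) \<bullet> abs_l2 (G' k)" for k
    using FG(1) FG'(1) by (intro sym) auto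
  have 1: "(\<lambda>k. abs_l2 (F k) \<bullet> abs_l2 (G' k)) \<longlonglongrightarrow> abs_l2 g \<bullet> abs_l2 f'"
    unfolding eq[symmetric] by (intro tendsto_inner FG FG')
  have 2: "(\<lambda>k. abs_l2 (F k) \<bullet> abs_l2 (G' k)) \<longlonglongrightarrow> abs_l2 f \<bullet> abs_l2 g'"
    by (intro tendsto_inner FG FG')
  show ?thesis by (rule LIMSEQ_unique[OF 1 2])
qed

text \<open>Only real spectral parameters enter, so complex-valued \<open>L\<^sup>2\<close> may be treated as a real Hilbert space.\<close>

theorem symmetric_operator_not_discrete:
  assumes A: "A \<subseteq> L2_half_line \<times> L2_half_line"
    and sym: "\<And>f g f' g'. (f, g) \<in> A \<Longrightarrow> (f', g') \<in> A \<Longrightarrow> abs_l2 g \<bullet> abs_l2 f' = abs_l2 f \<bullet> abs_l2 g'"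
    and fg: "\<And>k :: nat. (f k, g k) \<in> A"
    and orth: "\<And>i j. i \<noteq> j \<Longrightarrow> abs_l2 (f i) \<bullet> abs_l2 (f j) = 0 \<and> abs_l2 (f i) \<bullet> abs_l2 (g j) = 0
      \<and> abs_l2 (g i) \<bullet> abs_l2 (g j) = 0"
    and nz: "\<And>k. abs_l2 (f k) \<noteq> 0" and M: "\<And>k. norm (abs_l2 (g k)) \<le> M * norm (abs_l2 (f k))"
  shows "\<not> has_discrete_spectrum A"
proof
  assume disc: "has_discrete_spectrum A"
  define \<rho> where "\<rho> = {r. complex_of_real r \<in> resolvent_set A}"
  define T where "T = (\<lambda>(f, g). (abs_l2 f, abs_l2 g)) ` A"
  have AL: "p \<in> L2_half_line" "q \<in> L2_half_line" if "(p, q) \<in> A" for p q using that A by auto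
  have diff: "abs_l2 q - z *\<^sub>R abs_l2 p = abs_l2 (\<lambda>t. q t - complex_of_real z * p t)"
    and diffL: "(\<lambda>t. q t - complex_of_real z * p t) \<in> L2_half_line" if "(p, q) \<in> A" for p q z
    using AL[OF that] by (simp_all add: abs_l2_simps L2_scaleR L2_diff L2_cmult scaleR_conv_of_real)
  have TE: "\<exists>p q. (p, q) \<in> A \<and> u = abs_l2 p \<and> v = abs_l2 q" if "(u, v) \<in> T" for u v
    using that unfolding T_def by auto
  have TI: "(abs_l2 p, abs_l2 q) \<in> T" if "(p, q) \<in> A" for p q
    using that unfolding T_def by force
  have iso: "\<exists>e>0. \<forall>w. 0 < \<bar>w - z\<bar> \<and> \<bar>w - z\<bar> < e \<longrightarrow> w \<in> \<rho>" if "z \<notin> \<rho>" for z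
  proof -
    have "complex_of_real z isolated_in op_spectrum A"
      using disc that by (auto simp: has_discrete_spectrum_def op_spectrum_def \<rho>_def)
    then obtain U where U: "open U" "U \<inter> op_spectrum A = {complex_of_real z}"
      unfolding isolated_in_def by blast
    then have "complex_of_real z \<in> U" by blast
    then obtain e where e: "e > 0" "ball (complex_of_real z) e \<subseteq> U" using U(1) open_contains_ball by blast
    have "w \<in> \<rho>" if w: "0 < \<bar>w - z\<bar>" "\<bar>w - z\<bar> < e" for w
    proof -
      have "dist (complex_of_real z) (complex_of_real w) = \<bar>z - w\<bar>"
        by (simp add: dist_norm flip: of_real_diff)
      then have "complex_of_real w \<in> U" using w e(2) by (auto simp: abs_minus_commute)
      moreover have "complex_of_real w \<noteq> complex_of_real z" using w by auto
      ultimately have "complex_of_real w \<notin> op_spectrum A" using U(2) by blast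
      then show ?thesis by (simp add: op_spectrum_def \<rho>_def)
    qed
    then show ?thesis using e(1) by blast
  qed
  \<comment> \<open>Isolation provides a real regular point: 0 itself, or else a nonzero real number
    close to it.\<close>
  have "\<exists>a. a \<in> \<rho>"
  proof (cases "0 \<in> \<rho>")
    case False
    obtain e where e: "e > 0" "\<And>w. 0 < \<bar>w - 0\<bar> \<and> \<bar>w - 0\<bar> < e \<Longrightarrow> w \<in> \<rho>" using iso[OF False] by blast
    then have "e / 2 \<in> \<rho>" by (intro e(2)) auto
    then show ?thesis by blast
  qed blast
  then obtain a where a: "a \<in> \<rho>" by blast
  show False
  proof (rule symmetric_relation_not_discrete[where T = T and \<rho> = \<rho> and u = "\<lambda>k. abs_l2 (f k)"
        and v = "\<lambda>k. abs_l2 (g k)" and M = M, OF _ _ _ a iso])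
    fix u v u' v' assume uv: "(u, v) \<in> T" "(u', v') \<in> T"
    obtain p q where pq: "(p, q) \<in> A" "u = abs_l2 p" "v = abs_l2 q" using TE[OF uv(1)] by blast
    obtain p' q' where pq': "(p', q') \<in> A" "u' = abs_l2 p'" "v' = abs_l2 q'" using TE[OF uv(2)] by blast
    show "v \<bullet> u' = u \<bullet> v'" unfolding pq pq' by (rule sym[OF pq(1) pq'(1)])
  next
    fix z assume "z \<in> \<rho>"
    then have z: "complex_of_real z \<in> resolvent_set A" by (simp add: \<rho>_def)
    then obtain K where K: "\<forall>(p, q)\<in>A. L2_norm p \<le> K * L2_norm (\<lambda>t. q t - complex_of_real z * p t)"
      unfolding resolvent_set_def by blast
    have "norm u \<le> K * norm (v - z *\<^sub>R u)" if uv: "(u, v) \<in> T" for u v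
    proof -
      obtain p q where pq: "(p, q) \<in> A" "u = abs_l2 p" "v = abs_l2 q" using TE[OF uv] by blast
      show ?thesis unfolding pq diff[OF pq(1)] abs_l2_simps(1)[OF diffL[OF pq(1)]] abs_l2_simps(1)[OF AL(1)[OF pq(1)]]
        using K pq(1) by blast
    qed
    then show "\<exists>K. \<forall>(u, v)\<in>T. norm u \<le> K * norm (v - z *\<^sub>R u)" by blast
    fix h :: l2
    obtain h' where h': "h' \<in> L2_half_line" "abs_l2 h' = h" by (rule abs_l2_surj)
    then obtain p q where pq: "(p, q) \<in> A" "ae_eq (\<lambda>t. q t - complex_of_real z * p t) h'"
      using z unfolding resolvent_set_def by blast
    then have "abs_l2 q - z *\<^sub>R abs_l2 p = h"
      unfolding diff[OF pq(1)] h'(2)[symmetric] abs_l2_eq_iff[OF diffL[OF pq(1)] h'(1)] by simp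
    then show "\<exists>(u, v)\<in>T. v - z *\<^sub>R u = h" using TI[OF pq(1)] by blast
  next
    fix z assume "z \<notin> \<rho>"
    then have "has_finite_multiplicity A (complex_of_real z)"
      using disc by (simp add: has_discrete_spectrum_def op_spectrum_def \<rho>_def)
    from eigenspace_finite_real_span[OF A this]
    obtain V :: "l2 set" where V: "finite V" "\<forall>f\<in>eigenspace A (complex_of_real z). abs_l2 f \<in> span V" .
    have "u \<in> span V" if u: "(u, z *\<^sub>R u) \<in> T" for u
    proof -
      obtain p q where pq: "(p, q) \<in> A" "u = abs_l2 p" "z *\<^sub>R u = abs_l2 q" using TE[OF u] by blast
      have "abs_l2 q = abs_l2 (\<lambda>t. complex_of_real z * p t)"
        using pq AL[OF pq(1)] by (simp add: abs_l2_simps scaleR_conv_of_real flip: pq(3))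
      then have "ae_eq q (\<lambda>t. complex_of_real z * p t)"
        using AL[OF pq(1)] by (simp add: abs_l2_eq_iff L2_cmult)
      then have "p \<in> eigenspace A (complex_of_real z)" using pq(1) by (auto simp: eigenspace_def)
      then show ?thesis using V(2) pq(2) by simp
    qed
    then show "\<exists>B. finite B \<and> {u. (u, z *\<^sub>R u) \<in> T} \<subseteq> span B" using V(1) by blast
  next
    show "(abs_l2 (f k), abs_l2 (g k)) \<in> T" for k by (rule TI[OF fg])
  qed (use orth nz M in auto)
qed

section \<open>Norms and orthogonality in the quotient\<close>

context interaction_sequence begin

lemma H_min_L2: "H_min x \<beta> \<subseteq> L2_half_line \<times> L2_half_line"
  by (auto simp: H_min_def H_min_domain_def W22_comp_def W22_def intro: L2_uminus)

lemma H_min_inner_symmetric: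
  assumes "(f, g) \<in> H_min x \<beta>" "(f', g') \<in> H_min x \<beta>"
  shows "abs_l2 g \<bullet> abs_l2 f' = abs_l2 f \<bullet> abs_l2 g'"
proof -
  have dom: "f \<in> H_min_domain x \<beta>" "f' \<in> H_min_domain x \<beta>"
    and g: "g = (\<lambda>t. - pderivative x (pderivative x f) t)" "g' = (\<lambda>t. - pderivative x (pderivative x f') t)"
    using assms by (auto simp: H_min_def)
  have L2: "f \<in> L2_half_line" "g \<in> L2_half_line" "f' \<in> L2_half_line" "g' \<in> L2_half_line"
    using assms H_min_L2 by auto
  have "abs_l2 f \<bullet> abs_l2 g' - abs_l2 g \<bullet> abs_l2 f' = (\<integral>t. f t \<bullet> g' t - g t \<bullet> f' t \<partial>half_line_measure)"
    using L2 by (simp add: abs_l2_simps L2_integrable_inner)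
  also have "\<dots> = (\<integral>t. wronskian_density f f' t \<partial>half_line_measure)"
    by (simp add: g wronskian_density_def)
  also have "\<dots> = 0" by (rule H_min_symmetric[OF dom])
  finally show ?thesis by simp
qed

lemma half_line_integral_indicator:
  assumes "0 \<le> a" "a \<le> b"
  shows "(\<integral>t. indicat_real {a..b} t \<partial>half_line_measure) = b - a"
proof -
  have "(\<integral>t. indicat_real {a..b} t \<partial>half_line_measure) = (\<integral>t. indicat_real {0..} t *\<^sub>R indicat_real {a..b} t \<partial>lebesgue)"
    by (subst integral_restrict_space) auto
  also have "\<dots> = (\<integral>t. indicat_real {a..b} t \<partial>lebesgue)"
    using assms by (intro Bochner_Integration.integral_cong) (auto simp: indicator_def)
  also have "\<dots> = b - a" using assms by simp
  finally show ?thesis .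
qed

lemma L2_norm_bounds:
  assumes f: "f \<in> L2_half_line" and ab: "0 \<le> a" "a \<le> b"
  shows "(\<And>t. t \<in> {a..b} \<Longrightarrow> cmod (f t) = 1) \<Longrightarrow> b - a \<le> (L2_norm f)\<^sup>2"
    and "(\<And>t. t \<in> punctured x \<Longrightarrow> cmod (f t) \<le> B * indicat_real {a..b} t) \<Longrightarrow> (L2_norm f)\<^sup>2 \<le> B\<^sup>2 * (b - a)"
proof -
  have sq: "(L2_norm f)\<^sup>2 = (\<integral>t. (cmod (f t))\<^sup>2 \<partial>half_line_measure)" by (simp add: L2_norm_def)
  show "b - a \<le> (L2_norm f)\<^sup>2" if "\<And>t. t \<in> {a..b} \<Longrightarrow> cmod (f t) = 1"
    unfolding sq half_line_integral_indicator[OF ab, symmetric]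
    by (intro integral_mono half_line_integrable_indicator L2_half_lineD(2)[OF f])
      (use that in \<open>auto simp: indicator_def\<close>)
  assume B: "\<And>t. t \<in> punctured x \<Longrightarrow> cmod (f t) \<le> B * indicat_real {a..b} t"
  have "(L2_norm f)\<^sup>2 \<le> (\<integral>t. B\<^sup>2 * indicat_real {a..b} t \<partial>half_line_measure)"
    unfolding sq
  proof (rule integral_mono_AE[OF L2_half_lineD(2)[OF f]])
    show "integrable half_line_measure (\<lambda>t. B\<^sup>2 * indicat_real {a..b} t)"
      using half_line_integrable_indicator by simp
    show "AE t in half_line_measure. (cmod (f t))\<^sup>2 \<le> B\<^sup>2 * indicat_real {a..b} t"
      using AE_punctured
    proof eventually_elim
      case (elim t)
      have "(cmod (f t))\<^sup>2 \<le> (B * indicat_real {a..b} t)\<^sup>2" by (rule power_mono[OF B[OF elim]]) simp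
      then show ?case by (cases "t \<in> {a..b}") auto
    qed
  qed
  then show "(L2_norm f)\<^sup>2 \<le> B\<^sup>2 * (b - a)"
    unfolding integral_mult_right_zero half_line_integral_indicator[OF ab] .
qed

lemma abs_l2_disjoint_orthogonal:
  assumes "f \<in> L2_half_line" "g \<in> L2_half_line" and "\<And>t. t \<in> punctured x \<Longrightarrow> f t = 0 \<or> g t = 0"
  shows "abs_l2 f \<bullet> abs_l2 g = 0"
proof -
  have "AE t in half_line_measure. f t \<bullet> g t = 0"
    using AE_punctured
  proof eventually_elim
    case (elim t)
    then show ?case using assms(3)[of t] by auto
  qed
  then have "(\<integral>t. f t \<bullet> g t \<partial>half_line_measure) = 0" by (rule integral_eq_zero_AE)
  then show ?thesis using assms by (simp add: abs_l2_simps)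
qed

end

section \<open>The spectrum under either condition\<close>

theorem proposition6p9:
  fixes x \<beta> :: "nat \<Rightarrow> real"
  assumes "x 0 = 0" and "strict_mono x" and "filterlim x at_top sequentially"
    and "\<And>n. n \<ge> 1 \<Longrightarrow> \<beta> n \<noteq> 0"
    and "gap x \<longlonglongrightarrow> 0"
    and "\<exists>C>0. (\<forall>n\<ge>1. \<beta> n \<ge> - C * gap x n ^ 3) \<or>
               (\<forall>n\<ge>1. beta_minus \<beta> n \<le> ereal (- C * (1 / gap x n + 1 / gap x (n + 1))))"
  shows "\<not> has_discrete_spectrum (H_op x \<beta>)"
proof -
  interpret interaction_sequence x by unfold_locales (fact assms)+
  obtain C where C: "C > 0" "(\<forall>n\<ge>1. \<beta> n \<ge> - C * gap x n ^ 3) \<or>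
      (\<forall>n\<ge>1. beta_minus \<beta> n \<le> ereal (- C * (1 / gap x n + 1 / gap x (n + 1))))"
    using assms(6) by blast
  \<comment> \<open>For positive \<open>\<beta> n\<close> the value of \<open>beta_minus\<close> is
    minus infinity, so the second condition carries information at negative points only.\<close>
  have "\<beta> n \<le> - C * (1 / gap x n + 1 / gap x (Suc n))"
    if "beta_minus \<beta> n \<le> ereal (- C * (1 / gap x n + 1 / gap x (n + 1)))" "\<beta> n < 0" for n
    using that by (simp add: beta_minus_def)
  then have "(\<forall>n\<ge>1. \<beta> n \<ge> - C * gap x n ^ 3) \<or>
      (\<forall>n\<ge>1. \<beta> n < 0 \<longrightarrow> \<beta> n \<le> - C * (1 / gap x n + 1 / gap x (Suc n)))"
    using C(2) by blast
  from normalizable_bumps[OF assms(5) C(1) this]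
  obtain A M where AM: "A > 0" "M > 0"
    and bumps: "\<forall>a\<ge>A. \<exists>c \<delta>. 0 < \<delta> \<and> a \<le> c - \<delta> \<and> c + \<delta> \<le> a + 1 \<and>
      (\<forall>K R. finite K \<longrightarrow> K \<subseteq> {1..} \<longrightarrow> {n. 1 \<le> n \<and> x n \<le> a + 1} \<subseteq> K \<longrightarrow> a + 1 \<le> R \<longrightarrow>
         4 / \<delta> \<le> M * \<bar>mass \<beta> K R (bump c \<delta>)\<bar>)" .
  \<comment> \<open>A step of 4 keeps the supporting intervals, of length 3, apart.\<close>
  define a where "a k = A + 4 * real k" for k
  define P where "P k f \<longleftrightarrow> f \<in> H_min_domain x \<beta> \<and>
    (\<forall>t\<in>punctured x. t \<notin> {a k..a k + 3} \<longrightarrow> f t = 0 \<and> pderivative x (pderivative x f) t = 0) \<and>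
    (\<forall>t\<in>punctured x. cmod (pderivative x (pderivative x f) t) \<le> 2 * M) \<and>
    (\<forall>t\<in>{a k + 1..a k + 2}. f t = 1)" for k f
  have "\<exists>f. P k f" for k
  proof -
    have ak: "a k \<ge> A" "a k + 2 \<ge> A" "0 \<le> a k" using AM by (auto simp: a_def)
    define K where "K = {n. 1 \<le> n \<and> x n \<le> a k + 3}"
    have "K \<subseteq> {n. x n \<le> a k + 3}" by (auto simp: K_def)
    then have K: "finite K" "K \<subseteq> {1..}" using finite_below finite_subset by (blast, auto simp: K_def)
    obtain c1 \<delta>1 where b1: "0 < \<delta>1" "a k \<le> c1 - \<delta>1" "c1 + \<delta>1 \<le> a k + 1"
      "\<forall>K R. finite K \<longrightarrow> K \<subseteq> {1..} \<longrightarrow> {n. 1 \<le> n \<and> x n \<le> a k + 1} \<subseteq> K \<longrightarrow> a k + 1 \<le> R \<longrightarrow>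
         4 / \<delta>1 \<le> M * \<bar>mass \<beta> K R (bump c1 \<delta>1)\<bar>"
      using bumps[rule_format, OF ak(1)] by blast
    \<comment> \<open>The same construction shifted by 2, which leaves
      \<open>[a k + 1, a k + 2]\<close> free for the plateau.\<close>
    obtain c2 \<delta>2 where b2: "0 < \<delta>2" "a k + 2 \<le> c2 - \<delta>2" "c2 + \<delta>2 \<le> a k + 2 + 1"
      "\<forall>K R. finite K \<longrightarrow> K \<subseteq> {1..} \<longrightarrow> {n. 1 \<le> n \<and> x n \<le> a k + 2 + 1} \<subseteq> K \<longrightarrow> a k + 2 + 1 \<le> R \<longrightarrow>
         4 / \<delta>2 \<le> M * \<bar>mass \<beta> K R (bump c2 \<delta>2)\<bar>"
      using bumps[rule_format, OF ak(2)] by blast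
    have "4 / \<delta>1 \<le> M * \<bar>mass \<beta> K (a k + 3) (bump c1 \<delta>1)\<bar>"
      by (rule b1(4)[rule_format]) (use K in \<open>auto simp: K_def\<close>)
    moreover have "4 / \<delta>2 \<le> M * \<bar>mass \<beta> K (a k + 3) (bump c2 \<delta>2)\<bar>"
      by (rule b2(4)[rule_format]) (use K in \<open>auto simp: K_def\<close>)
    moreover have "c2 + \<delta>2 \<le> a k + 3" using b2(3) by simp
    ultimately have "\<exists>f\<in>H_min_domain x \<beta>.
      (\<forall>t\<in>punctured x. t \<notin> {a k..a k + 3} \<longrightarrow> f t = 0 \<and> pderivative x (pderivative x f) t = 0) \<and>
      (\<forall>t\<in>punctured x. cmod (pderivative x (pderivative x f) t) \<le> 2 * M) \<and>
      (\<forall>t\<in>{a k + 1..a k + 2}. f t = 1)"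
      unfolding K_def by (intro test_function[OF ak(3) AM(2) b1(1-3) b2(1,2)])
    then show ?thesis unfolding P_def by blast
  qed
  then obtain f where f: "\<And>k. P k (f k)" by metis
  define g where "g k = (\<lambda>t. - pderivative x (pderivative x (f k)) t)" for k
  have fg: "(f k, g k) \<in> H_min x \<beta>" for k using f[of k] by (auto simp: H_min_def g_def P_def)
  then have L2: "f k \<in> L2_half_line" "g k \<in> L2_half_line" for k using H_min_L2 by blast+
  have supp: "f k t = 0 \<and> g k t = 0" if "t \<in> punctured x" "t \<notin> {a k..a k + 3}" for k t
    using f[of k] that by (auto simp: P_def g_def)
  have a_nonneg: "0 \<le> a k" for k using AM by (simp add: a_def)
  have sep: "t \<notin> {a i..a i + 3} \<or> t \<notin> {a j..a j + 3}" if "i \<noteq> j" for i j t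
  proof -
    have "real i + 1 \<le> real j \<or> real j + 1 \<le> real i" using that by linarith
    then show ?thesis by (auto simp: a_def)
  qed
  have lower: "1 \<le> norm (abs_l2 (f k))" for k
  proof -
    have "(a k + 2) - (a k + 1) \<le> (L2_norm (f k))\<^sup>2"
      using f[of k] a_nonneg[of k] by (intro L2_norm_bounds(1)[OF L2(1)]) (auto simp: P_def)
    then have "1\<^sup>2 \<le> (norm (abs_l2 (f k)))\<^sup>2" by (simp add: abs_l2_simps L2)
    then show ?thesis by (rule power2_le_imp_le) simp
  qed
  \<comment> \<open>\<open>g k\<close> is bounded by \<open>2 * M\<close> on an interval of length
    3, and \<open>3 * (2 * M)\<^sup>2 \<le> (4 * M)\<^sup>2\<close>.\<close>
  have upper: "norm (abs_l2 (g k)) \<le> 4 * M" for k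
  proof -
    have "(L2_norm (g k))\<^sup>2 \<le> (2 * M)\<^sup>2 * ((a k + 3) - a k)"
    proof (rule L2_norm_bounds(2)[OF L2(2)])
      fix t assume t: "t \<in> punctured x"
      show "cmod (g k t) \<le> 2 * M * indicat_real {a k..a k + 3} t"
        using supp[OF t, of k] f[of k] t by (cases "t \<in> {a k..a k + 3}") (auto simp: P_def g_def)
    qed (use a_nonneg in auto)
    also have "\<dots> \<le> (4 * M)\<^sup>2" by (simp add: power2_eq_square)
    finally have "(norm (abs_l2 (g k)))\<^sup>2 \<le> (4 * M)\<^sup>2" by (simp add: abs_l2_simps L2)
    then show ?thesis by (rule power2_le_imp_le) (use AM in simp)
  qed
  show ?thesis unfolding H_op_def
  proof (rule symmetric_operator_not_discrete[where f = f and g = g and M = "4 * M"])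
    show "abs_l2 q \<bullet> abs_l2 p' = abs_l2 p \<bullet> abs_l2 q'"
      if "(p, q) \<in> op_closure (H_min x \<beta>)" "(p', q') \<in> op_closure (H_min x \<beta>)" for p q p' q'
      by (rule op_closure_symmetric[OF H_min_L2 H_min_inner_symmetric that])
    show "(f k, g k) \<in> op_closure (H_min x \<beta>)" for k by (rule op_closure_superset[OF fg L2])
    show "abs_l2 (f i) \<bullet> abs_l2 (f j) = 0 \<and> abs_l2 (f i) \<bullet> abs_l2 (g j) = 0 \<and> abs_l2 (g i) \<bullet> abs_l2 (g j) = 0"
      if "i \<noteq> j" for i j
      using sep[OF that] supp by (intro conjI abs_l2_disjoint_orthogonal L2) blast+
    show "abs_l2 (f k) \<noteq> 0" for k using lower[of k] by auto
    show "norm (abs_l2 (g k)) \<le> 4 * M * norm (abs_l2 (f k))" for k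
    proof -
      have "4 * M * 1 \<le> 4 * M * norm (abs_l2 (f k))" using lower[of k] AM by (intro mult_left_mono) auto
      then show ?thesis using upper[of k] by simp
    qed
  qed (rule op_closure_L2)
qed

end
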